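(* Let $(\mathcal X,d,\mu)$ be an RD-space with $\mu(\mathcal X)=\infty$, with constants $0<\kappa\le n$ as in the definition of RD-spaces. Let $s\in(0,1]$ and $p\in(n/(n+s),\infty)$. Then $\dot M^{s,p}(\mathcal X)=\mathcal A\dot F^s_{p,\infty}(\mathcal X)$ with equivalent norms.
   Context: RD-space: $(\mathcal X,d)$ is a metric space with a regular Borel measure $\mu$ such that all balls $B(x,r)=\{y:d(x,y)<r\}$ have finite positive measure, and there exist constants $0<C_1\le1\le C_2$ and $0<\kappa\le n$ such that for all $x\in\mathcal X$, $0<r<2\operatorname{diam}(\mathcal X)$ and $1\le\lambda<2\operatorname{diam}(\mathcal X)/r$, $C_1\lambda^\kappa\mu(B(x,r))\le\mu(B(x,\lambda r))\le C_2\lambda^n\mu(B(x,r))$. Hajłasz–Sobolev space: $\dot M^{s,p}(\mathcal X)$ is the set of all measurable $f\in L^p_{\rm loc}(\mathcal X)$ for which there exist a nonnegative $g\in L^p(\mathcal X)$ and a set $E\subset\mathcal X$ of measure zero such that $|f(x)-f(y)|\le[d(x,y)]^s[g(x)+g(y)]$ for all $x,y\in\mathcal X\setminus E$; $\|f\|_{\dot M^{s,p}(\mathcal X)}$ is the infimum of $\|g\|_{L^p(\mathcal X)}$ over all such $g$. Test functions: put $V_r(x)=\mu(B(x,r))$ and $V(x,y)=\mu(B(x,d(x,y)))$. For $x_0\in\mathcal X$, $r>0$, $\beta\in(0,1]$, $\gamma\in(0,\infty)$, $\mathcal G(x_0,r,\beta,\gamma)$ is the set of functions $\varphi$ on $\mathcal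 X$ for which there is $C\ge0$ with (a) $|\varphi(x)|\le C\frac1{V_r(x_0)+V(x_0,x)}\big(\frac r{r+d(x_0,x)}\big)^\gamma$ for all $x$; (b) $|\varphi(x)-\varphi(y)|\le C\big(\frac{d(x,y)}{r+d(x_0,x)}\big)^\beta\frac1{V_r(x_0)+V(x_0,x)}\big(\frac r{r+d(x_0,x)}\big)^\gamma$ whenever $d(x,y)\le(r+d(x_0,x))/2$. The norm $\|\varphi\|_{\mathcal G(x_0,r,\beta,\gamma)}$ is the infimum of such $C$. Fix $x_1\in\mathcal X$; $\mathcal G(\beta,\gamma)=\mathcal G(x_1,1,\beta,\gamma)$, and $\mathring{\mathcal G}(\beta,\gamma)$ is the subspace of those $\varphi\in\mathcal G(\beta,\gamma)$ with $\int_{\mathcal X}\varphi\,d\mu=0$. $(\mathcal G(\beta,\gamma))'$ is the dual of the Banach space $\mathcal G(\beta,\gamma)$. Grand Triebel–Lizorkin space: for $x\in\mathcal X$, $k\in\mathbb Z$ let $\mathcal A_k(x)=\{\phi\in\mathring{\mathcal G}(1,2):\|\phi\|_{\mathcal G(x,2^{-k},1,2)}\le1\}$. $\mathcal A\dot F^s_{p,\infty}(\mathcal X)$ is the set of all $f\in(\mathcal G(1,2))'$ with $\|f\|_{\mathcal A\dot F^s_{p,\infty}(\mathcal X)}=\big\|\sup_{k\in\mathbb Z}2^{ks}\sup_{\phi\in\mathcal A_k(\cdot)}|\langle f,\phi\rangle|\big\|_{L^p(\mathcal X)}<\infty$. Both spaces are considered modulo constants. The equality means: every $f\in\dot M^{s,p}(\mathcal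 X)$ is locally integrable and defines by integration an element of $(\mathcal G(1,2))'$ lying in $\mathcal A\dot F^s_{p,\infty}(\mathcal X)$; every $f\in\mathcal A\dot F^s_{p,\infty}(\mathcal X)$ coincides (modulo constants) with a locally integrable function lying in $\dot M^{s,p}(\mathcal X)$; and the two (quasi-)norms are comparable with constants independent of $f$. *)

theory Defs
  imports "HOL-Analysis.Analysis"
begin

text \<open>
  The metric space \<open>\<X>\<close> is a type of class \<open>metric_space\<close>. Functions take values in a scalar
  field \<open>'k\<close> of class \<open>{real_normed_field, banach, second_countable_topology}\<close>; \<^typ>\<open>real\<close> and
  \<^typ>\<open>complex\<close> are, up to isomorphism, its only instances (Gelfand--Mazur).
\<close>

section \<open>RD-spaces\<close>

text \<open>\<^const>\<open>diameter\<close> is \<open>0\<close> on unbounded sets, so it cannot be used here.\<close>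

definition ext_diam :: "'a::metric_space set \<Rightarrow> ereal" where
  "ext_diam S = (SUP x\<in>S. SUP y\<in>S. ereal (dist x y))"

text \<open>
  Borel regularity: open sets are measurable and every measurable set has a Borel hull of the same
  measure. The \<open>\<sigma>\<close>-algebra may be the Borel one, its completion, or anything in between.
\<close>

definition regular_borel_measure :: "'a::topological_space measure \<Rightarrow> bool" where
  "regular_borel_measure M \<longleftrightarrow>
     space M = UNIV \<and> sets borel \<subseteq> sets M \<and>
     (\<forall>A\<in>sets M. \<exists>B\<in>sets borel. A \<subseteq> B \<and> emeasure M B = emeasure M A)"

definition vol :: "'a::metric_space measure \<Rightarrow> 'a \<Rightarrow> real \<Rightarrow> real" where
  "vol M x r = measure M (ball x r)"

locale rd_space =
  fixes M :: "'a::metric_space measure" and \<kappa> n :: real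
  assumes regular: "regular_borel_measure M"
    and ball_pos_finite: "\<And>x r. 0 < r \<Longrightarrow> 0 < emeasure M (ball x r) \<and> emeasure M (ball x r) < \<infinity>"
    and dim_bounds: "0 < \<kappa>" "\<kappa> \<le> n"
    and volume_growth:
      "\<exists>C1 C2::real. 0 < C1 \<and> C1 \<le> 1 \<and> 1 \<le> C2 \<and>
         (\<forall>x r l. 0 < r \<and> ereal r < 2 * ext_diam (UNIV :: 'a set) \<and>
                  1 \<le> l \<and> ereal l < 2 * ext_diam (UNIV :: 'a set) / ereal r \<longrightarrow>
            C1 * l powr \<kappa> * vol M x r \<le> vol M x (l * r) \<and>
            vol M x (l * r) \<le> C2 * l powr n * vol M x r)"

section \<open>Lebesgue quasi-norms and Hajlasz--Sobolev spaces\<close>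

text \<open>Real powers on \<open>[0, \<infinity>]\<close>, for positive exponents.\<close>

definition epowr :: "ennreal \<Rightarrow> real \<Rightarrow> ennreal" where
  "epowr u p = (if u = \<infinity> then \<infinity> else ennreal (enn2real u powr p))"

text \<open>
  The function \<open>u\<close> need not be measurable; \<^const>\<open>nn_integral\<close> is then the lower integral.
\<close>

definition Lp_norm :: "'a measure \<Rightarrow> real \<Rightarrow> ('a \<Rightarrow> ennreal) \<Rightarrow> ennreal" where
  "Lp_norm M p u = epowr (\<integral>\<^sup>+x. epowr (u x) p \<partial>M) (1 / p)"

definition Lp_loc ::
    "'a::metric_space measure \<Rightarrow> real \<Rightarrow> ('a \<Rightarrow> 'k::real_normed_vector) set" where
  "Lp_loc M p = {f \<in> borel_measurable M.
     \<forall>x r. 0 < r \<longrightarrow> (\<integral>\<^sup>+y\<in>ball x r. ennreal (norm (f y) powr p) \<partial>M) < \<infinity>}"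

definition locally_integrable ::
    "'a::metric_space measure \<Rightarrow> ('a \<Rightarrow> 'k::{banach, second_countable_topology}) \<Rightarrow> bool" where
  "locally_integrable M f \<longleftrightarrow> (\<forall>x r. 0 < r \<longrightarrow> set_integrable M (ball x r) f)"

definition hajlasz_gradients ::
    "'a::metric_space measure \<Rightarrow> real \<Rightarrow> real \<Rightarrow> ('a \<Rightarrow> 'k::real_normed_vector) \<Rightarrow> ('a \<Rightarrow> real) set"
  where
  "hajlasz_gradients M s p f =
     {g \<in> borel_measurable M. (\<forall>x. 0 \<le> g x) \<and> Lp_norm M p (\<lambda>x. ennreal (g x)) < \<infinity> \<and>
        (\<exists>E\<in>null_sets M. \<forall>x\<in>-E. \<forall>y\<in>-E.
           norm (f x - f y) \<le> dist x y powr s * (g x + g y))}"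

definition hajlasz_space ::
    "'a::metric_space measure \<Rightarrow> real \<Rightarrow> real \<Rightarrow> ('a \<Rightarrow> 'k::real_normed_vector) set" where
  "hajlasz_space M s p = {f \<in> Lp_loc M p. hajlasz_gradients M s p f \<noteq> {}}"

definition hajlasz_norm ::
    "'a::metric_space measure \<Rightarrow> real \<Rightarrow> real \<Rightarrow> ('a \<Rightarrow> 'k::real_normed_vector) \<Rightarrow> ennreal" where
  "hajlasz_norm M s p f = (INF g\<in>hajlasz_gradients M s p f. Lp_norm M p (\<lambda>x. ennreal (g x)))"

section \<open>Test functions and distributions\<close>

definition test_bound ::
    "'a::metric_space measure \<Rightarrow> 'a \<Rightarrow> real \<Rightarrow> real \<Rightarrow> real \<Rightarrow> ('a \<Rightarrow> 'k::real_normed_vector) \<Rightarrow> real \<Rightarrow> bool"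
  where
  "test_bound M x0 r \<beta> \<gamma> \<phi> C \<longleftrightarrow> 0 \<le> C \<and>
     (\<forall>x. norm (\<phi> x) \<le>
        C * (1 / (vol M x0 r + vol M x0 (dist x0 x))) * (r / (r + dist x0 x)) powr \<gamma>) \<and>
     (\<forall>x y. dist x y \<le> (r + dist x0 x) / 2 \<longrightarrow>
        norm (\<phi> x - \<phi> y) \<le>
          C * (dist x y / (r + dist x0 x)) powr \<beta> *
            (1 / (vol M x0 r + vol M x0 (dist x0 x))) * (r / (r + dist x0 x)) powr \<gamma>)"

definition test_space ::
    "'a::metric_space measure \<Rightarrow> 'a \<Rightarrow> real \<Rightarrow> real \<Rightarrow> real \<Rightarrow> ('a \<Rightarrow> 'k::real_normed_vector) set" where
  "test_space M x0 r \<beta> \<gamma> = {\<phi>. \<exists>C. test_bound M x0 r \<beta> \<gamma> \<phi> C}"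

text \<open>The value is \<open>\<infinity>\<close> exactly outside \<^const>\<open>test_space\<close>.\<close>

definition test_norm ::
    "'a::metric_space measure \<Rightarrow> 'a \<Rightarrow> real \<Rightarrow> real \<Rightarrow> real \<Rightarrow> ('a \<Rightarrow> 'k::real_normed_vector) \<Rightarrow> ennreal"
  where
  "test_norm M x0 r \<beta> \<gamma> \<phi> = (INF C\<in>{C. test_bound M x0 r \<beta> \<gamma> \<phi> C}. ennreal C)"

definition test_space0 ::
    "'a::metric_space measure \<Rightarrow> 'a \<Rightarrow> real \<Rightarrow> real \<Rightarrow>
       ('a \<Rightarrow> 'k::{banach, second_countable_topology}) set" where
  "test_space0 M x1 \<beta> \<gamma> = {\<phi> \<in> test_space M x1 1 \<beta> \<gamma>. (\<integral>x. \<phi> x \<partial>M) = 0}"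

text \<open>
  An element of the dual is represented by a map on all functions, of which only the restriction
  to \<open>test_space M x1 1 \<beta> \<gamma>\<close> matters.
\<close>

definition test_dual ::
    "'a::metric_space measure \<Rightarrow> 'a \<Rightarrow> real \<Rightarrow> real \<Rightarrow> (('a \<Rightarrow> 'k::real_normed_field) \<Rightarrow> 'k) set" where
  "test_dual M x1 \<beta> \<gamma> =
     {F. (\<forall>\<phi>\<in>test_space M x1 1 \<beta> \<gamma>. \<forall>\<psi>\<in>test_space M x1 1 \<beta> \<gamma>. \<forall>a b.
            F (\<lambda>x. a * \<phi> x + b * \<psi> x) = a * F \<phi> + b * F \<psi>) \<and>
         (\<exists>C::real. \<forall>\<phi>\<in>test_space M x1 1 \<beta> \<gamma>.
            ennreal (norm (F \<phi>)) \<le> ennreal C * test_norm M x1 1 \<beta> \<gamma> \<phi>)}"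

definition integral_functional ::
    "'a measure \<Rightarrow> ('a \<Rightarrow> 'k::{real_normed_field, banach, second_countable_topology}) \<Rightarrow>
       ('a \<Rightarrow> 'k) \<Rightarrow> 'k" where
  "integral_functional M f = (\<lambda>\<phi>. \<integral>x. f x * \<phi> x \<partial>M)"

section \<open>Grand Triebel--Lizorkin spaces\<close>

definition grand_class ::
    "'a::metric_space measure \<Rightarrow> 'a \<Rightarrow> int \<Rightarrow> 'a \<Rightarrow>
       ('a \<Rightarrow> 'k::{banach, second_countable_topology}) set" where
  "grand_class M x1 k x = {\<phi> \<in> test_space0 M x1 1 2. test_norm M x (2 powi (- k)) 1 2 \<phi> \<le> 1}"

definition grand_TL_norm ::
    "'a::metric_space measure \<Rightarrow> 'a \<Rightarrow> real \<Rightarrow> real \<Rightarrow>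
       (('a \<Rightarrow> 'k::{real_normed_field, banach, second_countable_topology}) \<Rightarrow> 'k) \<Rightarrow> ennreal" where
  "grand_TL_norm M x1 s p F =
     Lp_norm M p (\<lambda>x. SUP k::int. ennreal (2 powr (of_int k * s)) *
                        (SUP \<phi>\<in>grand_class M x1 k x. ennreal (norm (F \<phi>))))"

definition grand_TL_space ::
    "'a::metric_space measure \<Rightarrow> 'a \<Rightarrow> real \<Rightarrow> real \<Rightarrow>
       (('a \<Rightarrow> 'k::{real_normed_field, banach, second_countable_topology}) \<Rightarrow> 'k) set" where
  "grand_TL_space M x1 s p = {F \<in> test_dual M x1 1 2. grand_TL_norm M x1 s p F < \<infinity>}"

end

theory Submission
  imports Defs
begin

text \<open>
  All estimates are expressed through the weight \<open>w\<close> with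
  \<open>w(u) = (r / (r + d(x, u)))\<^sup>2 / \<mu>(B(x, r + d(x, u)))\<close>, which up to constants governs
  \<open>\<G>(x, r, 1, 2)\<close>.

  From Sobolev to distributions: put \<open>q = n / (n + s) < min 1 p\<close>. A telescoping argument along points
  where the gradient \<open>g\<close> is small gives
  \<open>|f(z) - f(x)| \<le> C \<rho>\<^sup>s (g(x) + A + A\<^sup>1\<^sup>-\<^sup>q g(z)\<^sup>q)\<close> for \<open>d(x, z) < \<rho>\<close>, where \<open>A\<^sup>q\<close>
  bounds the maximal function of \<open>g\<^sup>q\<close> at \<open>x\<close>. Hence the oscillation of \<open>f\<close> on \<open>B(x, \<rho>)\<close> is at
  most \<open>C \<rho>\<^sup>s (g + (M g\<^sup>q)\<^sup>1\<^sup>/\<^sup>q)(x)\<close>, and the maximal theorem in \<open>L\<^sup>p\<^sup>/\<^sup>q\<close> applies because \<open>q < p\<close>.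

  From distributions to Sobolev: with normalized bumps \<open>\<psi>(x, r)\<close>, the values \<open>F(\<psi>(x, r))\<close> at
  neighbouring points and scales differ by at most \<open>C r\<^sup>s\<close> times the grand maximal function, so they
  converge as \<open>r\<close> tends to \<open>0\<close> to a function \<open>h\<close> having that maximal function as a gradient. The
  functional \<open>F - h\<close> is then of order \<open>r\<^sup>s\<close> on every bump of scale \<open>r\<close>. It vanishes on compactly
  supported test functions, by a partition of unity at scale \<open>r \<rightarrow> 0\<close> (again because
  \<open>p > n / (n + s)\<close>), and on the tail of a test function outside \<open>B(x, R)\<close> it is
  \<open>O(R\<^sup>s\<^sup>-\<^sup>2)\<close>, because the decay exponent \<open>2\<close> exceeds \<open>s\<close>.
\<close>

section \<open>Molecules\<close>

text \<open>The obstacle is that \<open>p\<close> may be at most 1. Only powers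
  \<open>g powr q\<close> with \<open>q < p\<close> can be averaged, and this forces the threshold:
  if the averages of \<open>g powr q\<close> are bounded by \<open>A powr q\<close>, a chain
  balanced at the point z produces the power \<open>1 - s * q / n\<close> of \<open>g z\<close>,
  which those same averages control only if it is at most \<open>q\<close>, that is, if
  \<open>q\<close> is at least \<open>n / (n + s)\<close>. The bound of the Sobolev norm of
  \<open>f\<close> by the norm of its functional uses the second construction as well: the bump
  values of that functional converge to \<open>f\<close> almost everywhere, so the gradient
  extracted from the functional is a gradient of \<open>f\<close>. The bumps have integral 1, hence
  the limit function comes with its additive constant already fixed.\<close>

text \<open>
  The constants \<open>chg\<close>, \<open>cw\<close>, \<open>cpsi\<close>, \<open>cM\<close>, ... are explicit so that they visibly depend on
  \<open>K\<close>, \<open>n\<close>, \<open>s\<close>, \<open>p\<close> only; the final constant has to be chosen before \<open>f\<close> and \<open>F\<close>.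
\<close>

lemma mult_ge1_le: "1 \<le> a \<Longrightarrow> 0 \<le> b \<Longrightarrow> b \<le> a * b" for a b :: real
  by (simp add: mult_le_cancel_right1)

section \<open>Balls, volumes and weights in a doubling space\<close>

locale doubling_space =
  fixes M :: "'a::metric_space measure" and K n :: real
  assumes space_M [simp]: "space M = UNIV"
    and borel_sub: "sets borel \<subseteq> sets M"
    and ball_pos: "0 < r \<Longrightarrow> 0 < emeasure M (ball x r)"
    and ball_finite: "emeasure M (ball x r) < \<infinity>"
    and K_ge_1: "1 \<le> K"
    and n_pos: "0 < n"
    and growth: "0 < r \<Longrightarrow> 1 \<le> l \<Longrightarrow> vol M x (l * r) \<le> K * l powr n * vol M x r"
begin

lemma open_in_M [measurable]: "open S \<Longrightarrow> S \<in> sets M"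
  using borel_sub by auto

lemma ball_in_M [measurable]: "ball x r \<in> sets M"
  by (simp add: open_in_M)

lemma continuous_measurable:
  fixes f :: "'a \<Rightarrow> 'b::topological_space"
  assumes "continuous_on UNIV f"
  shows "f \<in> borel_measurable M"
  using assms borel_sub
  by (intro borel_measurableI) (auto simp: continuous_on_open_vimage vimage_def intro!: open_in_M)

lemma dist_measurable [measurable]: "(\<lambda>y. dist x y) \<in> borel_measurable M"
  by (intro continuous_measurable continuous_intros)

lemma emeasure_ball: "emeasure M (ball x r) = ennreal (vol M x r)"
  unfolding vol_def using ball_finite[of x r] by (intro emeasure_eq_ennreal_measure) auto

lemma vol_nonneg [simp]: "0 \<le> vol M x r"
  by (simp add: vol_def)

lemma vol_pos: "0 < r \<Longrightarrow> 0 < vol M x r"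
  using ball_pos[of r x] by (simp add: emeasure_ball)

lemma vol_subset: "ball x r \<subseteq> ball y R \<Longrightarrow> vol M x r \<le> vol M y R"
  using emeasure_mono[of "ball x r" "ball y R" M] by (simp add: emeasure_ball)

lemma vol_mono: "r \<le> R \<Longrightarrow> vol M x r \<le> vol M x R"
  by (intro vol_subset) auto

text \<open>Doubling is applied only in this form; \<open>l\<close> is read off from the triangle
  inequality that puts \<open>ball y R\<close> into \<open>ball x (l * r)\<close>.\<close>

lemma vol_compare:
  assumes "0 < r" "1 \<le> l" "dist x y + R \<le> l * r"
  shows "vol M y R \<le> K * l powr n * vol M x r"
proof -
  have "ball y R \<subseteq> ball x (l * r)"
    using assms(3) by (auto simp: subset_eq) (metis dist_triangle_le le_less_trans less_le_not_le add_left_mono not_le order_less_le_trans dist_triangle add_strict_left_mono)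
  then have "vol M y R \<le> vol M x (l * r)" by (rule vol_subset)
  also have "\<dots> \<le> K * l powr n * vol M x r" using growth assms by auto
  finally show ?thesis .
qed

text \<open>By doubling, the denominator \<open>vol M x r + vol M x (dist x u)\<close> of the test
  bounds is comparable to the volume of this single ball, so a change of centre and scale needs just
  one volume comparison.\<close>

definition wt :: "'a \<Rightarrow> real \<Rightarrow> 'a \<Rightarrow> real" where
  "wt x r u = (r / (r + dist x u))\<^sup>2 / vol M x (r + dist x u)"

definition wt1 :: "'a \<Rightarrow> real \<Rightarrow> 'a \<Rightarrow> real" where
  "wt1 x r u = wt x r u / (r + dist x u)"

text \<open>
  Up to constants this is \<^const>\<open>test_bound\<close> with \<open>\<beta> = 1\<close>, \<open>\<gamma> = 2\<close>. The Lipschitz condition is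
  symmetric and free of the restriction to nearby points, so that a change of centre or scale is
  just a comparison of weights.
\<close>

definition molecule :: "'a \<Rightarrow> real \<Rightarrow> ('a \<Rightarrow> 'k::real_normed_vector) \<Rightarrow> real \<Rightarrow> bool" where
  "molecule x r \<phi> D \<longleftrightarrow> (\<forall>u. norm (\<phi> u) \<le> D * wt x r u) \<and>
     (\<forall>u v. norm (\<phi> u - \<phi> v) \<le> D * (dist u v * (wt1 x r u + wt1 x r v)))"

lemma K2_ge_1: "1 \<le> K * 2 powr n"
  using K_ge_1 n_pos ge_one_powr_ge_zero[of 2 n] by (simp add: mult_ge1_I)

lemma wt_nonneg: "0 \<le> wt x r u"
  by (simp add: wt_def)

lemma wt1_nonneg: "0 \<le> r \<Longrightarrow> 0 \<le> wt1 x r u"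
  by (simp add: wt1_def wt_nonneg)

text \<open>The cost of moving by a factor \<open>A\<close>, as collected in
  \<open>wt_change\<close>: the volume ratio gives the power of \<open>3 * A\<^sup>2\<close>, the
  squared ratio of scales gives \<open>4 * A ^ 6\<close>, and the extra denominator of
  \<open>wt1\<close> gives \<open>2 * A\<^sup>2\<close>. One constant then serves both
  weights.\<close>

definition chg :: "real \<Rightarrow> real" where
  "chg A = K * (3 * A\<^sup>2) powr n * (8 * A ^ 8)"

lemma chg_pos: "0 < A \<Longrightarrow> 0 < chg A"
  using K_ge_1 by (simp add: chg_def)

lemma wt_change:
  assumes r: "0 < r" "0 < r'" and A: "1 \<le> A" "dist x y \<le> A * r'" "r \<le> A * r'" "r' \<le> A * r"
  shows "wt x r u \<le> chg A * wt y r' u" "wt1 x r u \<le> chg A * wt1 y r' u"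
proof -
  define \<rho> \<rho>' where d: "\<rho> = r + dist x u" "\<rho>' = r' + dist y u"
  have pos: "0 < \<rho>" "0 < \<rho>'" using r by (auto simp: d intro: add_pos_nonneg)
  have A2: "1 \<le> A\<^sup>2" "A \<le> A\<^sup>2" using A(1) by (auto simp: power2_eq_square mult_ge1_I intro: mult_le_cancel_left1[THEN iffD2])
  have rr: "A * r' \<le> A\<^sup>2 * r" using A by (simp add: power2_eq_square mult.assoc mult_left_mono)
  have "r \<le> \<rho>" by (simp add: d)
  then have rr2: "A\<^sup>2 * r \<le> A\<^sup>2 * \<rho>" using A2 by (intro mult_left_mono) auto
  have dxu: "dist x u \<le> A\<^sup>2 * dist x u" using A2(1) by (simp add: mult_le_cancel_right1)
  have "\<rho>' \<le> r' + dist x y + dist x u"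
    unfolding d using dist_triangle[of y u x] by (simp add: dist_commute)
  also have "\<dots> \<le> A * r + A\<^sup>2 * r + A\<^sup>2 * dist x u" using A rr dxu by linarith
  also have "\<dots> \<le> A\<^sup>2 * r + A\<^sup>2 * r + A\<^sup>2 * dist x u" using A2 r by (simp add: mult_right_mono)
  also have "\<dots> \<le> 2 * A\<^sup>2 * \<rho>" unfolding d using A2 by (simp add: algebra_simps)
  finally have r1: "\<rho>' \<le> 2 * A\<^sup>2 * \<rho>" .
  have "vol M y \<rho>' \<le> K * (3 * A\<^sup>2) powr n * vol M x \<rho>"
  proof (rule vol_compare[OF pos(1)])
    show "1 \<le> 3 * A\<^sup>2" using A2(1) by linarith
    show "dist x y + \<rho>' \<le> 3 * A\<^sup>2 * \<rho>" using A(2) rr rr2 r1 by linarith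
  qed
  then have v: "1 / vol M x \<rho> \<le> K * (3 * A\<^sup>2) powr n * (1 / vol M y \<rho>')"
    using vol_pos[OF pos(1), of x] vol_pos[OF pos(2), of y] by (simp add: field_simps)
  have "r / \<rho> \<le> (A * r') / \<rho>" using A pos by (intro divide_right_mono) auto
  also have "1 / \<rho> \<le> 2 * A\<^sup>2 / \<rho>'" using r1 pos by (simp add: field_simps)
  then have inv: "1 / \<rho> \<le> 2 * A\<^sup>2 / \<rho>'" .
  have "(A * r') / \<rho> \<le> A * r' * (2 * A\<^sup>2 / \<rho>')"
    using mult_left_mono[OF inv, of "A * r'"] A r by simp
  finally have "r / \<rho> \<le> 2 * A ^ 3 * (r' / \<rho>')" by (simp add: power2_eq_square power3_eq_cube mult_ac)
  then have "(r / \<rho>)\<^sup>2 \<le> (2 * A ^ 3 * (r' / \<rho>'))\<^sup>2" using r pos by (intro power_mono) auto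
  then have q: "(r / \<rho>)\<^sup>2 \<le> 4 * A ^ 6 * (r' / \<rho>')\<^sup>2" by (simp add: power_mult_distrib power_divide flip: power_mult)
  have "wt x r u = (r / \<rho>)\<^sup>2 * (1 / vol M x \<rho>)" by (simp add: wt_def d)
  also have "\<dots> \<le> (4 * A ^ 6 * (r' / \<rho>')\<^sup>2) * (K * (3 * A\<^sup>2) powr n * (1 / vol M y \<rho>'))"
    using q v A by (intro mult_mono) auto
  also have "\<dots> = K * (3 * A\<^sup>2) powr n * (4 * A ^ 6) * wt y r' u" by (simp add: wt_def d)
  finally have w: "wt x r u \<le> K * (3 * A\<^sup>2) powr n * (4 * A ^ 6) * wt y r' u" .
  have "wt1 x r u = wt x r u * (1 / \<rho>)" by (simp add: wt1_def d)
  also have "\<dots> \<le> (K * (3 * A\<^sup>2) powr n * (4 * A ^ 6) * wt y r' u) * (2 * A\<^sup>2 / \<rho>')"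
    using w inv pos wt_nonneg K_ge_1 A by (intro mult_mono) auto
  also have "\<dots> = chg A * wt1 y r' u" by (simp add: wt1_def chg_def d field_simps flip: power_add)
  finally show "wt1 x r u \<le> chg A * wt1 y r' u" .
  have "4 * A ^ 6 \<le> 8 * A ^ 8" using power_increasing[of 6 8 A] A(1) zero_le_power[of A 8] by linarith
  then have "K * (3 * A\<^sup>2) powr n * (4 * A ^ 6) * wt y r' u \<le> chg A * wt y r' u"
    unfolding chg_def using K_ge_1 wt_nonneg by (intro mult_right_mono mult_left_mono) auto
  with w show "wt x r u \<le> chg A * wt y r' u" by linarith
qed

lemma molecule_change:
  assumes "molecule x r \<phi> D" "0 \<le> D" "0 < r" "0 < r'" "1 \<le> A" "dist x y \<le> A * r'" "r \<le> A * r'" "r' \<le> A * r"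
  shows "molecule y r' \<phi> (chg A * D)"
  unfolding molecule_def
proof safe
  note w = wt_change[OF assms(3-8)]
  fix u v
  have "norm (\<phi> u) \<le> D * wt x r u" using assms(1) by (simp add: molecule_def)
  also have "\<dots> \<le> D * (chg A * wt y r' u)" using w assms(2) by (intro mult_left_mono)
  finally show "norm (\<phi> u) \<le> chg A * D * wt y r' u" by (simp add: mult_ac)
  have "norm (\<phi> u - \<phi> v) \<le> D * (dist u v * (wt1 x r u + wt1 x r v))"
    using assms(1) by (simp add: molecule_def)
  also have "\<dots> \<le> D * (dist u v * (chg A * wt1 y r' u + chg A * wt1 y r' v))"
    using w assms(2) by (intro mult_left_mono add_mono) auto
  finally show "norm (\<phi> u - \<phi> v) \<le> chg A * D * (dist u v * (wt1 y r' u + wt1 y r' v))"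
    by (simp add: algebra_simps)
qed

lemma molecule_mono:
  assumes "molecule x r \<phi> D" "D \<le> D'" "0 \<le> r"
  shows "molecule x r \<phi> D'"
  unfolding molecule_def
proof safe
  fix u v
  have "norm (\<phi> u) \<le> D * wt x r u" "D * wt x r u \<le> D' * wt x r u"
    using assms wt_nonneg by (auto simp: molecule_def intro!: mult_right_mono)
  then show "norm (\<phi> u) \<le> D' * wt x r u" by simp
  have "norm (\<phi> u - \<phi> v) \<le> D * (dist u v * (wt1 x r u + wt1 x r v))"
    using assms(1) by (simp add: molecule_def)
  also have "\<dots> \<le> D' * (dist u v * (wt1 x r u + wt1 x r v))"
    using assms wt1_nonneg by (intro mult_right_mono) (auto intro!: mult_nonneg_nonneg add_nonneg_nonneg)
  finally show "norm (\<phi> u - \<phi> v) \<le> D' * (dist u v * (wt1 x r u + wt1 x r v))" .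
qed

lemma molecule_add:
  assumes "molecule x r \<phi> D" "molecule x r \<psi> D'"
  shows "molecule x r (\<lambda>z. \<phi> z + \<psi> z) (D + D')"
  unfolding molecule_def
proof safe
  fix u v
  show "norm (\<phi> u + \<psi> u) \<le> (D + D') * wt x r u"
    using assms norm_triangle_ineq[of "\<phi> u" "\<psi> u"] by (auto simp: molecule_def distrib_right intro: order_trans[OF _ add_mono])
  have "norm (\<phi> u + \<psi> u - (\<phi> v + \<psi> v)) \<le> norm (\<phi> u - \<phi> v) + norm (\<psi> u - \<psi> v)"
    by (rule norm_diff_triangle_ineq)
  also have "\<dots> \<le> (D + D') * (dist u v * (wt1 x r u + wt1 x r v))"
    using assms by (auto simp: molecule_def distrib_right[of D] intro!: add_mono)
  finally show "norm (\<phi> u + \<psi> u - (\<phi> v + \<psi> v)) \<le> (D + D') * (dist u v * (wt1 x r u + wt1 x r v))" .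
qed

lemma molecule_cmult:
  fixes \<phi> :: "'a \<Rightarrow> 'k::real_normed_field"
  assumes "molecule x r \<phi> D"
  shows "molecule x r (\<lambda>z. c * \<phi> z) (norm c * D)"
  using assms unfolding molecule_def
  by (auto simp: norm_mult mult.assoc mult_left_mono simp flip: right_diff_distrib)

text \<open>Near points are handled by the given Lipschitz bound. For far points both radii
  \<open>r + dist x u\<close> and \<open>r + dist x v\<close> are at most
  \<open>3 * dist u v\<close>, so the size bounds at the two points already have Lipschitz form;
  this is the factor 3.\<close>

lemma test_bound_molecule:
  assumes "test_bound M x r 1 2 \<phi> C" and r: "0 < r"
  shows "molecule x r \<phi> (3 * K * 2 powr n * C)"
proof -
  define k2 where "k2 = K * 2 powr n"
  have C: "0 \<le> C" using assms(1) by (simp add: test_bound_def)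
  have k2: "1 \<le> k2" unfolding k2_def by (rule K2_ge_1)
  have w: "(1 / (vol M x r + vol M x (dist x u))) * (r / (r + dist x u)) powr 2 \<le> k2 * wt x r u" for u
  proof -
    let ?\<rho> = "r + dist x u"
    have "vol M x ?\<rho> \<le> k2 * vol M x (max r (dist x u))"
      unfolding k2_def using r by (intro vol_compare) auto
    also have "\<dots> \<le> k2 * (vol M x r + vol M x (dist x u))"
      using k2 by (intro mult_left_mono) (auto simp: max_def)
    finally have "1 / (vol M x r + vol M x (dist x u)) \<le> k2 / vol M x ?\<rho>"
      using vol_pos[of ?\<rho> x] vol_pos[OF r, of x] r by (simp add: field_simps add_pos_nonneg)
    then have "(1 / (vol M x r + vol M x (dist x u))) * (r / ?\<rho>)\<^sup>2 \<le> (k2 / vol M x ?\<rho>) * (r / ?\<rho>)\<^sup>2"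
      by (rule mult_right_mono) simp
    then show ?thesis using r by (simp add: wt_def add_pos_nonneg)
  qed
  have a: "norm (\<phi> u) \<le> C * (k2 * wt x r u)" for u
  proof -
    have "norm (\<phi> u) \<le> C * ((1 / (vol M x r + vol M x (dist x u))) * (r / (r + dist x u)) powr 2)"
      using assms(1) by (simp add: test_bound_def mult.assoc)
    also have "\<dots> \<le> C * (k2 * wt x r u)" using w C by (rule mult_left_mono)
    finally show ?thesis .
  qed
  have near: "norm (\<phi> u - \<phi> v) \<le> C * k2 * dist u v * wt1 x r u" if "dist u v \<le> (r + dist x u) / 2" for u v
  proof -
    have "norm (\<phi> u - \<phi> v) \<le> C * (dist u v / (r + dist x u)) *
       ((1 / (vol M x r + vol M x (dist x u))) * (r / (r + dist x u)) powr 2)"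
      using assms(1) that r by (simp add: test_bound_def mult.assoc add_pos_nonneg)
    also have "\<dots> \<le> C * (dist u v / (r + dist x u)) * (k2 * wt x r u)"
      using w C r by (intro mult_left_mono) auto
    finally show ?thesis by (simp add: wt1_def mult_ac)
  qed
  show ?thesis unfolding molecule_def
  proof safe
    fix u v
    have "norm (\<phi> u) \<le> C * (k2 * wt x r u)" by (rule a)
    also have "\<dots> \<le> 3 * (C * (k2 * wt x r u))" using C k2 wt_nonneg by simp
    finally show "norm (\<phi> u) \<le> 3 * K * 2 powr n * C * wt x r u" by (simp add: k2_def mult_ac)
    let ?B = "C * k2 * dist u v * (wt1 x r u + wt1 x r v)"
    have "norm (\<phi> u - \<phi> v) \<le> 3 * ?B"
    proof (cases "dist u v \<le> (r + dist x u) / 2")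
      case True
      have "norm (\<phi> u - \<phi> v) \<le> C * k2 * dist u v * wt1 x r u" by (rule near[OF True])
      also have "\<dots> \<le> ?B" using C k2 r wt1_nonneg by (intro mult_left_mono) auto
      also have "?B \<le> 3 * ?B" using C k2 r wt1_nonneg by simp
      finally show ?thesis .
    next
      case False
      have "dist x v \<le> dist x u + dist u v" by (rule dist_triangle)
      then have l: "r + dist x u \<le> 3 * dist u v \<and> r + dist x v \<le> 3 * dist u v"
        using False r zero_le_dist[of u v] by argo
      have wl: "wt x r z \<le> 3 * dist u v * wt1 x r z" if "r + dist x z \<le> 3 * dist u v" for z
      proof -
        have "wt x r z = (r + dist x z) * wt1 x r z" using r by (simp add: wt1_def add_pos_nonneg less_imp_neq[symmetric])
        also have "\<dots> \<le> 3 * dist u v * wt1 x r z" using that r wt1_nonneg by (intro mult_right_mono) auto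
        finally show ?thesis .
      qed
      have "norm (\<phi> u - \<phi> v) \<le> norm (\<phi> u) + norm (\<phi> v)" by (rule norm_triangle_ineq4)
      also have "\<dots> \<le> C * (k2 * wt x r u) + C * (k2 * wt x r v)" using a by (intro add_mono)
      also have "\<dots> \<le> C * (k2 * (3 * dist u v * wt1 x r u)) + C * (k2 * (3 * dist u v * wt1 x r v))"
        using C k2 wl l by (intro add_mono mult_left_mono) auto
      finally show ?thesis by (simp add: algebra_simps)
    qed
    then show "norm (\<phi> u - \<phi> v) \<le> 3 * K * 2 powr n * C * (dist u v * (wt1 x r u + wt1 x r v))"
      by (simp add: k2_def mult_ac)
  qed
qed

text \<open>Near points have comparable radii, so the weight at \<open>v\<close> is absorbed by the
  one at \<open>u\<close>; this costs \<open>1 + 8 * K * 2 powr n\<close>. The remaining factor 2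
  replaces one volume by the sum of two.\<close>

lemma molecule_test_bound:
  assumes "molecule x r \<phi> D" and r: "0 < r" and D: "0 \<le> D"
  shows "test_bound M x r 1 2 \<phi> (18 * K * 2 powr n * D)"
proof -
  define k2 where "k2 = K * 2 powr n"
  have k2: "1 \<le> k2" unfolding k2_def by (rule K2_ge_1)
  have w: "wt x r u \<le> 2 * ((1 / (vol M x r + vol M x (dist x u))) * (r / (r + dist x u)) powr 2)" for u
  proof -
    let ?\<rho> = "r + dist x u"
    have "vol M x r + vol M x (dist x u) \<le> 2 * vol M x ?\<rho>"
      using vol_mono[of r ?\<rho> x] vol_mono[of "dist x u" ?\<rho> x] r by simp
    then have "1 / vol M x ?\<rho> \<le> 2 * (1 / (vol M x r + vol M x (dist x u)))"
      using vol_pos[of ?\<rho> x] vol_pos[OF r, of x] r by (simp add: field_simps add_pos_nonneg)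
    then have "(1 / vol M x ?\<rho>) * (r / ?\<rho>)\<^sup>2 \<le> (2 * (1 / (vol M x r + vol M x (dist x u)))) * (r / ?\<rho>)\<^sup>2"
      by (rule mult_right_mono) simp
    then show ?thesis using r by (simp add: wt_def add_pos_nonneg)
  qed
  have near: "wt1 x r v \<le> 8 * k2 * wt1 x r u" if "dist u v \<le> (r + dist x u) / 2" for u v
  proof -
    let ?\<rho> = "r + dist x u" and ?\<rho>' = "r + dist x v"
    have pos: "0 < ?\<rho>" "0 < ?\<rho>'" using r by (auto intro: add_pos_nonneg)
    have "dist x u \<le> dist x v + dist u v" using dist_triangle[of x u v] by (simp add: dist_commute)
    then have le: "?\<rho> \<le> 2 * ?\<rho>'" using that by auto
    have "vol M x ?\<rho> \<le> k2 * vol M x ?\<rho>'"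
      unfolding k2_def using pos le by (intro vol_compare) auto
    then have v: "1 / vol M x ?\<rho>' \<le> k2 * (1 / vol M x ?\<rho>)"
      using vol_pos[OF pos(1), of x] vol_pos[OF pos(2), of x] by (simp add: field_simps)
    have i: "1 / ?\<rho>' \<le> 2 * (1 / ?\<rho>)" using le pos by (simp add: field_simps)
    have "r * (1 / ?\<rho>') \<le> r * (2 * (1 / ?\<rho>))" using i r by (intro mult_left_mono) auto
    then have "(r / ?\<rho>')\<^sup>2 \<le> (2 * (r / ?\<rho>))\<^sup>2" using r by (intro power_mono) (auto simp: mult_ac)
    then have q: "(r / ?\<rho>')\<^sup>2 \<le> 4 * (r / ?\<rho>)\<^sup>2" by (simp add: power_mult_distrib power_divide)
    have "wt1 x r v = (r / ?\<rho>')\<^sup>2 * (1 / vol M x ?\<rho>') * (1 / ?\<rho>')" by (simp add: wt1_def wt_def)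
    also have "\<dots> \<le> (4 * (r / ?\<rho>)\<^sup>2) * (k2 * (1 / vol M x ?\<rho>)) * (2 * (1 / ?\<rho>))"
      using q v i pos k2 by (intro mult_mono) auto
    also have "\<dots> = 8 * k2 * wt1 x r u" by (simp add: wt1_def wt_def)
    finally show ?thesis .
  qed
  show ?thesis unfolding test_bound_def
  proof (intro conjI allI impI)
    show "0 \<le> 18 * K * 2 powr n * D" using K_ge_1 D by simp
    fix u
    have "norm (\<phi> u) \<le> D * wt x r u" using assms(1) by (simp add: molecule_def)
    also have "\<dots> \<le> D * (2 * ((1 / (vol M x r + vol M x (dist x u))) * (r / (r + dist x u)) powr 2))"
      using w D by (rule mult_left_mono)
    also have "\<dots> \<le> 9 * k2 * (D * (2 * ((1 / (vol M x r + vol M x (dist x u))) * (r / (r + dist x u)) powr 2)))"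
      using D k2 by (intro mult_ge1_le) (auto intro!: mult_nonneg_nonneg)
    finally show "norm (\<phi> u) \<le> 18 * K * 2 powr n * D * (1 / (vol M x r + vol M x (dist x u))) * (r / (r + dist x u)) powr 2"
      by (simp add: k2_def mult_ac)
    fix v assume uv: "dist u v \<le> (r + dist x u) / 2"
    have "norm (\<phi> u - \<phi> v) \<le> D * (dist u v * (wt1 x r u + wt1 x r v))"
      using assms(1) by (simp add: molecule_def)
    also have "\<dots> \<le> D * (dist u v * (9 * k2 * wt1 x r u))"
      using near[OF uv] k2 D wt1_nonneg[of r x u] r by (intro mult_left_mono) (auto simp: mult_le_cancel_right1 intro: order_trans[OF add_mono[of "wt1 x r u" "k2 * wt1 x r u"]])
    also have "\<dots> = 9 * k2 * D * (dist u v / (r + dist x u)) * wt x r u" by (simp add: wt1_def)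
    also have "\<dots> \<le> 9 * k2 * D * (dist u v / (r + dist x u)) * (2 * ((1 / (vol M x r + vol M x (dist x u))) * (r / (r + dist x u)) powr 2))"
      using w D k2 r by (intro mult_left_mono) auto
    finally show "norm (\<phi> u - \<phi> v) \<le> 18 * K * 2 powr n * D * (dist u v / (r + dist x u)) powr 1 *
        (1 / (vol M x r + vol M x (dist x u))) * (r / (r + dist x u)) powr 2"
      using r by (simp add: k2_def mult_ac add_pos_nonneg)
  qed
qed

section \<open>Integrals against the weight\<close>

definition cw :: real where "cw = 8 * K * 2 powr n"

lemma cw_pos: "0 < cw"
  using K_ge_1 by (simp add: cw_def)

text \<open>For the least such \<open>i\<close> the radius \<open>2 ^ i * r\<close> is at most twice
  \<open>r + dist x y\<close>. The weight is thus dominated by a single term of a series over full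
  balls, which spares a decomposition into annuli.\<close>

lemma wt_le_shells:
  assumes r: "0 < r"
  shows "\<exists>i::nat. dist x y < 2 ^ i * r \<and> wt x r y \<le> 4 * K * 2 powr n * (1/4) ^ i / vol M x (2 ^ i * r)"
proof -
  define i where "i = (LEAST i::nat. dist x y < 2 ^ i * r)"
  have "\<exists>i::nat. dist x y < 2 ^ i * r"
    using real_arch_pow[of 2 "dist x y / r"] r by (auto simp: field_simps)
  then have i: "dist x y < 2 ^ i * r" unfolding i_def by (rule LeastI_ex)
  let ?\<rho> = "r + dist x y"
  have pos: "0 < ?\<rho>" using r by (simp add: add_pos_nonneg)
  have le: "2 ^ i * r \<le> 2 * ?\<rho>"
  proof (cases i)
    case (Suc j)
    have "\<not> dist x y < 2 ^ j * r"
      using not_less_Least[of j "\<lambda>i. dist x y < 2 ^ i * r"] Suc by (simp add: i_def)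
    then show ?thesis using r Suc by simp
  qed (use r zero_le_dist[of x y] in simp)
  have "vol M x (2 ^ i * r) \<le> K * 2 powr n * vol M x ?\<rho>"
    using pos le by (intro vol_compare) auto
  then have v: "1 / vol M x ?\<rho> \<le> K * 2 powr n * (1 / vol M x (2 ^ i * r))"
    using vol_pos[of ?\<rho> x] vol_pos[of "2 ^ i * r" x] r pos by (simp add: field_simps)
  have "r / ?\<rho> \<le> 2 * (1/2) ^ i" using le pos by (simp add: field_simps power_divide)
  then have "(r / ?\<rho>)\<^sup>2 \<le> (2 * (1/2) ^ i)\<^sup>2" using r pos by (intro power_mono) auto
  also have "\<dots> = 4 * (1/4) ^ i" by (simp add: power_mult_distrib power_divide flip: power_mult) (simp add: power_mult mult.commute[of i])
  finally have "(r / ?\<rho>)\<^sup>2 * (1 / vol M x ?\<rho>) \<le> 4 * (1/4) ^ i * (K * 2 powr n * (1 / vol M x (2 ^ i * r)))"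
    using v by (intro mult_mono) auto
  then show ?thesis using i by (auto simp: wt_def mult_ac intro!: exI[of _ i])
qed

text \<open>The quadratic decay of the weight gives \<open>(1/4) ^ i\<close> on the i-th ball, while
  the averages grow by at most \<open>2 ^ i\<close> because \<open>s \<le> 1\<close>. The remaining
  series with ratio 1/2 sums to 2, so \<open>cw\<close> is twice the shell constant.\<close>

lemma nn_integral_wt:
  fixes H :: "'a \<Rightarrow> ennreal"
  assumes [measurable]: "H \<in> borel_measurable M" and r: "0 < r" and s: "0 \<le> s" "s \<le> 1"
    and A: "\<And>\<rho>. r \<le> \<rho> \<Longrightarrow> (\<integral>\<^sup>+y\<in>ball x \<rho>. H y \<partial>M) \<le> ennreal (\<rho> powr s * vol M x \<rho>) * A"
  shows "(\<integral>\<^sup>+y. H y * ennreal (wt x r y) \<partial>M) \<le> ennreal (cw * r powr s) * A"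
proof -
  define c where "c = 4 * K * 2 powr n"
  have c: "0 \<le> c" using K_ge_1 by (simp add: c_def)
  define a where "a i = c * (1/4) ^ i / vol M x (2 ^ i * r)" for i :: nat
  have a: "0 \<le> a i" for i using c by (simp add: a_def)
  have le: "H y * ennreal (wt x r y) \<le> (\<Sum>i. ennreal (a i) * (H y * indicator (ball x (2 ^ i * r)) y))" for y
  proof -
    obtain i :: nat where i: "dist x y < 2 ^ i * r" "wt x r y \<le> a i"
      using wt_le_shells[OF r, of x y] by (auto simp: a_def c_def)
    have "H y * ennreal (wt x r y) \<le> ennreal (a i) * (H y * indicator (ball x (2 ^ i * r)) y)"
      using i by (subst mult.commute) (auto intro!: mult_right_mono ennreal_leI)
    also have "\<dots> \<le> (\<Sum>i. ennreal (a i) * (H y * indicator (ball x (2 ^ i * r)) y))"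
      using sum_le_suminf[of "\<lambda>i. ennreal (a i) * (H y * indicator (ball x (2 ^ i * r)) y)" "{i}"] by simp
    finally show ?thesis .
  qed
  have "(\<integral>\<^sup>+y. H y * ennreal (wt x r y) \<partial>M)
      \<le> (\<integral>\<^sup>+y. (\<Sum>i. ennreal (a i) * (H y * indicator (ball x (2 ^ i * r)) y)) \<partial>M)"
    by (intro nn_integral_mono le)
  also have "\<dots> = (\<Sum>i. ennreal (a i) * (\<integral>\<^sup>+y\<in>ball x (2 ^ i * r). H y \<partial>M))"
    by (simp add: nn_integral_suminf nn_integral_cmult)
  also have "\<dots> \<le> (\<Sum>i. ennreal (c * r powr s * (1/2) ^ i) * A)"
  proof (intro suminf_le)
    fix i :: nat
    have ir: "r \<le> 2 ^ i * r" "0 < 2 ^ i * r" using r by (auto simp: mult_ge1_le)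
    have "ennreal (a i) * (\<integral>\<^sup>+y\<in>ball x (2 ^ i * r). H y \<partial>M)
        \<le> ennreal (a i) * (ennreal ((2 ^ i * r) powr s * vol M x (2 ^ i * r)) * A)"
      by (intro mult_left_mono A ir) auto
    also have "\<dots> = ennreal (a i * ((2 ^ i * r) powr s * vol M x (2 ^ i * r))) * A"
      using a by (simp add: ennreal_mult mult.assoc)
    also have "a i * ((2 ^ i * r) powr s * vol M x (2 ^ i * r)) = c * (1/4) ^ i * (2 ^ i * r) powr s"
      using vol_pos[OF ir(2), of x] by (simp add: a_def)
    also have "(2 ^ i * r) powr s = (2 ^ i) powr s * r powr s" using r by (simp add: powr_mult)
    also have "ennreal (c * (1/4) ^ i * ((2 ^ i) powr s * r powr s)) * A \<le> ennreal (c * r powr s * (1/2) ^ i) * A"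
    proof (intro mult_right_mono ennreal_leI)
      have "(2 ^ i :: real) powr s \<le> (2 ^ i) powr 1" using s by (intro powr_mono) auto
      then have "(1/4::real) ^ i * (2 ^ i) powr s \<le> (1/4) ^ i * 2 ^ i" by (intro mult_left_mono) auto
      also have "\<dots> = (1/2) ^ i" by (simp flip: power_mult_distrib)
      finally have "c * r powr s * ((1/4) ^ i * (2 ^ i) powr s) \<le> c * r powr s * (1/2) ^ i"
        using c by (intro mult_left_mono) auto
      then show "c * (1/4) ^ i * ((2 ^ i) powr s * r powr s) \<le> c * r powr s * (1/2) ^ i" by (simp add: mult_ac)
    qed auto
    finally show "ennreal (a i) * (\<integral>\<^sup>+y\<in>ball x (2 ^ i * r). H y \<partial>M) \<le> ennreal (c * r powr s * (1/2) ^ i) * A" .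
  qed auto
  also have "\<dots> = (\<Sum>i. ennreal (c * r powr s * (1/2) ^ i)) * A" by (rule ennreal_suminf_multc)
  also have "(\<Sum>i. ennreal (c * r powr s * (1/2) ^ i)) = ennreal (\<Sum>i. c * r powr s * (1/2) ^ i)"
    using c by (intro suminf_ennreal2) (auto intro!: summable_mult)
  also have "(\<Sum>i. c * r powr s * (1/2) ^ i) = cw * r powr s"
    by (simp add: suminf_mult suminf_geometric cw_def c_def)
  finally show ?thesis .
qed

lemma wt_le: "0 < r \<Longrightarrow> wt x r u \<le> 1 / vol M x r"
proof -
  assume r: "0 < r"
  have "r / (r + dist x u) \<le> 1"
    using r by (intro divide_le_eq_1_pos[THEN iffD2]) (auto intro: add_pos_nonneg)
  then have "(r / (r + dist x u))\<^sup>2 \<le> 1" using r by (intro power_le_one) auto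
  moreover have "vol M x r \<le> vol M x (r + dist x u)" by (intro vol_mono) auto
  ultimately show ?thesis unfolding wt_def using vol_pos[OF r, of x] by (intro frac_le) auto
qed

lemma wt1_le: "0 < r \<Longrightarrow> wt1 x r u \<le> 1 / (vol M x r * r)"
proof -
  assume r: "0 < r"
  have "wt x r u / (r + dist x u) \<le> (1 / vol M x r) / r"
    using wt_le[OF r, of x u] vol_pos[OF r, of x] r by (intro frac_le) auto
  then show ?thesis by (simp add: wt1_def)
qed

lemma molecule_bounded:
  assumes "molecule x r \<phi> D" "0 \<le> D" "0 < r"
  shows "norm (\<phi> u) \<le> D / vol M x r"
proof -
  have "norm (\<phi> u) \<le> D * wt x r u" using assms by (simp add: molecule_def)
  also have "\<dots> \<le> D * (1 / vol M x r)" using assms wt_le by (intro mult_left_mono)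
  finally show ?thesis by simp
qed

lemma molecule_lipschitz:
  assumes "molecule x r \<phi> D" "0 \<le> D" "0 < r"
  shows "norm (\<phi> u - \<phi> v) \<le> 2 * D / (vol M x r * r) * dist u v"
proof -
  have "norm (\<phi> u - \<phi> v) \<le> D * (dist u v * (wt1 x r u + wt1 x r v))" using assms by (simp add: molecule_def)
  also have "\<dots> \<le> D * (dist u v * (1 / (vol M x r * r) + 1 / (vol M x r * r)))"
    using assms wt1_le by (intro mult_left_mono add_mono) auto
  finally show ?thesis by (simp add: mult_ac)
qed

lemma molecule_continuous:
  assumes "molecule x r \<phi> D" "0 \<le> D" "0 < r"
  shows "continuous_on UNIV \<phi>"
proof (rule lipschitz_on_continuous_on)
  show "(2 * D / (vol M x r * r))-lipschitz_on UNIV \<phi>"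
    using molecule_lipschitz[OF assms] assms by (auto simp: lipschitz_on_def dist_norm)
qed

lemma molecule_measurable:
  fixes \<phi> :: "'a \<Rightarrow> 'k::{banach,second_countable_topology}"
  assumes "molecule x r \<phi> D" "0 \<le> D" "0 < r"
  shows "\<phi> \<in> borel_measurable M"
  by (rule continuous_measurable[OF molecule_continuous[OF assms]])

lemma molecule_nn_integral:
  fixes \<phi> :: "'a \<Rightarrow> 'k::{banach,second_countable_topology}"
  assumes "molecule x r \<phi> D" "0 \<le> D" "0 < r"
  shows "(\<integral>\<^sup>+y. ennreal (norm (\<phi> y)) \<partial>M) \<le> ennreal (cw * D)"
proof -
  have "(\<integral>\<^sup>+y. ennreal (norm (\<phi> y)) \<partial>M) \<le> (\<integral>\<^sup>+y. ennreal D * ennreal (wt x r y) \<partial>M)"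
    using assms wt_nonneg by (intro nn_integral_mono) (auto simp: molecule_def ennreal_leI simp flip: ennreal_mult)
  also have "\<dots> \<le> ennreal (cw * r powr 0) * ennreal D"
    using assms by (intro nn_integral_wt) (auto simp: nn_integral_cmult_indicator emeasure_ball mult.commute)
  finally show ?thesis using assms cw_pos by (simp add: ennreal_mult)
qed

lemma molecule_integrable:
  fixes \<phi> :: "'a \<Rightarrow> 'k::{banach,second_countable_topology}"
  assumes "molecule x r \<phi> D" "0 \<le> D" "0 < r"
  shows "integrable M \<phi>" "norm (\<integral>y. \<phi> y \<partial>M) \<le> cw * D"
proof -
  note i = molecule_nn_integral[OF assms]
  show int: "integrable M \<phi>"
    using molecule_measurable[OF assms] i by (intro integrableI_bounded) (auto intro: le_less_trans)
  have "ennreal (norm (\<integral>y. \<phi> y \<partial>M)) \<le> ennreal (cw * D)"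
    using integral_norm_bound_ennreal[OF int] i by (rule order_trans)
  then show "norm (\<integral>y. \<phi> y \<partial>M) \<le> cw * D" using cw_pos assms by (simp add: ennreal_le_iff)
qed

text \<open>Inside \<open>ball x r\<close> the two weights are bounded below by multiples of
  \<open>1 / vol M x r\<close> and \<open>1 / (vol M x r * r)\<close>. In the Lipschitz condition at
  least one point lies in the ball, otherwise both values vanish; since \<open>molecule\<close> adds
  the weights of both points, either of them can pay.\<close>

lemma bump_molecule:
  fixes \<zeta> :: "'a \<Rightarrow> 'k::real_normed_vector"
  assumes r: "0 < r" and B: "0 \<le> B" and out: "\<And>z. r \<le> dist x z \<Longrightarrow> \<zeta> z = 0"
    and bd: "\<And>z. norm (\<zeta> z) \<le> B" and lip: "\<And>u v. norm (\<zeta> u - \<zeta> v) \<le> B * (dist u v / r)"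
  shows "molecule x r \<zeta> (cw * vol M x r * B)"
proof -
  have w: "1 \<le> cw * vol M x r * wt x r z" "1 / r \<le> cw * vol M x r * wt1 x r z" if z: "dist x z < r" for z
  proof -
    let ?\<rho> = "r + dist x z"
    have pos: "0 < ?\<rho>" using r by (simp add: add_pos_nonneg)
    have "vol M x ?\<rho> \<le> K * 2 powr n * vol M x r" using r z by (intro vol_compare) auto
    then have v: "1 \<le> K * 2 powr n * vol M x r * (1 / vol M x ?\<rho>)" using vol_pos[OF pos, of x] by (simp add: field_simps)
    have h: "1 / 2 \<le> r / ?\<rho>" using z pos by (simp add: field_simps)
    then have "(1/2)\<^sup>2 \<le> (r / ?\<rho>)\<^sup>2" by (intro power_mono) auto
    then have "1 \<le> 4 * (r / ?\<rho>)\<^sup>2" by (simp add: power_divide mult_ac)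
    then have "1 * 1 \<le> (4 * (r / ?\<rho>)\<^sup>2) * (K * 2 powr n * vol M x r * (1 / vol M x ?\<rho>))"
      using v by (intro mult_mono) auto
    then have 1: "1 \<le> (cw / 2) * vol M x r * wt x r z" by (simp add: cw_def wt_def mult_ac)
    then show "1 \<le> cw * vol M x r * wt x r z" by simp
    have "1 / r \<le> 2 * (1 / ?\<rho>)" using z pos r by (simp add: field_simps)
    then have "1 * (1 / r) \<le> ((cw / 2) * vol M x r * wt x r z) * (2 * (1 / ?\<rho>))"
      using 1 r by (intro mult_mono) auto
    then show "1 / r \<le> cw * vol M x r * wt1 x r z" by (simp add: wt1_def)
  qed
  show ?thesis unfolding molecule_def
  proof safe
    fix u v
    show "norm (\<zeta> u) \<le> cw * vol M x r * B * wt x r u"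
    proof (cases "dist x u < r")
      case True
      have "norm (\<zeta> u) \<le> B * 1" using bd by simp
      also have "\<dots> \<le> B * (cw * vol M x r * wt x r u)" using w(1)[OF True] B by (rule mult_left_mono)
      finally show ?thesis by (simp add: mult_ac)
    qed (use out B cw_pos wt_nonneg in auto)
    have n: "0 \<le> cw * vol M x r * wt1 x r z" for z using cw_pos r wt1_nonneg by simp
    show "norm (\<zeta> u - \<zeta> v) \<le> cw * vol M x r * B * (dist u v * (wt1 x r u + wt1 x r v))"
    proof (cases "dist x u < r \<or> dist x v < r")
      case True
      then have "1 / r \<le> cw * vol M x r * wt1 x r u + cw * vol M x r * wt1 x r v"
        using w(2)[of u] w(2)[of v] n[of u] n[of v] by linarith
      then have "(B * dist u v) * (1 / r) \<le> (B * dist u v) * (cw * vol M x r * wt1 x r u + cw * vol M x r * wt1 x r v)"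
        using B by (intro mult_left_mono) auto
      then show ?thesis using lip[of u v] by (simp add: algebra_simps)
    qed (use out B cw_pos r wt1_nonneg in \<open>auto intro!: mult_nonneg_nonneg add_nonneg_nonneg\<close>)
  qed
qed

section \<open>Bumps of integral one\<close>

definition hat :: "'a \<Rightarrow> real \<Rightarrow> 'a \<Rightarrow> real" where
  "hat x r z = max 0 (1 - dist x z / r)"

lemma hat_simps: "0 \<le> hat x r z" "0 < r \<Longrightarrow> hat x r z \<le> 1" "0 < r \<Longrightarrow> r \<le> dist x z \<Longrightarrow> hat x r z = 0"
  by (auto simp: hat_def)

lemma hat_lipschitz: "0 < r \<Longrightarrow> \<bar>hat x r u - hat x r v\<bar> \<le> dist u v / r"
proof -
  assume r: "0 < r"
  have "\<bar>dist x u - dist x v\<bar> \<le> dist u v" by (metis abs_dist_diff_le dist_commute)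
  then have "\<bar>dist x u / r - dist x v / r\<bar> \<le> dist u v / r"
    using r by (simp add: divide_right_mono flip: diff_divide_distrib)
  then show ?thesis unfolding hat_def by linarith
qed

lemma hat_molecule: "0 < r \<Longrightarrow> molecule x r (hat x r) (cw * vol M x r)"
  using bump_molecule[of r 1 x "hat x r"] hat_simps hat_lipschitz by auto

lemma hat_integral:
  assumes r: "0 < r"
  shows "integrable M (hat x r)" "vol M x r \<le> 2 * K * 2 powr n * (\<integral>z. hat x r z \<partial>M)"
proof -
  show i: "integrable M (hat x r)"
    using cw_pos r by (intro molecule_integrable[OF hat_molecule]) auto
  have fin: "emeasure M (ball x (r/2)) < \<infinity>" by (rule ball_finite)
  have "(\<integral>z. 1/2 * indicator (ball x (r/2)) z \<partial>M) \<le> (\<integral>z. hat x r z \<partial>M)"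
  proof (rule integral_mono[OF _ i])
    show "integrable M (\<lambda>z. 1/2 * indicator (ball x (r/2)) z :: real)" using fin by simp
    show "1/2 * indicator (ball x (r/2)) z \<le> hat x r z" for z
      using r by (auto simp: hat_def indicator_def field_simps max_def)
  qed
  then have "vol M x (r/2) \<le> 2 * (\<integral>z. hat x r z \<partial>M)" by (simp add: vol_def)
  moreover have "vol M x r \<le> K * 2 powr n * vol M x (r/2)" using r by (intro vol_compare) auto
  ultimately show "vol M x r \<le> 2 * K * 2 powr n * (\<integral>z. hat x r z \<partial>M)"
    using mult_left_mono[of "vol M x (r/2)" "2 * (\<integral>z. hat x r z \<partial>M)" "K * 2 powr n"] K2_ge_1
    by (simp add: mult_ac)
qed

definition psi :: "'a \<Rightarrow> real \<Rightarrow> 'a \<Rightarrow> 'k::{real_normed_field,banach,second_countable_topology}" where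
  "psi x r z = of_real (hat x r z / (\<integral>z. hat x r z \<partial>M))"

definition cpsi :: real where "cpsi = cw * (2 * K * 2 powr n)"

lemma cpsi_pos: "0 < cpsi"
  using K_ge_1 cw_pos by (simp add: cpsi_def)

lemma hat_integral_pos: "0 < r \<Longrightarrow> 0 < (\<integral>z. hat x r z \<partial>M)"
  using hat_integral(2)[of r x] vol_pos[of r x] K_ge_1 by (smt (verit) mult_nonneg_nonpos mult_nonneg_nonneg powr_ge_zero)

lemma psi_molecule:
  assumes r: "0 < r"
  shows "molecule x r (psi x r :: 'a \<Rightarrow> 'k::{real_normed_field,banach,second_countable_topology}) cpsi"
proof -
  define I where "I = (\<integral>z. hat x r z \<partial>M)"
  have I: "0 < I" unfolding I_def using r by (rule hat_integral_pos)
  have "molecule x r (psi x r :: 'a \<Rightarrow> 'k) (cw * vol M x r * (1 / I))"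
  proof (rule bump_molecule[OF r])
    show "0 \<le> 1 / I" using I by simp
    fix z u v
    show "psi x r z = (0::'k)" if "r \<le> dist x z" using that hat_simps r by (simp add: psi_def)
    show "norm (psi x r z :: 'k) \<le> 1 / I"
      using hat_simps(1)[of x r z] hat_simps(2)[OF r, of x z] r I by (simp add: psi_def I_def[symmetric] divide_right_mono flip: of_real_divide)
    have "norm (psi x r u - psi x r v :: 'k) = \<bar>hat x r u - hat x r v\<bar> / I"
      using I by (simp add: psi_def I_def[symmetric] diff_divide_distrib[symmetric] flip: of_real_divide of_real_diff)
    also have "\<dots> \<le> (dist u v / r) / I" using hat_lipschitz[OF r] I by (intro divide_right_mono) auto
    finally show "norm (psi x r u - psi x r v :: 'k) \<le> 1 / I * (dist u v / r)" by (simp add: mult_ac)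
  qed
  moreover have "cw * vol M x r * (1 / I) \<le> cpsi"
    using hat_integral(2)[OF r, of x] I cw_pos by (simp add: cpsi_def I_def[symmetric] field_simps)
  ultimately show ?thesis using r by (blast intro: molecule_mono less_imp_le)
qed

lemma psi_integral:
  assumes r: "0 < r"
  shows "integrable M (psi x r :: 'a \<Rightarrow> 'k::{real_normed_field,banach,second_countable_topology})"
    and "(\<integral>z. psi x r z \<partial>M) = (1 :: 'k)"
proof -
  show "integrable M (psi x r :: 'a \<Rightarrow> 'k)"
    using molecule_integrable[OF psi_molecule[OF r]] cpsi_pos r by auto
  have "(\<integral>z. psi x r z \<partial>M) = (of_real (\<integral>z. hat x r z / (\<integral>z. hat x r z \<partial>M) \<partial>M) :: 'k)"
    unfolding psi_def using hat_integral(1)[OF r, of x] by (intro integral_of_real) auto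
  also have "\<dots> = 1" using hat_integral_pos[OF r, of x] by simp
  finally show "(\<integral>z. psi x r z \<partial>M) = (1 :: 'k)" .
qed

text \<open>The grand maximal function sees only test functions of mean zero; subtracting a multiple
  of a bump at the same centre and scale brings any molecule into this class.\<close>

lemma molecule_centre:
  fixes \<phi> :: "'a \<Rightarrow> 'k::{real_normed_field,banach,second_countable_topology}"
  assumes \<phi>: "molecule x r \<phi> D" "0 \<le> D" "0 < r"
  defines "c \<equiv> \<integral>z. \<phi> z \<partial>M"
  shows "molecule x r (\<lambda>z. \<phi> z + (- c) * psi x r z) ((1 + cw * cpsi) * D)"
    and "(\<integral>z. \<phi> z + (- c) * psi x r z \<partial>M) = 0"
proof -
  have c: "norm c \<le> cw * D" unfolding c_def by (rule molecule_integrable[OF \<phi>])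
  have "molecule x r (\<lambda>z. \<phi> z + (- c) * psi x r z) (D + norm (- c) * cpsi)"
    by (intro molecule_add molecule_cmult \<phi> psi_molecule)
  moreover have "D + norm (- c) * cpsi \<le> (1 + cw * cpsi) * D"
    using mult_right_mono[OF c, of cpsi] cpsi_pos by (simp add: algebra_simps)
  ultimately show "molecule x r (\<lambda>z. \<phi> z + (- c) * psi x r z) ((1 + cw * cpsi) * D)"
    using \<phi> by (blast intro: molecule_mono less_imp_le)
  show "(\<integral>z. \<phi> z + (- c) * psi x r z \<partial>M) = 0"
    using molecule_integrable(1)[OF \<phi>] psi_integral[OF \<phi>(3), of x, where 'k='k]
    by (simp add: c_def)
qed

section \<open>Packing and maximal separated nets\<close>

lemma card_separated:
  fixes S :: "'a set"
  assumes S: "finite S" "S \<subseteq> ball x R" "\<And>y z. y \<in> S \<Longrightarrow> z \<in> S \<Longrightarrow> y \<noteq> z \<Longrightarrow> r \<le> dist y z"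
    and r: "0 < r" "r \<le> R"
  shows "real (card S) \<le> K * (6 * R / r) powr n"
proof -
  \<comment> \<open>The balls of radius \<open>r / 2\<close> about \<open>S\<close> are disjoint and
    lie in \<open>ball x (2 * R)\<close>. Conversely
    \<open>dist y x + 2 * R < 3 * R = 6 * R / r * (r / 2)\<close>, so each of them carries the
    fraction \<open>1 / ?c\<close> of the volume of that ball.\<close>
  let ?c = "K * (6 * R / r) powr n"
  have disj: "disjoint_family_on (\<lambda>y. ball y (r/2)) S"
    unfolding disjoint_family_on_def
  proof (safe, simp)
    fix y z w assume "y \<in> S" "z \<in> S" "y \<noteq> z" "dist y w * 2 < r" "dist z w * 2 < r"
    with S(3)[of y z] dist_triangle[of y z w] show False by (simp add: dist_commute)
  qed
  have "(\<Sum>y\<in>S. emeasure M (ball y (r/2))) = emeasure M (\<Union>y\<in>S. ball y (r/2))"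
    using S disj by (intro sum_emeasure) auto
  also have "\<dots> \<le> emeasure M (ball x (2 * R))"
  proof (intro emeasure_mono)
    show "(\<Union>y\<in>S. ball y (r/2)) \<subseteq> ball x (2 * R)"
    proof (clarsimp)
      fix y z assume "y \<in> S" "dist y z * 2 < r"
      with S(2) dist_triangle[of x z y] r show "dist x z < 2 * R" by (auto simp: subset_eq)
    qed
  qed auto
  finally have le: "(\<Sum>y\<in>S. vol M y (r/2)) \<le> vol M x (2 * R)"
    by (simp add: emeasure_ball sum_nonneg)
  have "real (card S) * vol M x (2 * R) = (\<Sum>y\<in>S. vol M x (2 * R))" by simp
  also have "\<dots> \<le> (\<Sum>y\<in>S. ?c * vol M y (r/2))"
  proof (intro sum_mono vol_compare)
    fix y assume "y \<in> S"
    then have "dist y x < R" using S(2) by (auto simp: dist_commute)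
    then show "dist y x + 2 * R \<le> 6 * R / r * (r/2)" using r by simp
  qed (use r in auto)
  also have "\<dots> = ?c * (\<Sum>y\<in>S. vol M y (r/2))" by (rule sum_distrib_left[symmetric])
  also have "\<dots> \<le> ?c * vol M x (2 * R)" using le K_ge_1 by (intro mult_left_mono) auto
  finally show ?thesis using vol_pos[of "2 * R" x] r by simp
qed

definition separated :: "real \<Rightarrow> 'a set \<Rightarrow> bool" where
  "separated r S \<longleftrightarrow> (\<forall>y\<in>S. \<forall>z\<in>S. y \<noteq> z \<longrightarrow> r \<le> dist y z)"

text \<open>A maximal separated set is dense at scale \<open>r\<close>, since a point far from all
  of it could be added. The union of a chain is separated because any two of its points lie in a
  common member.\<close>

lemma ex_net:
  assumes r: "0 < r"
  shows "\<exists>S. separated r S \<and> (\<forall>x. \<exists>y\<in>S. dist x y < r)"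
proof -
  define A where "A = Collect (separated r)"
  have "\<exists>S\<in>A. \<forall>X\<in>A. S \<subseteq> X \<longrightarrow> X = S"
  proof (intro Zorn_Lemma ballI)
    fix C assume C: "C \<in> chains A"
    have "r \<le> dist y z" if "y \<in> Y" "Y \<in> C" "z \<in> Z" "Z \<in> C" "y \<noteq> z" for y z Y Z
    proof -
      have "Y \<subseteq> Z \<or> Z \<subseteq> Y" using chainsD[OF C \<open>Y \<in> C\<close> \<open>Z \<in> C\<close>] .
      moreover have "separated r Y" "separated r Z" using chainsD2[OF C] that by (auto simp: A_def)
      ultimately show ?thesis using that by (auto simp: separated_def)
    qed
    then show "\<Union>C \<in> A" by (auto simp: A_def separated_def)
  qed
  then obtain S where S: "S \<in> A" "\<forall>X\<in>A. S \<subseteq> X \<longrightarrow> X = S" by (rule bexE)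
  have sep: "separated r S" using S(1) by (simp add: A_def)
  have "\<exists>y\<in>S. dist x y < r" for x
  proof (rule ccontr)
    assume *: "\<not> (\<exists>y\<in>S. dist x y < r)"
    have far: "r \<le> dist x y" "r \<le> dist y x" if "y \<in> S" for y
      using * that by (auto simp: not_less dist_commute[of y x])
    have "separated r (insert x S)" unfolding separated_def
    proof (intro ballI impI)
      fix y z assume "y \<in> insert x S" "z \<in> insert x S" "y \<noteq> z"
      then consider "y = x" "z \<in> S" | "z = x" "y \<in> S" | "y \<in> S" "z \<in> S" by blast
      then show "r \<le> dist y z" using far sep \<open>y \<noteq> z\<close> unfolding separated_def by cases auto
    qed
    then have "insert x S \<in> A" by (simp add: A_def)
    then have "S \<subseteq> insert x S \<longrightarrow> insert x S = S" by (rule bspec[OF S(2)])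
    then have "x \<in> S" by blast
    with far[of x] r show False by simp
  qed
  with sep show ?thesis by blast
qed

definition net :: "real \<Rightarrow> 'a set" where
  "net r = (SOME S. separated r S \<and> (\<forall>x. \<exists>y\<in>S. dist x y < r))"

lemma net_props:
  assumes r: "0 < r"
  shows net_separated: "y \<in> net r \<Longrightarrow> z \<in> net r \<Longrightarrow> y \<noteq> z \<Longrightarrow> r \<le> dist y z"
    and net_dense: "\<exists>y\<in>net r. dist x y < r"
proof -
  have *: "separated r (net r) \<and> (\<forall>x. \<exists>y\<in>net r. dist x y < r)"
    unfolding net_def by (rule someI_ex[OF ex_net[OF r]])
  show "y \<in> net r \<Longrightarrow> z \<in> net r \<Longrightarrow> y \<noteq> z \<Longrightarrow> r \<le> dist y z"
    using * by (simp add: separated_def)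
  show "\<exists>y\<in>net r. dist x y < r" using * by blast
qed

lemma net_card:
  assumes r: "0 < r" "r \<le> R"
  shows "finite (net r \<inter> ball x R)" "real (card (net r \<inter> ball x R)) \<le> K * (6 * R / r) powr n"
proof -
  have *: "finite (net r \<inter> ball x R) \<and> card (net r \<inter> ball x R) \<le> nat \<lfloor>K * (6 * R / r) powr n\<rfloor>"
  proof (rule finite_if_finite_subsets_card_bdd)
    fix G assume "G \<subseteq> net r \<inter> ball x R" "finite G"
    then have "real (card G) \<le> K * (6 * R / r) powr n"
      using net_separated[OF r(1)] r by (intro card_separated) auto
    then show "card G \<le> nat \<lfloor>K * (6 * R / r) powr n\<rfloor>" by (simp add: le_nat_floor)
  qed
  then show "finite (net r \<inter> ball x R)" ..
  then show "real (card (net r \<inter> ball x R)) \<le> K * (6 * R / r) powr n"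
    using net_separated[OF r(1)] r by (intro card_separated) auto
qed

lemma countable_net:
  assumes r: "0 < r"
  shows "countable (net r)"
proof -
  fix x :: 'a
  have "net r = (\<Union>m::nat. net r \<inter> ball x (r + real m))"
  proof (safe)
    fix y assume "y \<in> net r"
    obtain m :: nat where "dist x y < real m" using reals_Archimedean2 by blast
    then show "y \<in> (\<Union>m::nat. net r \<inter> ball x (r + real m))" using \<open>y \<in> net r\<close> r by (auto intro!: exI[of _ m])
  qed
  also have "countable \<dots>"
    using net_card(1)[OF r] by (intro countable_UN) (auto intro: countable_finite)
  finally show ?thesis .
qed

end

section \<open>The maximal theorem\<close>

lemma epowr_ennreal: "0 \<le> a \<Longrightarrow> epowr (ennreal a) p = ennreal (a powr p)"
  by (simp add: epowr_def)

lemma epowr_top [simp]: "epowr top p = top"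
  by (simp add: epowr_def)

lemma epowr_mono: "u \<le> v \<Longrightarrow> 0 \<le> p \<Longrightarrow> epowr u p \<le> epowr v p"
  by (cases u; cases v) (auto simp: epowr_ennreal powr_mono2 top_unique intro!: ennreal_leI)

lemma epowr_measurable [measurable]: "(\<lambda>u. epowr u p) \<in> borel_measurable borel"
  unfolding epowr_def by measurable

text \<open>Greedy selection: keep a ball of largest radius, discard all balls that meet it, and
  recurse. A discarded ball is no larger, hence contained in the tripled one. The family consists of
  pairs because a ball, as a set, does not determine its centre and radius.\<close>

lemma vitali_finite:
  fixes F :: "('a::metric_space \<times> real) set"
  assumes "finite F" "\<And>p. p \<in> F \<Longrightarrow> 0 < snd p"
  shows "\<exists>G\<subseteq>F. disjoint_family_on (\<lambda>(y, \<rho>). ball y \<rho>) G \<and>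
    (\<Union>(y, \<rho>)\<in>F. ball y \<rho>) \<subseteq> (\<Union>(y, \<rho>)\<in>G. ball y (3 * \<rho>))"
  using assms
proof (induction F rule: finite_psubset_induct)
  case (psubset F)
  show ?case
  proof (cases "F = {}")
    case False
    define b where "b = (ARG_MAX snd p. p \<in> F)"
    obtain y0 \<rho>0 where b0: "b = (y0, \<rho>0)" by (cases b)
    have b: "b \<in> F" "\<And>p. p \<in> F \<Longrightarrow> snd p \<le> snd b"
    proof -
      have "Max (snd ` F) \<in> snd ` F" using psubset.hyps False by (intro Max_in) auto
      then obtain p0 where p0: "p0 \<in> F" "snd p0 = Max (snd ` F)" by auto
      have "b \<in> F \<and> (\<forall>p\<in>F. snd p \<le> snd b)"
        unfolding b_def
      proof (rule arg_maxI[where P="\<lambda>p. p \<in> F" and x=p0])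
        show "\<not> snd p0 < snd y" if "y \<in> F" for y using psubset.hyps that by (simp add: p0 not_less)
      qed (use p0 in \<open>auto simp: not_less\<close>)
      then show "b \<in> F" "\<And>p. p \<in> F \<Longrightarrow> snd p \<le> snd b" by auto
    qed
    define F' where "F' = {p\<in>F. ball (fst p) (snd p) \<inter> ball y0 \<rho>0 = {}}"
    have \<rho>0: "0 < \<rho>0" using psubset.prems[OF b(1)] b0 by simp
    then have "b \<notin> F'" by (auto simp: F'_def b0)
    then have "F' \<subset> F" using b(1) by (auto simp: F'_def)
    then obtain G where G: "G \<subseteq> F'" "disjoint_family_on (\<lambda>(y, \<rho>). ball y \<rho>) G"
      "(\<Union>(y, \<rho>)\<in>F'. ball y \<rho>) \<subseteq> (\<Union>(y, \<rho>)\<in>G. ball y (3 * \<rho>))"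
      using psubset.IH[of F'] psubset.prems by (auto simp: F'_def)
    have "disjoint_family_on (\<lambda>(y, \<rho>). ball y \<rho>) (insert b G)"
      using G(1,2) unfolding disjoint_family_on_def F'_def b0 by (fastforce simp: subset_eq)
    moreover have "ball y \<rho> \<subseteq> (\<Union>(y, \<rho>)\<in>insert b G. ball y (3 * \<rho>))" if p: "(y, \<rho>) \<in> F" for y \<rho>
    proof (cases "(y, \<rho>) \<in> F'")
      case True then show ?thesis using G(3) by auto
    next
      case False
      then have "ball y \<rho> \<inter> ball y0 \<rho>0 \<noteq> {}" using p by (simp add: F'_def)
      then obtain w where "dist y w < \<rho>" "dist y0 w < \<rho>0" by auto
      moreover have "\<rho> \<le> \<rho>0" using b(2)[OF p] by (simp add: b0)
      ultimately have "ball y \<rho> \<subseteq> ball y0 (3 * \<rho>0)"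
      proof (intro subsetI)
        fix z assume "z \<in> ball y \<rho>"
        then have "dist y z < \<rho>" by simp
        moreover have "dist y0 z \<le> dist y0 w + dist y w + dist y z"
          using dist_triangle[of y0 z w] dist_triangle[of w z y] by (simp add: dist_commute)
        ultimately show "z \<in> ball y0 (3 * \<rho>0)"
          using \<open>dist y w < \<rho>\<close> \<open>dist y0 w < \<rho>0\<close> \<open>\<rho> \<le> \<rho>0\<close> by simp
      qed
      then show ?thesis by (auto simp: b0)
    qed
    ultimately show ?thesis using b(1) G(1) by (intro exI[of _ "insert b G"]) (auto simp: F'_def)
  qed (auto simp: disjoint_family_on_def)
qed

context doubling_space
begin

section \<open>A countable maximal function and its weak-type bound\<close>

lemma superlevel_in_M [measurable]:
  fixes f :: "'a \<Rightarrow> ennreal"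
  assumes [measurable]: "f \<in> borel_measurable M"
  shows "{x. c < f x} \<in> sets M"
proof -
  have "{x \<in> space M. c < f x} \<in> sets M" by measurable
  then show ?thesis by simp
qed

text \<open>
  Countably many balls suffice up to a constant; this makes the maximal function measurable and
  reduces the weak-type estimate to finite families.
\<close>

definition fam :: "('a \<times> real) set" where
  "fam = (\<Union>k::int. (\<lambda>y. (y, 2 * 2 powr k)) ` net (2 powr k))"

lemma fam_countable: "countable fam"
  unfolding fam_def by (intro countable_UN countable_image countable_net) auto

lemma fam_pos: "(y, \<rho>) \<in> fam \<Longrightarrow> 0 < \<rho>"
  by (auto simp: fam_def)

definition maxf :: "('a \<Rightarrow> ennreal) \<Rightarrow> 'a \<Rightarrow> ennreal" where
  "maxf H x = (SUP p\<in>fam. indicator (ball (fst p) (snd p)) x *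
     ((\<integral>\<^sup>+z\<in>ball (fst p) (snd p). H z \<partial>M) * ennreal (1 / vol M (fst p) (snd p))))"

lemma maxf_measurable [measurable]: "maxf H \<in> borel_measurable M"
  unfolding maxf_def by (intro borel_measurable_SUP fam_countable) auto

definition cM :: real where "cM = K * 6 powr n"

lemma cM_ge_1: "1 \<le> cM"
  unfolding cM_def using K_ge_1 n_pos ge_one_powr_ge_zero[of 6 n] by (simp add: mult_ge1_I)

text \<open>Choose \<open>2 powr k\<close> between \<open>r\<close> and \<open>2 * r\<close>. A net
  point within \<open>2 powr k\<close> of \<open>x\<close> is the centre of a ball of the family
  that contains \<open>ball x r\<close>; as \<open>3 * 2 powr k\<close> is at most
  \<open>6 * r\<close>, its volume grows by at most \<open>K * 6 powr n\<close>, which is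
  \<open>cM\<close>.\<close>

lemma ball_le_maxf:
  assumes r: "0 < r"
  shows "(\<integral>\<^sup>+z\<in>ball x r. H z \<partial>M) \<le> ennreal (cM * vol M x r) * maxf H x"
proof -
  define k where "k = \<lfloor>log 2 r\<rfloor> + 1"
  let ?R = "2 powr real_of_int k"
  have "2 powr log 2 r \<le> ?R" "?R \<le> 2 powr (log 2 r + 1)"
    unfolding k_def by (intro powr_mono; linarith)+
  then have R: "r \<le> ?R" "?R \<le> 2 * r" using r by (auto simp: powr_add)
  obtain y where y: "y \<in> net ?R" "dist x y < ?R" using net_dense[of ?R x] by auto
  then have p: "(y, 2 * ?R) \<in> fam" by (auto simp: fam_def)
  let ?a = "\<integral>\<^sup>+z\<in>ball y (2 * ?R). H z \<partial>M" and ?v = "vol M y (2 * ?R)"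
  have v: "0 < ?v" by (simp add: vol_pos)
  have vle: "?v \<le> cM * vol M x r" unfolding cM_def using r R y(2) by (intro vol_compare) auto
  have "ball x r \<subseteq> ball y (2 * ?R)"
  proof
    fix z assume "z \<in> ball x r"
    then show "z \<in> ball y (2 * ?R)"
      using dist_triangle[of y z x] y(2) R by (simp add: dist_commute)
  qed
  then have "(\<integral>\<^sup>+z\<in>ball x r. H z \<partial>M) \<le> ?a"
    by (intro nn_integral_mono mult_left_mono) (auto simp: indicator_def)
  also have "\<dots> = ennreal ?v * (?a * ennreal (1 / ?v))"
    using v by (simp add: mult.left_commute[of "ennreal ?v"] flip: ennreal_mult)
  also have "?a * ennreal (1 / ?v) = indicator (ball y (2 * ?R)) x * (?a * ennreal (1 / ?v))"
    using \<open>ball x r \<subseteq> ball y (2 * ?R)\<close> r by (simp add: indicator_def subset_eq)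
  also have "\<dots> \<le> maxf H x"
    unfolding maxf_def using SUP_upper[OF p, of "\<lambda>p. indicator (ball (fst p) (snd p)) x *
     ((\<integral>\<^sup>+z\<in>ball (fst p) (snd p). H z \<partial>M) * ennreal (1 / vol M (fst p) (snd p)))"] by simp
  finally have "(\<integral>\<^sup>+z\<in>ball x r. H z \<partial>M) \<le> ennreal ?v * maxf H x" by (simp add: mult_left_mono)
  also have "\<dots> \<le> ennreal (cM * vol M x r) * maxf H x"
    using vle by (intro mult_right_mono ennreal_leI) auto
  finally show ?thesis .
qed

text \<open>The integrals of \<open>H\<close> over the disjoint Vitali subfamily add up to at most
  the full integral, and tripling its balls costs at most \<open>cM\<close>.\<close>

lemma weak_type_finite:
  assumes [measurable]: "H \<in> borel_measurable M" and t: "0 \<le> t"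
    and F: "finite F" "\<And>y \<rho>. (y, \<rho>) \<in> F \<Longrightarrow> 0 < \<rho>"
      "\<And>y \<rho>. (y, \<rho>) \<in> F \<Longrightarrow> ennreal (t * vol M y \<rho>) \<le> (\<integral>\<^sup>+z\<in>ball y \<rho>. H z \<partial>M)"
  shows "ennreal t * emeasure M (\<Union>(y, \<rho>)\<in>F. ball y \<rho>) \<le> ennreal cM * (\<integral>\<^sup>+z. H z \<partial>M)"
proof -
  obtain G where G: "G \<subseteq> F" "disjoint_family_on (\<lambda>(y, \<rho>). ball y \<rho>) G"
    "(\<Union>(y, \<rho>)\<in>F. ball y \<rho>) \<subseteq> (\<Union>(y, \<rho>)\<in>G. ball y (3 * \<rho>))"
    using vitali_finite[of F] F(1,2) by (metis prod.collapse)
  have fG: "finite G" using F(1) G(1) finite_subset by blast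
  have "emeasure M (\<Union>(y, \<rho>)\<in>F. ball y \<rho>) \<le> emeasure M (\<Union>(y, \<rho>)\<in>G. ball y (3 * \<rho>))"
    using G(3) fG by (intro emeasure_mono sets.finite_UN) auto
  also have "\<dots> \<le> (\<Sum>p\<in>G. emeasure M (case p of (y, \<rho>) \<Rightarrow> ball y (3 * \<rho>)))"
    using fG by (intro emeasure_subadditive_finite) auto
  finally have "ennreal t * emeasure M (\<Union>(y, \<rho>)\<in>F. ball y \<rho>)
      \<le> ennreal t * (\<Sum>p\<in>G. emeasure M (case p of (y, \<rho>) \<Rightarrow> ball y (3 * \<rho>)))"
    by (rule mult_left_mono) simp
  also have "\<dots> = (\<Sum>p\<in>G. ennreal t * emeasure M (case p of (y, \<rho>) \<Rightarrow> ball y (3 * \<rho>)))"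
    by (rule sum_distrib_left)
  also have "\<dots> \<le> (\<Sum>p\<in>G. ennreal cM * (\<integral>\<^sup>+z\<in>ball (fst p) (snd p). H z \<partial>M))"
  proof (intro sum_mono)
    fix p assume "p \<in> G"
    obtain y \<rho> where p: "p = (y, \<rho>)" by (cases p)
    have pF: "(y, \<rho>) \<in> F" using \<open>p \<in> G\<close> G(1) p by auto
    have "vol M y (3 * \<rho>) \<le> cM * vol M y \<rho>"
      unfolding cM_def using F(2)[OF pF] by (intro vol_compare) auto
    then have "t * vol M y (3 * \<rho>) \<le> cM * (t * vol M y \<rho>)"
      using mult_left_mono[OF _ t] by (simp add: mult.left_commute)
    then have "ennreal t * emeasure M (ball y (3 * \<rho>)) \<le> ennreal (cM * (t * vol M y \<rho>))"
      using t by (simp add: emeasure_ball ennreal_leI flip: ennreal_mult)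
    also have "\<dots> = ennreal cM * ennreal (t * vol M y \<rho>)" using cM_ge_1 t by (simp add: ennreal_mult)
    also have "\<dots> \<le> ennreal cM * (\<integral>\<^sup>+z\<in>ball y \<rho>. H z \<partial>M)" using F(3)[OF pF] by (rule mult_left_mono) simp
    finally show "ennreal t * emeasure M (case p of (y, \<rho>) \<Rightarrow> ball y (3 * \<rho>)) \<le> ennreal cM * (\<integral>\<^sup>+z\<in>ball (fst p) (snd p). H z \<partial>M)"
      by (simp add: p)
  qed
  also have "\<dots> = ennreal cM * (\<integral>\<^sup>+z. (\<Sum>p\<in>G. H z * indicator (ball (fst p) (snd p)) z) \<partial>M)"
    by (subst nn_integral_sum) (auto simp: sum_distrib_left)
  also have "\<dots> \<le> ennreal cM * (\<integral>\<^sup>+z. H z \<partial>M)"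
  proof (intro mult_left_mono nn_integral_mono)
    fix z
    have "(\<Sum>p\<in>G. H z * indicator (ball (fst p) (snd p)) z) = H z * (\<Sum>p\<in>G. indicator (case p of (y, \<rho>) \<Rightarrow> ball y \<rho>) z)"
      by (simp add: sum_distrib_left case_prod_unfold)
    also have "(\<Sum>p\<in>G. indicator (case p of (y, \<rho>) \<Rightarrow> ball y \<rho>) z) = (indicator (\<Union>p\<in>G. case p of (y, \<rho>) \<Rightarrow> ball y \<rho>) z :: ennreal)"
      using fG G(2) by (intro indicator_UN_disjoint[symmetric])
    also have "H z * \<dots> \<le> H z * 1" by (intro mult_left_mono) (auto simp: indicator_def)
    finally show "(\<Sum>p\<in>G. H z * indicator (ball (fst p) (snd p)) z) \<le> H z" by simp
  qed auto
  finally show ?thesis .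
qed

text \<open>The part of \<open>H\<close> below \<open>t/2\<close> contributes at most
  \<open>t/2\<close> to any average, so the part above \<open>t/2\<close> must supply the other
  half. This truncation is what makes the sum over all levels converge later. Finite subfamilies
  exhaust the countable family from below.\<close>

lemma weak_type:
  assumes [measurable]: "H \<in> borel_measurable M" and t: "0 < t"
  shows "ennreal t * emeasure M {x. ennreal t < maxf H x}
    \<le> ennreal (2 * cM) * (\<integral>\<^sup>+z. H z * indicator {z. ennreal (t/2) < H z} z \<partial>M)"
proof -
  define H1 where "H1 z = H z * indicator {z. ennreal (t/2) < H z} z" for z
  have [measurable]: "H1 \<in> borel_measurable M" unfolding H1_def by measurable
  define F where "F = {p\<in>fam. ennreal (t * vol M (fst p) (snd p)) < (\<integral>\<^sup>+z\<in>ball (fst p) (snd p). H z \<partial>M)}"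
  have H1: "ennreal (t / 2 * vol M y \<rho>) \<le> (\<integral>\<^sup>+z\<in>ball y \<rho>. H1 z \<partial>M)" if "(y, \<rho>) \<in> F" for y \<rho>
  proof (rule ccontr)
    assume "\<not> ?thesis"
    then have less: "(\<integral>\<^sup>+z\<in>ball y \<rho>. H1 z \<partial>M) \<le> ennreal (t / 2 * vol M y \<rho>)" by simp
    have "(\<integral>\<^sup>+z\<in>ball y \<rho>. H z \<partial>M) \<le> (\<integral>\<^sup>+z. H1 z * indicator (ball y \<rho>) z + ennreal (t/2) * indicator (ball y \<rho>) z \<partial>M)"
      by (intro nn_integral_mono) (auto simp: H1_def indicator_def)
    also have "\<dots> = (\<integral>\<^sup>+z\<in>ball y \<rho>. H1 z \<partial>M) + ennreal (t / 2 * vol M y \<rho>)"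
      using t ennreal_mult[of "t/2" "vol M y \<rho>"]
      by (subst nn_integral_add) (auto simp: nn_integral_cmult_indicator emeasure_ball)
    also have "\<dots> \<le> ennreal (t / 2 * vol M y \<rho>) + ennreal (t / 2 * vol M y \<rho>)" using less by (rule add_right_mono)
    also have "\<dots> = ennreal (t * vol M y \<rho>)" using t by (simp flip: ennreal_plus)
    finally show False using that unfolding F_def by (auto dest: leD)
  qed
  have cF: "countable F" using fam_countable by (auto simp: F_def)
  have sub: "{x. ennreal t < maxf H x} \<subseteq> (\<Union>p\<in>F. ball (fst p) (snd p))"
  proof
    fix x assume "x \<in> {x. ennreal t < maxf H x}"
    then obtain p where p: "p \<in> fam" "ennreal t < indicator (ball (fst p) (snd p)) x *
     ((\<integral>\<^sup>+z\<in>ball (fst p) (snd p). H z \<partial>M) * ennreal (1 / vol M (fst p) (snd p)))"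
      by (auto simp: maxf_def less_SUP_iff)
    let ?v = "vol M (fst p) (snd p)" and ?a = "\<integral>\<^sup>+z\<in>ball (fst p) (snd p). H z \<partial>M"
    have xp: "x \<in> ball (fst p) (snd p)" using p(2) by (cases "x \<in> ball (fst p) (snd p)") auto
    have v: "0 < ?v" using fam_pos[of "fst p" "snd p"] p(1) by (simp add: vol_pos)
    have "ennreal t < ?a * ennreal (1 / ?v)" using p(2) xp by simp
    then have "ennreal t * ennreal ?v < ?a * ennreal (1 / ?v) * ennreal ?v"
      using v by (intro ennreal_mult_strict_right_mono) auto
    also have "\<dots> = ?a" using v by (simp add: mult.assoc flip: ennreal_mult)
    finally have "p \<in> F" using p(1) t by (simp add: F_def ennreal_mult)
    then show "x \<in> (\<Union>p\<in>F. ball (fst p) (snd p))" using xp by auto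
  qed
  have *: "ennreal (t/2) * emeasure M (\<Union>p\<in>F. ball (fst p) (snd p)) \<le> ennreal cM * (\<integral>\<^sup>+z. H1 z \<partial>M)"
  proof (cases "F = {}")
    case False
    define A where "A m = (\<Union>p\<in>from_nat_into F ` {..<m}. ball (fst p) (snd p))" for m
    have FA: "(\<Union>p\<in>F. ball (fst p) (snd p)) = (\<Union>m. A m)"
    proof (intro equalityI subsetI)
      fix x assume "x \<in> (\<Union>p\<in>F. ball (fst p) (snd p))"
      then obtain p where "p \<in> F" "x \<in> ball (fst p) (snd p)" by auto
      moreover have "p = from_nat_into F (to_nat_on F p)" using cF \<open>p \<in> F\<close> by simp
      ultimately have "x \<in> A (Suc (to_nat_on F p))" unfolding A_def by (metis UN_I imageI lessThan_iff lessI)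
      then show "x \<in> (\<Union>m. A m)" by blast
    next
      fix x assume "x \<in> (\<Union>m. A m)"
      then show "x \<in> (\<Union>p\<in>F. ball (fst p) (snd p))" using from_nat_into[OF False] by (auto simp: A_def)
    qed
    have inc: "incseq A" unfolding A_def incseq_def by (intro allI impI UN_mono image_mono) auto
    have "emeasure M (\<Union>m. A m) = (SUP m. emeasure M (A m))"
    proof (intro SUP_emeasure_incseq[symmetric] inc)
      show "range A \<subseteq> sets M" by (auto simp: A_def)
    qed
    then have "ennreal (t/2) * emeasure M (\<Union>m. A m) = (SUP m. ennreal (t/2) * emeasure M (A m))"
      by (simp add: SUP_mult_left_ennreal)
    also have "\<dots> \<le> ennreal cM * (\<integral>\<^sup>+z. H1 z \<partial>M)"
    proof (intro SUP_least)
      fix m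
      have FF: "(y, \<rho>) \<in> F" if "(y, \<rho>) \<in> from_nat_into F ` {..<m}" for y \<rho>
        using from_nat_into[OF False] that by (metis imageE)
      have "ennreal (t/2) * emeasure M (\<Union>(y, \<rho>)\<in>from_nat_into F ` {..<m}. ball y \<rho>) \<le> ennreal cM * (\<integral>\<^sup>+z. H1 z \<partial>M)"
      proof (rule weak_type_finite)
        show "0 < \<rho>" if "(y, \<rho>) \<in> from_nat_into F ` {..<m}" for y \<rho>
          using FF[OF that] by (auto simp: F_def intro: fam_pos)
      qed (use t in \<open>auto intro: H1 FF simp del: times_divide_eq_left\<close>)
      then show "ennreal (t/2) * emeasure M (A m) \<le> ennreal cM * (\<integral>\<^sup>+z. H1 z \<partial>M)"
        by (simp add: A_def case_prod_unfold)
    qed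
    finally show ?thesis by (simp add: FA)
  qed simp
  have "ennreal t * emeasure M {x. ennreal t < maxf H x} \<le> ennreal t * emeasure M (\<Union>p\<in>F. ball (fst p) (snd p))"
    using sub cF by (intro mult_left_mono emeasure_mono) auto
  also have "\<dots> = 2 * (ennreal (t/2) * emeasure M (\<Union>p\<in>F. ball (fst p) (snd p)))"
    using t by (simp add: mult.assoc[symmetric] ennreal_mult[symmetric] flip: ennreal_numeral)
  also have "\<dots> \<le> 2 * (ennreal cM * (\<integral>\<^sup>+z. H1 z \<partial>M))" by (rule mult_left_mono[OF *]) simp
  also have "\<dots> = ennreal (2 * cM) * (\<integral>\<^sup>+z. H1 z \<partial>M)"
    using cM_ge_1 by (simp add: ennreal_mult mult.assoc)
  finally show ?thesis by (simp add: H1_def)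
qed

end

section \<open>From weak type to strong type by dyadic levels\<close>

lemma epowr_le_dyadic:
  fixes v :: ennreal
  assumes P: "1 < P"
  shows "epowr v P \<le> (\<integral>\<^sup>+i. ennreal (2 powr ((real_of_int i + 1) * P)) * indicator {i. ennreal (2 powr real_of_int i) < v} i \<partial>count_space (UNIV :: int set))"
    (is "_ \<le> ?R")
proof -
  have pt: "ennreal (2 powr ((real_of_int i + 1) * P)) \<le> ?R" if "ennreal (2 powr real_of_int i) < v" for i :: int
    using nn_integral_ge_point[of i UNIV "\<lambda>i. ennreal (2 powr ((real_of_int i + 1) * P)) * indicator {i. ennreal (2 powr real_of_int i) < v} i"] that
    by simp
  show ?thesis
  proof (cases v)
    case (real r)
    show ?thesis
    proof (cases "r = 0")
      case False
      then have r: "0 < r" using real by simp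
      \<comment> \<open>The largest level with \<open>2 powr i < r\<close>, strictly; the single
        term at this level already dominates.\<close>
      define i where "i = \<lceil>log 2 r\<rceil> - 1"
      have i: "real_of_int i < log 2 r" "log 2 r \<le> real_of_int i + 1" unfolding i_def by linarith+
      have "2 powr real_of_int i < r" using i(1) r by (simp add: less_log_iff)
      then have "ennreal (2 powr ((real_of_int i + 1) * P)) \<le> ?R" using real by (intro pt) (simp add: ennreal_less_iff)
      moreover have "r \<le> 2 powr (real_of_int i + 1)" using i(2) r by (simp add: log_le_iff)
      then have "r powr P \<le> (2 powr (real_of_int i + 1)) powr P" using r P by (intro powr_mono2) auto
      then have "epowr v P \<le> ennreal (2 powr ((real_of_int i + 1) * P))"
        using real r by (simp add: epowr_ennreal powr_powr ennreal_leI)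
      ultimately show ?thesis by (rule order_trans[rotated])
    qed (simp add: real epowr_def)
  next
    case top
    have "?R = top"
    proof (rule ccontr)
      assume "?R \<noteq> top"
      then obtain c where c: "?R = ennreal c" "0 \<le> c" by (cases ?R) auto
      obtain m :: nat where m: "c < real m" using reals_Archimedean2 by blast
      have "real m < 2 ^ m" by (rule of_nat_less_two_power)
      also have "(2::real) ^ m = 2 powr (real m * 1)" by (simp add: powr_realpow)
      also have "\<dots> \<le> 2 powr ((real m + 1) * P)" using P by (intro powr_mono mult_mono) auto
      finally have "c < 2 powr ((real m + 1) * P)" using m by simp
      moreover have "ennreal (2 powr ((real_of_int (int m) + 1) * P)) \<le> ?R" by (rule pt) (simp add: top)
      ultimately show False using c by (simp add: ennreal_le_iff)
    qed
    then show ?thesis by simp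
  qed
qed

text \<open>The factor \<open>2 powr ((i + 1) * P)\<close> comes from the layer sum and
  \<open>2 powr (- i)\<close> from the weak-type bound. Only levels up to \<open>i0\<close> occur,
  and counted downwards from \<open>i0\<close> they form a geometric series of ratio
  \<open>2 powr (1 - P) < 1\<close>. Rounding \<open>i + 1\<close> and \<open>i0\<close> accounts
  for \<open>4 powr P\<close>.\<close>

lemma dyadic_le_powr:
  fixes h :: real
  assumes P: "1 < P" and h: "0 \<le> h"
  shows "(\<integral>\<^sup>+i. ennreal (2 powr ((real_of_int i + 1) * P) * 2 powr (- real_of_int i)) * indicator {i. 2 powr real_of_int i / 2 < h} i \<partial>count_space (UNIV :: int set))
    \<le> ennreal (4 powr P / (1 - 2 powr (1 - P)) * h powr (P - 1))"
proof (cases "h = 0")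
  case True
  have "{i::int. 2 powr real_of_int i / 2 < h} = {}" using True by (auto simp: not_less)
  then show ?thesis by simp
next
  case False
  then have hp: "0 < h" using h by simp
  define i0 where "i0 = \<lceil>log 2 h\<rceil>"
  define q where "q = 2 powr (1 - P)"
  have q: "0 < q" "q < 1" using P powr_less_mono[of "1 - P" 0 2] by (auto simp: q_def)
  have i0: "i \<le> i0" if "2 powr real_of_int i / 2 < h" for i
  proof -
    have "2 powr (real_of_int i - 1) < h" using that by (simp add: powr_diff)
    then have "real_of_int i - 1 < log 2 h" using hp by (simp add: less_log_iff)
    then show ?thesis unfolding i0_def by linarith
  qed
  have "2 powr real_of_int i0 \<le> 2 powr (log 2 h + 1)" unfolding i0_def by (intro powr_mono) linarith+
  also have "\<dots> = 2 * h" using hp by (simp add: powr_add)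
  finally have i0h: "2 powr real_of_int i0 \<le> 2 * h" .
  let ?f = "\<lambda>i::int. ennreal (2 powr P * 2 powr (real_of_int i * (P - 1)))"
  have "(\<integral>\<^sup>+i. ennreal (2 powr ((real_of_int i + 1) * P) * 2 powr (- real_of_int i)) * indicator {i. 2 powr real_of_int i / 2 < h} i \<partial>count_space (UNIV :: int set))
    \<le> (\<integral>\<^sup>+i. ?f i * indicator {..i0} i \<partial>count_space UNIV)"
  proof (intro nn_integral_mono mult_mono)
    fix i :: int
    have "(real_of_int i + 1) * P + - real_of_int i = P + real_of_int i * (P - 1)" by (simp add: algebra_simps)
    then show "ennreal (2 powr ((real_of_int i + 1) * P) * 2 powr (- real_of_int i)) \<le> ?f i" by (simp flip: powr_add)
  qed (auto simp: indicator_def i0)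
  also have "\<dots> = (\<integral>\<^sup>+i. ?f i \<partial>count_space {..i0})"
    by (subst nn_integral_count_space_indicator) auto
  also have "\<dots> = (\<integral>\<^sup>+j. ?f (i0 - int j) \<partial>count_space UNIV)"
  proof -
    have "bij_betw (\<lambda>j. i0 - int j) UNIV {..i0}"
      by (rule bij_betw_byWitness[where f'="\<lambda>i. nat (i0 - i)"]) auto
    from nn_integral_bij_count_space[OF this, of ?f] show ?thesis by (rule sym)
  qed
  also have "\<dots> = (\<Sum>j. ?f (i0 - int j))" by (rule nn_integral_count_space_nat)
  also have "\<dots> = (\<Sum>j. ennreal (2 powr P * 2 powr (real_of_int i0 * (P - 1)) * q ^ j))"
  proof (intro suminf_cong)
    fix j
    have "q ^ j = 2 powr ((1 - P) * real j)" using q by (simp add: q_def powr_powr flip: powr_realpow)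
    moreover have "real_of_int (i0 - int j) * (P - 1) = real_of_int i0 * (P - 1) + (1 - P) * real j"
      by (simp add: algebra_simps)
    ultimately show "?f (i0 - int j) = ennreal (2 powr P * 2 powr (real_of_int i0 * (P - 1)) * q ^ j)"
      by (simp add: powr_add mult.assoc)
  qed
  also have "\<dots> = ennreal (\<Sum>j. 2 powr P * 2 powr (real_of_int i0 * (P - 1)) * q ^ j)"
    using q by (intro suminf_ennreal2) (auto intro!: summable_mult summable_geometric)
  also have "(\<Sum>j. 2 powr P * 2 powr (real_of_int i0 * (P - 1)) * q ^ j) = 2 powr P * 2 powr (real_of_int i0 * (P - 1)) / (1 - q)"
    using q by (simp add: suminf_mult suminf_geometric)
  also have "\<dots> \<le> 4 powr P / (1 - q) * h powr (P - 1)"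
  proof -
    have "2 powr (real_of_int i0 * (P - 1)) = (2 powr real_of_int i0) powr (P - 1)" by (simp add: powr_powr)
    also have "\<dots> \<le> (2 * h) powr (P - 1)" using i0h P by (intro powr_mono2) auto
    also have "\<dots> = 2 powr (P - 1) * h powr (P - 1)" using hp by (simp add: powr_mult)
    also have "\<dots> \<le> 2 powr P * h powr (P - 1)" by (intro mult_right_mono powr_mono) auto
    finally have "2 powr P * 2 powr (real_of_int i0 * (P - 1)) \<le> 2 powr P * (2 powr P * h powr (P - 1))"
      by (intro mult_left_mono) auto
    also have "\<dots> = 4 powr P * h powr (P - 1)" using powr_mult[of 2 2 P] by simp
    finally show ?thesis using q by (simp add: divide_right_mono)
  qed
  finally show ?thesis by (simp add: q_def ennreal_leI)
qed

context doubling_space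
begin

text \<open>The bound \<open>weak_type\<close> is inserted at every dyadic level and the sum over
  levels is moved inside the integral. At a point \<open>z\<close> the truncation leaves the levels
  with \<open>2 powr i < 2 * h z\<close>, to which \<open>dyadic_le_powr\<close> applies.\<close>

lemma maximal_theorem:
  fixes h :: "'a \<Rightarrow> real"
  assumes [measurable]: "h \<in> borel_measurable M" and h: "\<And>x. 0 \<le> h x" and P: "1 < P"
  shows "(\<integral>\<^sup>+x. epowr (maxf (\<lambda>x. ennreal (h x)) x) P \<partial>M)
    \<le> ennreal (2 * cM * (4 powr P / (1 - 2 powr (1 - P)))) * (\<integral>\<^sup>+x. ennreal (h x powr P) \<partial>M)"
proof -
  define H where "H x = ennreal (h x)" for x
  have [measurable]: "H \<in> borel_measurable M" unfolding H_def by measurable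
  let ?C = "4 powr P / (1 - 2 powr (1 - P))"
  let ?a = "\<lambda>i::int. ennreal (2 powr ((real_of_int i + 1) * P))"
  have "(\<integral>\<^sup>+x. epowr (maxf H x) P \<partial>M)
     \<le> (\<integral>\<^sup>+x. \<integral>\<^sup>+i. ?a i * indicator {i. ennreal (2 powr real_of_int i) < maxf H x} i \<partial>count_space UNIV \<partial>M)"
    by (intro nn_integral_mono epowr_le_dyadic P)
  also have "\<dots> = (\<integral>\<^sup>+x. \<integral>\<^sup>+i. ?a i * indicator {x. ennreal (2 powr real_of_int i) < maxf H x} x \<partial>count_space UNIV \<partial>M)"
    by (simp add: indicator_def)
  also have "\<dots> = (\<integral>\<^sup>+i. \<integral>\<^sup>+x. ?a i * indicator {x. ennreal (2 powr real_of_int i) < maxf H x} x \<partial>M \<partial>count_space UNIV)"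
    by (intro nn_integral_count_space_nn_integral) auto
  also have "\<dots> = (\<integral>\<^sup>+i. ?a i * emeasure M {x. ennreal (2 powr real_of_int i) < maxf H x} \<partial>count_space UNIV)"
    by (intro nn_integral_cong nn_integral_cmult_indicator) auto
  also have "\<dots> \<le> (\<integral>\<^sup>+i. \<integral>\<^sup>+z. ennreal (2 * cM) * (H z * (ennreal (2 powr ((real_of_int i + 1) * P) * 2 powr (- real_of_int i)) * indicator {z. 2 powr real_of_int i / 2 < h z} z)) \<partial>M \<partial>count_space UNIV)"
  proof (intro nn_integral_mono)
    fix i :: int
    let ?t = "2 powr real_of_int i" and ?m = "emeasure M {x. ennreal (2 powr real_of_int i) < maxf H x}"
    have "{z \<in> space M. ?t / 2 < h z} \<in> sets M" by measurable
    then have m: "{z. ?t / 2 < h z} \<in> sets M" by simp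
    have "?m = ennreal (2 powr (- real_of_int i)) * (ennreal ?t * ?m)"
      by (simp add: mult.assoc[symmetric] powr_minus flip: ennreal_mult)
    also have "\<dots> \<le> ennreal (2 powr (- real_of_int i)) * (ennreal (2 * cM) * (\<integral>\<^sup>+z. H z * indicator {z. ennreal (?t/2) < H z} z \<partial>M))"
      by (intro mult_left_mono weak_type) auto
    also have "{z. ennreal (?t/2) < H z} = {z. ?t/2 < h z}" by (auto simp: H_def ennreal_less_iff)
    finally have "?a i * ?m \<le> ?a i * (ennreal (2 powr (- real_of_int i)) * (ennreal (2 * cM) * (\<integral>\<^sup>+z. H z * indicator {z. ?t/2 < h z} z \<partial>M)))"
      by (rule mult_left_mono) simp
    also have "\<dots> = ennreal (2 * cM) * (ennreal (2 powr ((real_of_int i + 1) * P) * 2 powr (- real_of_int i)) * (\<integral>\<^sup>+z. H z * indicator {z. ?t/2 < h z} z \<partial>M))"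
      by (simp add: ennreal_mult mult_ac)
    also have "\<dots> = (\<integral>\<^sup>+z. ennreal (2 * cM) * (H z * (ennreal (2 powr ((real_of_int i + 1) * P) * 2 powr (- real_of_int i)) * indicator {z. ?t / 2 < h z} z)) \<partial>M)"
      using m by (simp add: nn_integral_cmult[symmetric] mult_ac)
    finally show "?a i * ?m \<le> (\<integral>\<^sup>+z. ennreal (2 * cM) * (H z * (ennreal (2 powr ((real_of_int i + 1) * P) * 2 powr (- real_of_int i)) * indicator {z. ?t / 2 < h z} z)) \<partial>M)" .
  qed
  also have "\<dots> = (\<integral>\<^sup>+z. \<integral>\<^sup>+i. ennreal (2 * cM) * (H z * (ennreal (2 powr ((real_of_int i + 1) * P) * 2 powr (- real_of_int i)) * indicator {z. 2 powr real_of_int i / 2 < h z} z)) \<partial>count_space UNIV \<partial>M)"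
  proof (intro nn_integral_count_space_nn_integral[symmetric])
    fix i :: int
    have "{z \<in> space M. 2 powr real_of_int i / 2 < h z} \<in> sets M" by measurable
    then have [measurable]: "{z. 2 powr real_of_int i / 2 < h z} \<in> sets M" by simp
    show "(\<lambda>z. ennreal (2 * cM) * (H z * (ennreal (2 powr ((real_of_int i + 1) * P) * 2 powr (- real_of_int i)) * indicator {z. 2 powr real_of_int i / 2 < h z} z))) \<in> borel_measurable M"
      by measurable
  qed auto
  also have "\<dots> = (\<integral>\<^sup>+z. ennreal (2 * cM) * (H z * (\<integral>\<^sup>+i. ennreal (2 powr ((real_of_int i + 1) * P) * 2 powr (- real_of_int i)) * indicator {i. 2 powr real_of_int i / 2 < h z} i \<partial>count_space UNIV)) \<partial>M)"
    by (simp add: nn_integral_cmult indicator_def)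
  also have "\<dots> \<le> (\<integral>\<^sup>+z. ennreal (2 * cM) * (H z * ennreal (?C * h z powr (P - 1))) \<partial>M)"
    by (intro nn_integral_mono mult_left_mono dyadic_le_powr P h) auto
  also have "\<dots> = (\<integral>\<^sup>+z. ennreal (2 * cM * ?C) * ennreal (h z powr P) \<partial>M)"
  proof (intro nn_integral_cong)
    fix z
    have "2 powr (1 - P) \<le> 1" using P powr_mono[of "1 - P" 0 2] by simp
    then have C: "0 \<le> ?C" by simp
    have hP: "h z powr P = h z * h z powr (P - 1)"
      using h[of z] powr_add[of "h z" 1 "P - 1"] by simp
    have e4: "ennreal a * (ennreal b * ennreal (c * e)) = ennreal (a * c) * ennreal (b * e)"
      if "0 \<le> a" "0 \<le> b" "0 \<le> c" "0 \<le> e" for a b c e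
      using that by (simp add: ennreal_mult mult_ac)
    show "ennreal (2 * cM) * (H z * ennreal (?C * h z powr (P - 1))) = ennreal (2 * cM * ?C) * ennreal (h z powr P)"
      unfolding H_def hP using h[of z] C cM_ge_1 by (intro e4) auto
  qed
  also have "\<dots> = ennreal (2 * cM * ?C) * (\<integral>\<^sup>+x. ennreal (h x powr P) \<partial>M)"
    by (rule nn_integral_cmult) simp
  finally show ?thesis by (simp add: H_def[abs_def])
qed

end

section \<open>Oscillation of Hajlasz--Sobolev functions\<close>

lemma epowr_cmult:
  assumes "0 < c" shows "epowr (ennreal c * u) a = ennreal (c powr a) * epowr u a"
  using assms by (cases u) (auto simp: epowr_ennreal powr_mult ennreal_mult_top simp flip: ennreal_mult)

lemma Lp_norm_le:
  assumes "0 < C" "0 < p" "(\<integral>\<^sup>+x. epowr (u x) p \<partial>M) \<le> ennreal C * (\<integral>\<^sup>+x. epowr (v x) p \<partial>M)"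
  shows "Lp_norm M p u \<le> ennreal (C powr (1 / p)) * Lp_norm M p v"
  unfolding Lp_norm_def epowr_cmult[OF assms(1), symmetric] using assms by (intro epowr_mono) auto

lemma powr_add_le:
  fixes a b p :: real
  assumes "0 \<le> a" "0 \<le> b" "0 < p"
  shows "(a + b) powr p \<le> 2 powr p * (a powr p + b powr p)"
proof -
  have "(a + b) powr p \<le> (2 * max a b) powr p" using assms by (intro powr_mono2) auto
  also have "\<dots> = 2 powr p * max a b powr p" using assms by (simp add: powr_mult)
  also have "max a b powr p \<le> a powr p + b powr p" by (auto simp: max_def)
  finally show ?thesis by simp
qed

context doubling_space
begin

lemma not_null_ball:
  assumes "N \<in> null_sets M" "0 < r"
  shows "\<exists>y\<in>ball x r. y \<notin> N"
proof (rule ccontr)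
  assume "\<not> ?thesis"
  then have "emeasure M (ball x r) \<le> emeasure M N" using assms(1) by (intro emeasure_mono) auto
  then show False using ball_pos[OF assms(2), of x] assms(1) by auto
qed

text \<open>If \<open>H\<close> exceeded \<open>c\<close> almost everywhere on the ball, then
  \<open>H - c\<close> would be positive there with integral 0, which contradicts the positive
  measure of the ball. This argument yields the non-strict bound also when the average equals
  \<open>c\<close>.\<close>

lemma ex_small_point:
  assumes [measurable]: "H \<in> borel_measurable M" and E: "E \<in> null_sets M" and \<rho>: "0 < \<rho>"
    and c: "0 \<le> c" "(\<integral>\<^sup>+w\<in>ball z \<rho>. H w \<partial>M) \<le> ennreal (c * vol M z \<rho>)"
  shows "\<exists>w\<in>ball z \<rho>. w \<notin> E \<and> H w \<le> ennreal c"
proof (rule ccontr)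
  assume "\<not> ?thesis"
  then have gt: "ennreal c < H w" if "w \<in> ball z \<rho>" "w \<notin> E" for w using that by (auto simp: not_le)
  let ?D = "\<lambda>w. (H w - ennreal c) * indicator (ball z \<rho>) w"
  have "AE w in M. w \<notin> E" using E by (rule AE_not_in)
  then have "(\<integral>\<^sup>+w. ennreal c * indicator (ball z \<rho>) w + ?D w \<partial>M) \<le> (\<integral>\<^sup>+w\<in>ball z \<rho>. H w \<partial>M)"
    using gt by (intro nn_integral_mono_AE) (auto elim!: eventually_mono simp: indicator_def add_diff_inverse_ennreal less_imp_le)
  also have "\<dots> \<le> ennreal (c * vol M z \<rho>)" by (rule c)
  also have "(\<integral>\<^sup>+w. ennreal c * indicator (ball z \<rho>) w + ?D w \<partial>M) = ennreal (c * vol M z \<rho>) + (\<integral>\<^sup>+w. ?D w \<partial>M)"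
    using c(1) by (subst nn_integral_add) (auto simp: nn_integral_cmult_indicator emeasure_ball ennreal_mult)
  finally have "ennreal (c * vol M z \<rho>) + (\<integral>\<^sup>+w. ?D w \<partial>M) \<le> ennreal (c * vol M z \<rho>) + 0" by simp
  then have "(\<integral>\<^sup>+w. ?D w \<partial>M) = 0"
    by (subst (asm) ennreal_add_left_cancel_le) auto
  then have "AE w in M. ?D w = 0" by (subst (asm) nn_integral_0_iff_AE) auto
  with \<open>AE w in M. w \<notin> E\<close> have "AE w in M. w \<notin> ball z \<rho>"
  proof eventually_elim
    case (elim w)
    then show ?case using gt[of w] by (auto simp: indicator_def diff_eq_0_iff_ennreal split: if_splits)
  qed
  then have "ball z \<rho> \<in> null_sets M" by (simp add: AE_iff_null_sets)
  then show False using ball_pos[OF \<rho>, of z] by auto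
qed

definition qexp :: "real \<Rightarrow> real" where "qexp s = n / (n + s)"

definition c1 :: "real \<Rightarrow> real" where "c1 s = (K * 3 powr n) powr (1 / qexp s)"

text \<open>The divisor is the one for which telescoping steps of ratio \<open>2 powr n\<close>
  close in an induction without loss.\<close>

definition c2 :: "real \<Rightarrow> real" where "c2 s = 2 * c1 s * 2 powr (n + 2 * s) / (2 powr n - 1)"

definition cP :: "real \<Rightarrow> real" where "cP s = c2 s + 3 * c1 s + 2"

lemma c_nonneg: "0 \<le> c1 s" "0 \<le> c2 s" "0 < cP s"
proof -
  have "1 \<le> (2::real) powr n" using n_pos ge_one_powr_ge_zero[of 2 n] by simp
  then show *: "0 \<le> c1 s" "0 \<le> c2 s" by (auto simp: c1_def c2_def)
  then show "0 < cP s" by (simp add: cP_def)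
qed

end

section \<open>Chains and oscillation for one fixed gradient\<close>

locale hajlasz_function = doubling_space M K n
  for M :: "'a::metric_space measure" and K n :: real +
  fixes s p :: real and f :: "'a \<Rightarrow> 'k::{real_normed_field, banach, second_countable_topology}"
    and g :: "'a \<Rightarrow> real" and E :: "'a set"
  assumes s: "0 < s" "s \<le> 1"
    and p: "n / (n + s) < p"
    and f_meas [measurable]: "f \<in> borel_measurable M"
    and g_meas [measurable]: "g \<in> borel_measurable M"
    and g_nonneg: "0 \<le> g x"
    and g_Lp: "(\<integral>\<^sup>+x. ennreal (g x powr p) \<partial>M) < top"
    and E_null: "E \<in> null_sets M"
    and grad: "x \<notin> E \<Longrightarrow> y \<notin> E \<Longrightarrow> norm (f x - f y) \<le> dist x y powr s * (g x + g y)"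
begin

abbreviation "q \<equiv> qexp s"

lemma q: "0 < q" "q < 1" "n / q = n + s" "1 - s / (n + s) = q" "q < p" "n / (n + s) = q"
  using n_pos s p by (auto simp: qexp_def field_simps add_pos_pos)

lemma p_pos: "0 < p" using q by simp

definition Gq :: "'a \<Rightarrow> ennreal" where "Gq x = ennreal (g x powr q)"

lemma Gq_meas [measurable]: "Gq \<in> borel_measurable M"
  unfolding Gq_def by measurable

context
  fixes A \<rho> :: real and x z :: 'a
  assumes A: "0 < A" and avg: "\<And>R. 0 < R \<Longrightarrow> (\<integral>\<^sup>+w\<in>ball x R. Gq w \<partial>M) \<le> ennreal (A powr q * vol M x R)"
    and x: "x \<notin> E" and z: "z \<notin> E" and xz: "dist x z < \<rho>"
begin

lemma rho_pos: "0 < \<rho>" using xz zero_le_dist[of x z] by linarith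

text \<open>Only averages centred at \<open>x\<close> are controlled, so the small ball about
  \<open>z\<close> is enlarged to \<open>ball x (2 * \<rho>)\<close>. The volume factor
  \<open>K * (3 * 2 ^ i) powr n\<close> passes from \<open>g powr q\<close> to \<open>g\<close>
  through the power \<open>1 / q\<close>, and \<open>n / q = n + s\<close>.\<close>

lemma ex_chain_point:
  "\<exists>w. dist z w < \<rho> / 2 ^ i \<and> w \<notin> E \<and> g w \<le> c1 s * A * 2 powr (real i * (n + s))"
proof -
  let ?R = "\<rho> / 2 ^ i" and ?c = "A powr q * (K * (3 * 2 ^ i) powr n)"
  have R: "0 < ?R" "?R \<le> \<rho>" using rho_pos by (auto simp: field_simps mult_ge1_le)
  have sub: "ball z ?R \<subseteq> ball x (2 * \<rho>)"
  proof
    fix w assume "w \<in> ball z ?R"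
    then show "w \<in> ball x (2 * \<rho>)" using dist_triangle[of x w z] xz R by simp
  qed
  have "(\<integral>\<^sup>+w\<in>ball z ?R. Gq w \<partial>M) \<le> (\<integral>\<^sup>+w\<in>ball x (2 * \<rho>). Gq w \<partial>M)"
    using sub by (intro nn_integral_mono mult_left_mono) (auto simp: indicator_def)
  also have "\<dots> \<le> ennreal (A powr q * vol M x (2 * \<rho>))" using rho_pos by (intro avg) auto
  also have "\<dots> \<le> ennreal (?c * vol M z ?R)"
  proof (rule ennreal_leI)
    have "(1::real) \<le> 2 ^ i" by simp
    then have "1 \<le> 3 * (2::real) ^ i" by linarith
    then have "vol M x (2 * \<rho>) \<le> K * (3 * 2 ^ i) powr n * vol M z ?R"
      using R xz by (intro vol_compare) (auto simp: dist_commute)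
    then show "A powr q * vol M x (2 * \<rho>) \<le> ?c * vol M z ?R"
      by (simp add: mult.assoc mult_left_mono)
  qed
  finally obtain w where w: "w \<in> ball z ?R" "w \<notin> E" "Gq w \<le> ennreal ?c"
    using ex_small_point[OF Gq_meas E_null R(1), of ?c z] K_ge_1 by auto
  have c: "0 \<le> ?c" using K_ge_1 by simp
  have "g w powr q \<le> ?c" using w(3) c by (simp add: Gq_def ennreal_le_iff)
  then have "(g w powr q) powr (1 / q) \<le> ?c powr (1 / q)" using q by (intro powr_mono2) auto
  also have "(g w powr q) powr (1 / q) = g w" using g_nonneg q by (simp add: powr_powr)
  also have "?c = A powr q * ((K * 3 powr n) * 2 powr (real i * n))"
    by (simp add: powr_mult powr_powr mult.assoc flip: powr_realpow)
  also have "(A powr q * ((K * 3 powr n) * 2 powr (real i * n))) powr (1 / q)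
      = A * (c1 s * 2 powr (real i * (n / q)))"
    using A q(1) K_ge_1 by (simp add: powr_mult powr_powr c1_def)
  finally show ?thesis using w q(3) by (auto simp: mult_ac)
qed

text \<open>
  All chain points \<open>Z i\<close> lie in balls about the same point \<open>z\<close>, so the chain cannot drift away.
\<close>

lemma chain_bound:
  "norm (f z - f x) \<le> cP s * \<rho> powr s * (g x + A * 2 powr (real m * n) + 2 powr (- real m * s) * g z)"
proof -
  obtain Z where Z: "\<And>i. dist z (Z i) < \<rho> / 2 ^ i" "\<And>i. Z i \<notin> E"
    "\<And>i. g (Z i) \<le> c1 s * A * 2 powr (real i * (n + s))"
    using ex_chain_point by metis
  have P: "0 < \<rho> powr s" using rho_pos by simp
  have d2: "0 < (2::real) powr n - 1" using n_pos powr_less_mono[of 0 n 2] by simp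
  have \<rho>i: "(\<rho> / 2 ^ i) powr s = \<rho> powr s * 2 powr (- real i * s)" for i
  proof -
    have "(2 ^ i) powr s = 2 powr (real i * s)" by (simp add: powr_powr flip: powr_realpow)
    then show ?thesis using rho_pos by (simp add: powr_divide powr_minus_divide)
  qed
  have step: "norm (f (Z (Suc i)) - f (Z i)) \<le> \<rho> powr s * A * (c2 s * (2 powr n - 1)) * 2 powr (real i * n)" for i
  proof -
    have "dist (Z (Suc i)) (Z i) \<le> 2 * (\<rho> / 2 ^ i)"
    proof -
      have "dist (Z (Suc i)) (Z i) \<le> dist z (Z (Suc i)) + dist z (Z i)" by (metis dist_commute dist_triangle)
      moreover have "\<rho> / 2 ^ Suc i \<le> \<rho> / 2 ^ i" using rho_pos by (intro divide_left_mono) auto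
      ultimately show ?thesis using Z(1)[of i] Z(1)[of "Suc i"] by linarith
    qed
    then have "dist (Z (Suc i)) (Z i) powr s \<le> (2 * (\<rho> / 2 ^ i)) powr s" using s by (intro powr_mono2) auto
    also have "\<dots> = 2 powr s * (\<rho> powr s * 2 powr (- real i * s))"
      using rho_pos by (subst powr_mult) (auto simp: \<rho>i)
    finally have d: "dist (Z (Suc i)) (Z i) powr s \<le> 2 powr s * (\<rho> powr s * 2 powr (- real i * s))" .
    have "c1 s * A * 2 powr (real i * (n + s)) \<le> c1 s * A * 2 powr (real (Suc i) * (n + s))"
      using c_nonneg A n_pos s by (intro mult_left_mono powr_mono mult_right_mono) auto
    then have gs: "g (Z (Suc i)) + g (Z i) \<le> 2 * (c1 s * A * 2 powr (real (Suc i) * (n + s)))"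
      using Z(3)[of i] Z(3)[of "Suc i"] by linarith
    have "norm (f (Z (Suc i)) - f (Z i)) \<le> dist (Z (Suc i)) (Z i) powr s * (g (Z (Suc i)) + g (Z i))"
      by (intro grad Z)
    also have "\<dots> \<le> (2 powr s * (\<rho> powr s * 2 powr (- real i * s))) * (2 * (c1 s * A * 2 powr (real (Suc i) * (n + s))))"
      using d gs g_nonneg by (intro mult_mono) auto
    also have "\<dots> = \<rho> powr s * A * (2 * c1 s) * (2 powr s * 2 powr (- real i * s) * 2 powr (real (Suc i) * (n + s)))"
      by (simp add: mult_ac)
    also have "2 powr s * 2 powr (- real i * s) * 2 powr (real (Suc i) * (n + s)) = 2 powr (n + 2 * s) * 2 powr (real i * n)"
      by (simp add: algebra_simps flip: powr_add)
    finally show ?thesis using d2 n_pos by (simp add: c2_def mult_ac)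
  qed
  have tele: "norm (f (Z m) - f (Z 0)) \<le> \<rho> powr s * A * c2 s * 2 powr (real m * n)" for m
  proof (induction m)
    case 0 then show ?case using c_nonneg(2)[of s] A P by simp
  next
    case (Suc m)
    have "norm (f (Z (Suc m)) - f (Z 0)) \<le> norm (f (Z (Suc m)) - f (Z m)) + norm (f (Z m) - f (Z 0))"
      by (metis norm_triangle_ineq diff_add_cancel add_diff_eq)
    also have "\<dots> \<le> \<rho> powr s * A * (c2 s * (2 powr n - 1)) * 2 powr (real m * n) + \<rho> powr s * A * c2 s * 2 powr (real m * n)"
      using step Suc by (intro add_mono)
    also have "\<dots> = \<rho> powr s * A * c2 s * (2 powr n * 2 powr (real m * n))" by (simp add: algebra_simps)
    also have "2 powr n * 2 powr (real m * n) = 2 powr (real (Suc m) * n)" by (simp add: algebra_simps flip: powr_add)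
    finally show ?case .
  qed
  have last: "norm (f z - f (Z m)) \<le> \<rho> powr s * (2 powr (- real m * s) * g z + c1 s * (A * 2 powr (real m * n)))"
  proof -
    have "norm (f z - f (Z m)) \<le> dist z (Z m) powr s * (g z + g (Z m))" by (intro grad z Z)
    also have "\<dots> \<le> (\<rho> / 2 ^ m) powr s * (g z + c1 s * A * 2 powr (real m * (n + s)))"
      using Z(1,3)[of m] g_nonneg s by (intro mult_mono powr_mono2 add_left_mono) auto
    also have "\<dots> = \<rho> powr s * (2 powr (- real m * s) * g z + c1 s * (A * (2 powr (- real m * s) * 2 powr (real m * (n + s)))))"
      by (simp add: \<rho>i algebra_simps)
    also have "2 powr (- real m * s) * 2 powr (real m * (n + s)) = 2 powr (real m * n)"
      by (simp add: algebra_simps flip: powr_add)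
    finally show ?thesis .
  qed
  have first: "norm (f (Z 0) - f x) \<le> \<rho> powr s * (2 * g x + 2 * c1 s * (A * 2 powr (real m * n)))"
  proof -
    have 1: "1 \<le> 2 powr (real m * n)" using n_pos by (intro ge_one_powr_ge_zero) auto
    have "dist (Z 0) x \<le> 2 * \<rho>" using Z(1)[of 0] xz dist_triangle[of "Z 0" x z] by (simp add: dist_commute)
    then have "dist (Z 0) x powr s \<le> (2 * \<rho>) powr s" using s by (intro powr_mono2) auto
    also have "\<dots> = 2 powr s * \<rho> powr s" using rho_pos by (simp add: powr_mult)
    also have "\<dots> \<le> 2 * \<rho> powr s" using s powr_mono[of s 1 2] P by simp
    finally have d: "dist (Z 0) x powr s \<le> 2 * \<rho> powr s" .
    have "norm (f (Z 0) - f x) \<le> dist (Z 0) x powr s * (g (Z 0) + g x)" by (intro grad x Z)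
    also have "\<dots> \<le> (2 * \<rho> powr s) * (c1 s * A + g x)"
      using d Z(3)[of 0] g_nonneg P by (intro mult_mono) auto
    also have "\<dots> \<le> (2 * \<rho> powr s) * (c1 s * A * 2 powr (real m * n) + g x)"
      using 1 c_nonneg(1)[of s] A P mult_left_mono[OF 1, of "c1 s * A"] by (intro mult_left_mono) auto
    finally show ?thesis by (simp add: algebra_simps)
  qed
  have "norm (f z - f x) = norm ((f z - f (Z m)) + (f (Z m) - f (Z 0)) + (f (Z 0) - f x))" by simp
  also have "\<dots> \<le> norm (f z - f (Z m)) + norm (f (Z m) - f (Z 0)) + norm (f (Z 0) - f x)"
    by (intro norm_triangle_mono order_refl)
  also have "\<dots> \<le> \<rho> powr s * (2 powr (- real m * s) * g z + c1 s * (A * 2 powr (real m * n)))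
      + \<rho> powr s * A * c2 s * 2 powr (real m * n) + \<rho> powr s * (2 * g x + 2 * c1 s * (A * 2 powr (real m * n)))"
    using last tele first by (intro add_mono)
  also have "\<dots> = \<rho> powr s * (2 * g x + (c2 s + 3 * c1 s) * (A * 2 powr (real m * n)) + 1 * (2 powr (- real m * s) * g z))"
    by (simp add: algebra_simps)
  also have "\<dots> \<le> \<rho> powr s * (cP s * g x + cP s * (A * 2 powr (real m * n)) + cP s * (2 powr (- real m * s) * g z))"
    using c_nonneg[of s] A g_nonneg P by (intro mult_left_mono add_mono mult_right_mono) (auto simp: cP_def)
  finally show ?thesis by (simp add: algebra_simps)
qed

text \<open>
  The choice of \<open>m\<close> in the chain that balances the two terms, \<open>2\<^sup>m\<^sup>(\<^sup>n\<^sup>+\<^sup>s\<^sup>) \<approx> g z / A\<close>, leaves the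
  power \<open>g z powr q\<close>, the largest one controlled by the averages of \<open>Gq\<close>.
\<close>

lemma pointwise_poincare:
  "norm (f z - f x) \<le> 3 * cP s * \<rho> powr s * (g x + A + A powr (1 - q) * g z powr q)"
proof -
  have P: "0 < cP s * \<rho> powr s" using rho_pos c_nonneg(3) by simp
  show ?thesis
  proof (cases "g z \<le> A")
    case True
    have "norm (f z - f x) \<le> cP s * \<rho> powr s * (g x + A + g z)" using chain_bound[of 0] A by simp
    also have "\<dots> \<le> cP s * \<rho> powr s * (3 * (g x + A + A powr (1 - q) * g z powr q))"
    proof (rule mult_left_mono)
      have "g x + A + g z \<le> 3 * (g x + A + t)" if "0 \<le> t" for t
        using that True g_nonneg[of x] A by simp
      then show "g x + A + g z \<le> 3 * (g x + A + A powr (1 - q) * g z powr q)" by simp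
    qed (use P in simp)
    finally show ?thesis by (simp only: mult.left_commute[of _ 3] mult.assoc)
  next
    case False
    define L where "L = log 2 (g z / A)"
    have gz: "g z = A * 2 powr L" using False A by (simp add: L_def)
    have L: "0 < L" using False A by (simp add: L_def)
    have ns: "0 < n + s" using n_pos s by simp
    define m where "m = nat \<lfloor>L / (n + s)\<rfloor>"
    have "0 \<le> L / (n + s)" using L ns by simp
    then have m: "real m \<le> L / (n + s)" "L / (n + s) < real m + 1" unfolding m_def by linarith+
    have Lq: "A powr (1 - q) * g z powr q = A * 2 powr (L * q)"
      using A by (simp add: gz powr_mult powr_powr powr_diff)
    have "real m * n \<le> L / (n + s) * n" using m n_pos by (intro mult_right_mono) auto
    also have "\<dots> = L * q" by (simp add: qexp_def)
    finally have 1: "A * 2 powr (real m * n) \<le> A * 2 powr (L * q)" using A by simp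
    have "L / (n + s) * s \<le> (real m + 1) * s" using m s by (intro mult_right_mono) auto
    then have "- real m * s + L \<le> 1 + (L - L / (n + s) * s)" using s by (simp add: algebra_simps)
    also have "L - L / (n + s) * s = L * (1 - s / (n + s))" by (simp add: algebra_simps)
    also have "\<dots> = L * q" using q(4) by simp
    finally have "2 powr (- real m * s + L) \<le> (2::real) powr (1 + L * q)" by simp
    also have "2 powr (1 + L * q) = 2 * 2 powr (L * q)" by (simp add: powr_add)
    finally have "2 powr (- real m * s) * 2 powr L \<le> 2 * 2 powr (L * q)" by (simp only: powr_add)
    then have "A * (2 powr (- real m * s) * 2 powr L) \<le> A * (2 * 2 powr (L * q))" using A by (intro mult_left_mono) auto
    then have 2: "2 powr (- real m * s) * g z \<le> 2 * (A * 2 powr (L * q))" by (simp add: gz mult_ac)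
    have "norm (f z - f x) \<le> cP s * \<rho> powr s * (g x + A * 2 powr (real m * n) + 2 powr (- real m * s) * g z)"
      by (rule chain_bound)
    also have "\<dots> \<le> cP s * \<rho> powr s * (3 * (g x + A + A powr (1 - q) * g z powr q))"
      unfolding Lq
    proof (rule mult_left_mono)
      have "g x + a + b \<le> 3 * (g x + A + t)" if "a \<le> t" "b \<le> 2 * t" for a b t
        using that g_nonneg[of x] A by simp
      then show "g x + A * 2 powr (real m * n) + 2 powr (- real m * s) * g z \<le> 3 * (g x + A + A * 2 powr (L * q))"
        using 1 2 .
    qed (use P in simp)
    finally show ?thesis by (simp only: mult.left_commute[of _ 3] mult.assoc)
  qed
qed

end

text \<open>Integrate \<open>pointwise_poincare\<close> in \<open>z\<close>: the factor
  \<open>A powr (1 - q)\<close> combines with the average of \<open>g powr q\<close>, at most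
  \<open>A powr q\<close>, to \<open>A\<close>.\<close>

lemma oscillation_ball:
  assumes A: "0 \<le> A" and avg: "\<And>R. 0 < R \<Longrightarrow> (\<integral>\<^sup>+w\<in>ball x R. Gq w \<partial>M) \<le> ennreal (A powr q * vol M x R)"
    and x: "x \<notin> E" and \<rho>: "0 < \<rho>"
  shows "(\<integral>\<^sup>+z\<in>ball x \<rho>. ennreal (norm (f z - f x)) \<partial>M)
    \<le> ennreal (\<rho> powr s * vol M x \<rho>) * ennreal (6 * cP s * (g x + A))"
proof (rule ennreal_le_epsilon)
  fix e :: real assume e: "0 < e"
  define c where "c = 6 * cP s * (\<rho> powr s * vol M x \<rho>)"
  have c: "0 < c" using \<rho> vol_pos[OF \<rho>, of x] c_nonneg(3)[of s] by (simp add: c_def)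
  \<comment> \<open>The pointwise estimate requires a positive bound, whereas \<open>A\<close> may
    be 0. The increment is chosen so that it adds exactly \<open>e\<close> to the final
    estimate.\<close>
  define B where "B = A + e / c"
  have B: "0 < B" "A \<le> B" using A e c by (auto simp: B_def add_nonneg_pos)
  let ?C = "3 * cP s * \<rho> powr s"
  have C: "0 < ?C" using \<rho> c_nonneg(3) by simp
  have avgB: "(\<integral>\<^sup>+w\<in>ball x R. Gq w \<partial>M) \<le> ennreal (B powr q * vol M x R)" if "0 < R" for R
    using avg[OF that] A B q by (rule_tac order_trans) (auto intro!: ennreal_leI mult_right_mono powr_mono2)
  have "AE z in M. z \<notin> E" using E_null by (rule AE_not_in)
  then have "(\<integral>\<^sup>+z\<in>ball x \<rho>. ennreal (norm (f z - f x)) \<partial>M)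
      \<le> (\<integral>\<^sup>+z. ennreal (?C * (g x + B)) * indicator (ball x \<rho>) z + ennreal (?C * B powr (1 - q)) * (Gq z * indicator (ball x \<rho>) z) \<partial>M)"
  proof (intro nn_integral_mono_AE, eventually_elim)
    case (elim z)
    show ?case
    proof (cases "z \<in> ball x \<rho>")
      case True
      have "norm (f z - f x) \<le> ?C * (g x + B + B powr (1 - q) * g z powr q)"
        using B avgB x elim True by (intro pointwise_poincare) auto
      also have "\<dots> = ?C * (g x + B) + ?C * B powr (1 - q) * g z powr q" by (simp add: algebra_simps)
      finally have "ennreal (norm (f z - f x)) \<le> ennreal (?C * (g x + B) + ?C * B powr (1 - q) * g z powr q)"
        by (rule ennreal_leI)
      then show ?thesis using True C B g_nonneg[of x]
        by (simp add: Gq_def ennreal_mult[symmetric] flip: ennreal_plus)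
    qed simp
  qed
  also have "\<dots> = ennreal (?C * (g x + B)) * ennreal (vol M x \<rho>) + ennreal (?C * B powr (1 - q)) * (\<integral>\<^sup>+z\<in>ball x \<rho>. Gq z \<partial>M)"
    by (subst nn_integral_add) (auto simp: nn_integral_cmult nn_integral_cmult_indicator emeasure_ball)
  also have "\<dots> \<le> ennreal (?C * (g x + B)) * ennreal (vol M x \<rho>) + ennreal (?C * B powr (1 - q)) * ennreal (B powr q * vol M x \<rho>)"
    using avgB[OF \<rho>] by (intro add_left_mono mult_left_mono) auto
  also have "\<dots> = ennreal (?C * (g x + B) * vol M x \<rho> + ?C * B powr (1 - q) * (B powr q * vol M x \<rho>))"
    using C B g_nonneg[of x] by (simp flip: ennreal_mult ennreal_plus)
  also have "\<dots> \<le> ennreal (\<rho> powr s * vol M x \<rho> * (6 * cP s * (g x + A)) + e)"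
  proof (rule ennreal_leI)
    have "B powr (1 - q) * B powr q = B" using B by (simp flip: powr_add)
    then have "?C * B powr (1 - q) * (B powr q * vol M x \<rho>) = ?C * B * vol M x \<rho>"
      by (metis mult.assoc)
    then have "?C * (g x + B) * vol M x \<rho> + ?C * B powr (1 - q) * (B powr q * vol M x \<rho>)
       = ?C * vol M x \<rho> * (g x + 2 * B)" by (simp add: algebra_simps)
    also have "\<dots> \<le> ?C * vol M x \<rho> * (2 * (g x + B))" using C g_nonneg[of x] by (intro mult_left_mono) auto
    also have "\<dots> = c * (g x + B)" by (simp add: c_def)
    also have "\<dots> = c * (g x + A) + e" using c by (simp add: B_def field_simps)
    finally show "?C * (g x + B) * vol M x \<rho> + ?C * B powr (1 - q) * (B powr q * vol M x \<rho>)
       \<le> \<rho> powr s * vol M x \<rho> * (6 * cP s * (g x + A)) + e" by (simp add: c_def mult_ac)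
  qed
  also have "\<dots> = ennreal (\<rho> powr s * vol M x \<rho>) * ennreal (6 * cP s * (g x + A)) + ennreal e"
    using A e g_nonneg[of x] c_nonneg(3)[of s] by (simp flip: ennreal_mult)
  finally show "(\<integral>\<^sup>+z\<in>ball x \<rho>. ennreal (norm (f z - f x)) \<partial>M)
    \<le> ennreal (\<rho> powr s * vol M x \<rho>) * ennreal (6 * cP s * (g x + A)) + ennreal e" .
qed

text \<open>The gradient plus the maximal operator of order \<open>q\<close>. Where
  \<open>maxf Gq\<close> is infinite, \<open>enn2real\<close> returns 0 and the formula is
  meaningless; those points are put into \<open>N\<close>.\<close>

definition hg :: "'a \<Rightarrow> real" where
  "hg x = g x + (cM * enn2real (maxf Gq x)) powr (1 / q)"

definition N :: "'a set" where "N = E \<union> {x. maxf Gq x = top}"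

lemma hg_meas [measurable]: "hg \<in> borel_measurable M"
  unfolding hg_def by measurable

lemma hg_nonneg: "0 \<le> hg x"
  using g_nonneg by (simp add: hg_def)

lemma oscillation:
  assumes x: "x \<notin> N" and \<rho>: "0 < \<rho>"
  shows "(\<integral>\<^sup>+z\<in>ball x \<rho>. ennreal (norm (f z - f x)) \<partial>M)
    \<le> ennreal (\<rho> powr s * vol M x \<rho>) * ennreal (6 * cP s * hg x)"
  unfolding hg_def
proof (rule oscillation_ball)
  fix R :: real assume R: "0 < R"
  obtain m where m: "maxf Gq x = ennreal m" "0 \<le> m" using x by (cases "maxf Gq x") (auto simp: N_def)
  have "(\<integral>\<^sup>+w\<in>ball x R. Gq w \<partial>M) \<le> ennreal (cM * vol M x R) * maxf Gq x" by (rule ball_le_maxf[OF R])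
  also have "\<dots> = ennreal (((cM * m) powr (1 / q)) powr q * vol M x R)"
    using m cM_ge_1 q by (simp add: powr_powr mult_ac flip: ennreal_mult)
  finally show "(\<integral>\<^sup>+w\<in>ball x R. Gq w \<partial>M) \<le> ennreal (((cM * enn2real (maxf Gq x)) powr (1 / q)) powr q * vol M x R)"
    using m by simp
qed (use x \<rho> in \<open>auto simp: N_def\<close>)

end

context doubling_space
begin

section \<open>The oscillation bound in the Lebesgue space\<close>

definition cmax :: "real \<Rightarrow> real \<Rightarrow> real" where
  "cmax s p = 2 * cM * (4 powr (p / qexp s) / (1 - 2 powr (1 - p / qexp s)))"

definition clp :: "real \<Rightarrow> real \<Rightarrow> real" where
  "clp s p = 2 powr p * (1 + cM powr (p / qexp s) * cmax s p)"

end

context hajlasz_function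
begin

lemma pq: "1 < p / q" using q by simp

lemma cmax_nonneg: "0 \<le> cmax s p"
  using pq cM_ge_1 powr_mono[of "1 - p / q" 0 2] by (simp add: cmax_def)

lemma clp_pos: "0 < clp s p"
  using cmax_nonneg by (auto simp: clp_def intro!: mult_pos_pos add_pos_nonneg)

lemma maxf_Lp: "(\<integral>\<^sup>+x. epowr (maxf Gq x) (p / q) \<partial>M) \<le> ennreal (cmax s p) * (\<integral>\<^sup>+x. ennreal (g x powr p) \<partial>M)"
proof -
  have "(\<integral>\<^sup>+x. epowr (maxf (\<lambda>x. ennreal (g x powr q)) x) (p / q) \<partial>M)
    \<le> ennreal (2 * cM * (4 powr (p / q) / (1 - 2 powr (1 - p / q)))) * (\<integral>\<^sup>+x. ennreal ((g x powr q) powr (p / q)) \<partial>M)"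
    using pq by (intro maximal_theorem) auto
  then show ?thesis using q by (simp add: cmax_def Gq_def[abs_def] powr_powr)
qed

text \<open>As \<open>p / q\<close> exceeds 1, the maximal theorem applies to
  \<open>g powr q\<close> with this exponent and makes \<open>maxf Gq\<close> finite almost
  everywhere.\<close>

lemma N_null: "N \<in> null_sets M"
proof -
  have "(\<integral>\<^sup>+x. epowr (maxf Gq x) (p / q) \<partial>M) < top"
    using maxf_Lp g_Lp by (auto simp: ennreal_mult_less_top intro: le_less_trans)
  then have "AE x in M. epowr (maxf Gq x) (p / q) \<noteq> \<infinity>"
    by (intro nn_integral_noteq_infinite) auto
  then have "AE x in M. \<not> maxf Gq x = top" by (auto elim!: eventually_mono)
  moreover have "{x \<in> space M. maxf Gq x = top} \<in> sets M" by measurable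
  ultimately have "{x. maxf Gq x = top} \<in> null_sets M"
    by (subst (asm) AE_iff_null) auto
  then show ?thesis using E_null by (auto simp: N_def)
qed

lemma hg_Lp: "(\<integral>\<^sup>+x. ennreal (hg x powr p) \<partial>M) \<le> ennreal (clp s p) * (\<integral>\<^sup>+x. ennreal (g x powr p) \<partial>M)"
proof -
  let ?I = "\<integral>\<^sup>+x. ennreal (g x powr p) \<partial>M"
  let ?c = "cM powr (p / q)"
  have "(\<integral>\<^sup>+x. ennreal (hg x powr p) \<partial>M)
    \<le> (\<integral>\<^sup>+x. ennreal (2 powr p) * (ennreal (g x powr p) + ennreal ?c * epowr (maxf Gq x) (p / q)) \<partial>M)"
  proof (rule nn_integral_mono)
    fix x
    show "ennreal (hg x powr p) \<le> ennreal (2 powr p) * (ennreal (g x powr p) + ennreal ?c * epowr (maxf Gq x) (p / q))"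
    proof (cases "maxf Gq x")
      case (real m)
      have "hg x powr p \<le> 2 powr p * (g x powr p + ((cM * m) powr (1 / q)) powr p)"
        unfolding hg_def using real g_nonneg p_pos by (simp add: powr_add_le)
      also have "((cM * m) powr (1 / q)) powr p = ?c * m powr (p / q)"
        using real cM_ge_1 by (simp add: powr_powr powr_mult)
      finally show ?thesis using real by (simp add: epowr_ennreal ennreal_leI flip: ennreal_mult ennreal_plus)
    next
      case top
      have "0 < ?c" using cM_ge_1 by simp
      then show ?thesis using top by (simp add: ennreal_mult_top)
    qed
  qed
  also have "\<dots> = ennreal (2 powr p) * (?I + ennreal ?c * (\<integral>\<^sup>+x. epowr (maxf Gq x) (p / q) \<partial>M))"
    by (simp add: nn_integral_cmult nn_integral_add)
  also have "\<dots> \<le> ennreal (2 powr p) * (?I + ennreal ?c * (ennreal (cmax s p) * ?I))"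
    by (intro mult_left_mono add_left_mono maxf_Lp) auto
  also have "\<dots> = ennreal (clp s p) * ?I"
    using cmax_nonneg by (simp add: clp_def ennreal_mult distrib_left distrib_right mult.assoc)
  finally show ?thesis .
qed

end

context doubling_space
begin

section \<open>Test functions and controlled functionals\<close>

abbreviation tests :: "'a \<Rightarrow> ('a \<Rightarrow> 'k::real_normed_vector) set" where
  "tests x1 \<equiv> test_space M x1 1 1 2"

text \<open>The constant is uniform in the function. Its size is irrelevant for membership and for
  boundedness of a functional; quantitative moves use \<open>molecule_change\<close>.\<close>

lemma molecule_recentre:
  assumes "0 < r" "0 < r'"
  obtains C where "0 < C" "\<And>\<phi> :: 'a \<Rightarrow> 'k::real_normed_vector. \<And>D. molecule x r \<phi> D \<Longrightarrow> 0 \<le> D \<Longrightarrow> molecule y r' \<phi> (C * D)"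
proof -
  define A where "A = max 1 (max (dist x y / r') (max (r / r') (r' / r)))"
  have "dist x y / r' \<le> A" "r / r' \<le> A" "r' / r \<le> A" "1 \<le> A" by (auto simp: A_def)
  then have A: "1 \<le> A" "dist x y \<le> A * r'" "r \<le> A * r'" "r' \<le> A * r" using assms by (auto simp: field_simps)
  show ?thesis
  proof
    show "0 < chg A" using A by (simp add: chg_pos)
    show "molecule y r' \<phi> (chg A * D)" if "molecule x r \<phi> D" "0 \<le> D" for \<phi> :: "'a \<Rightarrow> 'k" and D
      using that assms A by (intro molecule_change) auto
  qed
qed

lemma molecule_in_tests:
  assumes "molecule x r \<phi> D" "0 \<le> D" "0 < r"
  shows "\<phi> \<in> tests x1"
proof -
  obtain C where C: "0 < C" "molecule x1 1 \<phi> (C * D)"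
    using molecule_recentre[of r 1 x x1] assms by (metis zero_less_one)
  then have "test_bound M x1 1 1 2 \<phi> (18 * K * 2 powr n * (C * D))"
    using assms by (intro molecule_test_bound) auto
  then show ?thesis unfolding test_space_def by blast
qed

lemma tests_molecule:
  assumes "\<phi> \<in> tests x1" "0 < r"
  obtains D where "0 \<le> D" "molecule x r \<phi> D"
proof -
  obtain C0 where C0: "test_bound M x1 1 1 2 \<phi> C0" using assms(1) by (auto simp: test_space_def)
  then have m: "molecule x1 1 \<phi> (3 * K * 2 powr n * C0)" by (rule test_bound_molecule) simp
  have "0 \<le> 3 * K * 2 powr n * C0" using C0 K_ge_1 by (simp add: test_bound_def)
  with m obtain C where "0 < C" "molecule x r \<phi> (C * (3 * K * 2 powr n * C0))"
    using molecule_recentre[of 1 r x1 x] assms(2) by (metis zero_less_one)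
  then show ?thesis using \<open>0 \<le> 3 * K * 2 powr n * C0\<close> by (intro that[of "C * (3 * K * 2 powr n * C0)"]) auto
qed

lemma tests_lincomb:
  fixes \<phi> \<psi> :: "'a \<Rightarrow> 'k::real_normed_field"
  assumes "\<phi> \<in> tests x1" "\<psi> \<in> tests x1"
  shows "(\<lambda>x. a * \<phi> x + b * \<psi> x) \<in> tests x1"
proof -
  obtain D where D: "0 \<le> D" "molecule x1 1 \<phi> D" using tests_molecule[OF assms(1) zero_less_one] by blast
  obtain D' where D': "0 \<le> D'" "molecule x1 1 \<psi> D'" using tests_molecule[OF assms(2) zero_less_one] by blast
  have "molecule x1 1 (\<lambda>x. a * \<phi> x + b * \<psi> x) (norm a * D + norm b * D')"
    by (intro molecule_add molecule_cmult D D')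
  then show ?thesis using D(1) D'(1) by (intro molecule_in_tests[of x1 1 _ "norm a * D + norm b * D'"]) auto
qed

lemma psi_in_tests: "0 < r \<Longrightarrow> psi x r \<in> tests x1"
  using psi_molecule cpsi_pos by (blast intro: molecule_in_tests less_imp_le)

definition linear_on_tests :: "'a \<Rightarrow> (('a \<Rightarrow> 'k::real_normed_field) \<Rightarrow> 'k) \<Rightarrow> bool" where
  "linear_on_tests x1 F \<longleftrightarrow> (\<forall>\<phi>\<in>tests x1. \<forall>\<psi>\<in>tests x1. \<forall>a b.
     F (\<lambda>x. a * \<phi> x + b * \<psi> x) = a * F \<phi> + b * F \<psi>)"

lemma linear_on_testsD:
  assumes "linear_on_tests x1 F" "\<phi> \<in> tests x1" "\<psi> \<in> tests x1"
  shows "F (\<lambda>x. \<phi> x + b * \<psi> x) = F \<phi> + b * F \<psi>" "F (\<lambda>x. \<phi> x - \<psi> x) = F \<phi> - F \<psi>"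
    "F (\<lambda>x. a * \<phi> x) = a * F \<phi>" "F (\<lambda>x. 0) = 0" "F (\<lambda>x. \<phi> x + \<psi> x) = F \<phi> + F \<psi>"
proof -
  have *: "F (\<lambda>x. a * \<phi> x + b * \<psi> x) = a * F \<phi> + b * F \<psi>" for a b
    using assms by (simp add: linear_on_tests_def)
  show "F (\<lambda>x. \<phi> x + b * \<psi> x) = F \<phi> + b * F \<psi>" using *[of 1 b] by simp
  show "F (\<lambda>x. \<phi> x - \<psi> x) = F \<phi> - F \<psi>" using *[of 1 "-1"] by simp
  show "F (\<lambda>x. a * \<phi> x) = a * F \<phi>" using *[of a 0] by simp
  show "F (\<lambda>x. 0) = 0" using *[of 0 0] by simp
  show "F (\<lambda>x. \<phi> x + \<psi> x) = F \<phi> + F \<psi>" using *[of 1 1] by simp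
qed

definition ctl :: "'a \<Rightarrow> real \<Rightarrow> (('a \<Rightarrow> 'k::{real_normed_field,banach,second_countable_topology}) \<Rightarrow> 'k) \<Rightarrow>
    ('a \<Rightarrow> real) \<Rightarrow> 'a set \<Rightarrow> bool" where
  "ctl x1 s F g N \<longleftrightarrow> g \<in> borel_measurable M \<and> (\<forall>x. 0 \<le> g x) \<and> N \<in> null_sets M \<and> linear_on_tests x1 F \<and>
     (\<forall>x r D \<phi>. x \<notin> N \<longrightarrow> 0 < r \<longrightarrow> 0 \<le> D \<longrightarrow> molecule x r \<phi> D \<longrightarrow> (\<integral>z. \<phi> z \<partial>M) = 0 \<longrightarrow>
        norm (F \<phi>) \<le> D * r powr s * g x)"

lemma ctlD:
  assumes "ctl x1 s F g N"
  shows "g \<in> borel_measurable M" "0 \<le> g x" "N \<in> null_sets M" "linear_on_tests x1 F"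
    "x \<notin> N \<Longrightarrow> 0 < r \<Longrightarrow> 0 \<le> D \<Longrightarrow> molecule x r \<phi> D \<Longrightarrow> (\<integral>z. \<phi> z \<partial>M) = 0 \<Longrightarrow> norm (F \<phi>) \<le> D * r powr s * g x"
  using assms by (simp_all add: ctl_def)

definition cosc :: "real \<Rightarrow> real" where "cosc s = cw * (6 * cP s)"

lemma cosc_pos: "0 < cosc s"
  using cw_pos c_nonneg(3) by (simp add: cosc_def)

end

context hajlasz_function
begin

section \<open>Integration of a Sobolev function against molecules\<close>

lemma oscillation_wt:
  assumes x: "x \<notin> N" "0 < r" and D: "0 \<le> D"
  shows "(\<integral>\<^sup>+z. ennreal (D * norm (f z - f x)) * ennreal (wt x r z) \<partial>M) \<le> ennreal (D * (cosc s * r powr s * hg x))"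
proof -
  have "(\<integral>\<^sup>+z. ennreal (D * norm (f z - f x)) * ennreal (wt x r z) \<partial>M)
      \<le> ennreal (cw * r powr s) * (ennreal D * ennreal (6 * cP s * hg x))"
  proof (rule nn_integral_wt)
    fix \<rho> assume "r \<le> \<rho>"
    have "(\<integral>\<^sup>+z\<in>ball x \<rho>. ennreal (D * norm (f z - f x)) \<partial>M) = ennreal D * (\<integral>\<^sup>+z\<in>ball x \<rho>. ennreal (norm (f z - f x)) \<partial>M)"
      using D by (simp add: ennreal_mult mult.assoc nn_integral_cmult)
    also have "\<dots> \<le> ennreal D * (ennreal (\<rho> powr s * vol M x \<rho>) * ennreal (6 * cP s * hg x))"
      using x \<open>r \<le> \<rho>\<close> by (intro mult_left_mono oscillation) auto
    finally show "(\<integral>\<^sup>+z\<in>ball x \<rho>. ennreal (D * norm (f z - f x)) \<partial>M)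
      \<le> ennreal (\<rho> powr s * vol M x \<rho>) * (ennreal D * ennreal (6 * cP s * hg x))"
      by (simp add: mult_ac)
  qed (use s x in auto)
  also have "\<dots> = ennreal (D * (cosc s * r powr s * hg x))"
    using D cw_pos c_nonneg(3)[of s] hg_nonneg[of x] by (simp add: cosc_def mult_ac flip: ennreal_mult)
  finally show ?thesis .
qed

text \<open>After subtracting \<open>f x\<close> the integrand is governed by the oscillation about
  \<open>x\<close>, which the weight sums over dyadic balls. The subtracted part is a constant times
  an integrable molecule, so it can be added back.\<close>

lemma pairing:
  fixes \<phi> :: "'a \<Rightarrow> 'k"
  assumes x: "x \<notin> N" and \<phi>: "molecule x r \<phi> D" "0 \<le> D" "0 < r"
  shows "integrable M (\<lambda>z. (f z - f x) * \<phi> z)"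
    and "norm (\<integral>z. (f z - f x) * \<phi> z \<partial>M) \<le> D * (cosc s * r powr s * hg x)"
    and "integrable M (\<lambda>z. f z * \<phi> z)"
    and "(\<integral>z. f z * \<phi> z \<partial>M) = (\<integral>z. (f z - f x) * \<phi> z \<partial>M) + f x * (\<integral>z. \<phi> z \<partial>M)"
proof -
  have [measurable]: "\<phi> \<in> borel_measurable M" by (rule molecule_measurable[OF \<phi>])
  have "(\<integral>\<^sup>+z. ennreal (norm ((f z - f x) * \<phi> z)) \<partial>M) \<le> (\<integral>\<^sup>+z. ennreal (D * norm (f z - f x)) * ennreal (wt x r z) \<partial>M)"
  proof (intro nn_integral_mono)
    fix z
    have "norm ((f z - f x) * \<phi> z) \<le> norm (f z - f x) * (D * wt x r z)"
      using \<phi>(1) unfolding norm_mult molecule_def by (intro mult_left_mono) auto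
    then show "ennreal (norm ((f z - f x) * \<phi> z)) \<le> ennreal (D * norm (f z - f x)) * ennreal (wt x r z)"
      using \<phi>(2) wt_nonneg[of x r z] by (simp add: mult_ac ennreal_leI flip: ennreal_mult)
  qed
  also have "\<dots> \<le> ennreal (D * (cosc s * r powr s * hg x))"
    by (intro oscillation_wt x \<phi>)
  finally have le: "(\<integral>\<^sup>+z. ennreal (norm ((f z - f x) * \<phi> z)) \<partial>M) \<le> ennreal (D * (cosc s * r powr s * hg x))" .
  show int: "integrable M (\<lambda>z. (f z - f x) * \<phi> z)"
    using le by (intro integrableI_bounded) (auto intro: le_less_trans)
  have "ennreal (norm (\<integral>z. (f z - f x) * \<phi> z \<partial>M)) \<le> ennreal (D * (cosc s * r powr s * hg x))"
    using integral_norm_bound_ennreal[OF int] le by (rule order_trans)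
  then show "norm (\<integral>z. (f z - f x) * \<phi> z \<partial>M) \<le> D * (cosc s * r powr s * hg x)"
    using \<phi>(2) hg_nonneg[of x] cosc_pos[of s] by (simp add: ennreal_le_iff)
  have int': "integrable M (\<lambda>z. f x * \<phi> z)" using molecule_integrable(1)[OF \<phi>] by simp
  have eq: "f z * \<phi> z = (f z - f x) * \<phi> z + f x * \<phi> z" for z by (simp add: algebra_simps)
  show "integrable M (\<lambda>z. f z * \<phi> z)"
    unfolding eq by (intro Bochner_Integration.integrable_add int int')
  show "(\<integral>z. f z * \<phi> z \<partial>M) = (\<integral>z. (f z - f x) * \<phi> z \<partial>M) + f x * (\<integral>z. \<phi> z \<partial>M)"
    unfolding eq by (subst Bochner_Integration.integral_add[OF int int']) simp
qed

lemma ex_regular_point: "\<exists>x. x \<notin> N"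
  using not_null_ball[OF N_null zero_less_one] by blast

lemma f_tests_integrable:
  assumes "\<phi> \<in> tests x1"
  shows "integrable M (\<lambda>z. f z * \<phi> z)"
proof -
  obtain x where x: "x \<notin> N" using ex_regular_point by blast
  obtain D where "0 \<le> D" "molecule x 1 \<phi> D" using tests_molecule[OF assms zero_less_one] by blast
  then show ?thesis using x by (intro pairing(3)) auto
qed

lemma linear_integral_functional: "linear_on_tests x1 (integral_functional M f)"
  unfolding linear_on_tests_def integral_functional_def
proof (intro ballI allI)
  fix \<phi> \<psi> :: "'a \<Rightarrow> 'k" and a b :: 'k
  assume "\<phi> \<in> tests x1" "\<psi> \<in> tests x1"
  then have "integrable M (\<lambda>z. a * (f z * \<phi> z))" "integrable M (\<lambda>z. b * (f z * \<psi> z))"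
    by (auto intro: f_tests_integrable)
  then have "(\<integral>z. a * (f z * \<phi> z) + b * (f z * \<psi> z) \<partial>M) = a * (\<integral>z. f z * \<phi> z \<partial>M) + b * (\<integral>z. f z * \<psi> z \<partial>M)"
    by simp
  then show "(\<integral>z. f z * (a * \<phi> z + b * \<psi> z) \<partial>M) = a * (\<integral>z. f z * \<phi> z \<partial>M) + b * (\<integral>z. f z * \<psi> z \<partial>M)"
    by (simp add: algebra_simps)
qed

lemma ctl_integral_functional: "ctl x1 s (integral_functional M f) (\<lambda>x. cosc s * hg x) N"
  unfolding ctl_def
proof (intro conjI allI impI)
  fix x r D and \<phi> :: "'a \<Rightarrow> 'k"
  assume x: "x \<notin> N" "0 < r" "0 \<le> D" "molecule x r \<phi> D" "(\<integral>z. \<phi> z \<partial>M) = 0"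
  then have "integral_functional M f \<phi> = (\<integral>z. (f z - f x) * \<phi> z \<partial>M)"
    unfolding integral_functional_def by (subst pairing(4)[of x r \<phi> D]) auto
  then show "norm (integral_functional M f \<phi>) \<le> D * r powr s * (cosc s * hg x)"
    using pairing(2)[of x r \<phi> D] x by (simp add: mult_ac)
qed (use N_null linear_integral_functional hg_nonneg cosc_pos[of s] in \<open>auto simp: less_imp_le\<close>)

lemma integral_functional_psi:
  assumes "x \<notin> N" "0 < r"
  shows "norm (integral_functional M f (psi x r) - f x) \<le> cpsi * cosc s * r powr s * hg x"
proof -
  have "integral_functional M f (psi x r) - f x = (\<integral>z. (f z - f x) * psi x r z \<partial>M)"
    unfolding integral_functional_def using pairing(4)[OF assms(1) psi_molecule[OF assms(2)]] cpsi_pos assms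
    by (simp add: psi_integral(2))
  then show ?thesis
    using pairing(2)[OF assms(1) psi_molecule[OF assms(2)]] cpsi_pos assms by (simp add: mult_ac)
qed

lemma integral_functional_dual: "integral_functional M f \<in> test_dual M x1 1 2"
proof -
  obtain x where x: "x \<notin> N" using ex_regular_point by blast
  \<comment> \<open>The base point \<open>x1\<close> may lie in \<open>N\<close>, so test functions
    are recentred at \<open>x\<close> before \<open>pairing\<close> applies.\<close>
  obtain C where C: "0 < C" "\<And>\<phi> :: 'a \<Rightarrow> 'k. \<And>D. molecule x1 1 \<phi> D \<Longrightarrow> 0 \<le> D \<Longrightarrow> molecule x 1 \<phi> (C * D)"
    using molecule_recentre[of 1 1 x1 x] by (metis zero_less_one)
  let ?k = "C * (3 * K * 2 powr n)"
  define B where "B = ?k * (cosc s * hg x) + norm (f x) * (cw * ?k) + 1"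
  have k: "0 \<le> ?k" using C K_ge_1 by simp
  have B: "0 < B" unfolding B_def using k cw_pos cosc_pos[of s] hg_nonneg[of x] by (intro add_nonneg_pos) auto
  have bd: "norm (integral_functional M f \<phi>) \<le> B * C0" if tb: "test_bound M x1 1 1 2 \<phi> C0" for \<phi> :: "'a \<Rightarrow> 'k" and C0
  proof -
    have C0: "0 \<le> C0" using tb by (simp add: test_bound_def)
    have "molecule x1 1 \<phi> (3 * K * 2 powr n * C0)" using tb by (rule test_bound_molecule) simp
    then have "molecule x 1 \<phi> (C * (3 * K * 2 powr n * C0))" using C0 K_ge_1 by (intro C) auto
    then have m: "molecule x 1 \<phi> (?k * C0)" by (simp add: mult_ac)
    have "norm (integral_functional M f \<phi>) \<le> norm (\<integral>z. (f z - f x) * \<phi> z \<partial>M) + norm (f x) * norm (\<integral>z. \<phi> z \<partial>M)"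
      unfolding integral_functional_def pairing(4)[OF x m mult_nonneg_nonneg[OF k C0] zero_less_one]
      by (rule order_trans[OF norm_triangle_ineq]) (simp add: norm_mult)
    also have "\<dots> \<le> ?k * C0 * (cosc s * 1 powr s * hg x) + norm (f x) * (cw * (?k * C0))"
      using pairing(2)[OF x m] molecule_integrable(2)[OF m] k C0 by (intro add_mono mult_left_mono) auto
    also have "\<dots> \<le> B * C0" using C0 by (simp add: B_def algebra_simps)
    finally show ?thesis .
  qed
  have "ennreal (norm (integral_functional M f \<phi>)) \<le> ennreal B * test_norm M x1 1 1 2 \<phi>" for \<phi> :: "'a \<Rightarrow> 'k"
  proof -
    have "ennreal (norm (integral_functional M f \<phi>) / B) \<le> test_norm M x1 1 1 2 \<phi>"
      unfolding test_norm_def using bd B by (intro INF_greatest ennreal_leI) (auto simp: field_simps)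
    then have "ennreal B * ennreal (norm (integral_functional M f \<phi>) / B) \<le> ennreal B * test_norm M x1 1 1 2 \<phi>"
      by (rule mult_left_mono) simp
    then show ?thesis using B by (simp flip: ennreal_mult)
  qed
  then show ?thesis
    using linear_integral_functional[of x1] unfolding test_dual_def linear_on_tests_def by blast
qed

lemma f_locally_integrable: "locally_integrable M f"
  unfolding locally_integrable_def
proof (intro allI impI)
  fix y and r :: real assume r: "0 < r"
  obtain x where x: "x \<notin> N" using ex_regular_point by blast
  let ?\<rho> = "r + dist x y"
  have \<rho>: "0 < ?\<rho>" using r by (simp add: add_pos_nonneg)
  have "(\<integral>\<^sup>+z. ennreal (norm (indicator (ball x ?\<rho>) z *\<^sub>R (f z - f x))) \<partial>M) = (\<integral>\<^sup>+z\<in>ball x ?\<rho>. ennreal (norm (f z - f x)) \<partial>M)"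
    by (intro nn_integral_cong) (auto simp: indicator_def)
  also have "\<dots> < \<infinity>"
    using oscillation[OF x \<rho>] by (rule le_less_trans) (auto simp: ennreal_mult_less_top)
  finally have "integrable M (\<lambda>z. indicator (ball x ?\<rho>) z *\<^sub>R (f z - f x))"
    by (intro integrableI_bounded) auto
  moreover have "integrable M (\<lambda>z. indicator (ball x ?\<rho>) z *\<^sub>R f x)"
    using ball_finite[of x ?\<rho>] by simp
  ultimately have "integrable M (\<lambda>z. indicator (ball x ?\<rho>) z *\<^sub>R (f z - f x) + indicator (ball x ?\<rho>) z *\<^sub>R f x)"
    by (rule Bochner_Integration.integrable_add)
  then have "set_integrable M (ball x ?\<rho>) f"
    by (simp add: set_integrable_def algebra_simps)
  moreover have "ball y r \<subseteq> ball x ?\<rho>"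
  proof
    fix z assume "z \<in> ball y r"
    then show "z \<in> ball x ?\<rho>" using dist_triangle[of x z y] by simp
  qed
  ultimately show "set_integrable M (ball y r) f" using ball_in_M by (metis set_integrable_subset)
qed

end

context doubling_space
begin

text \<open>This places the limit function, known only through its gradient, into
  \<open>hajlasz_space\<close>: on a ball all values are compared with the value at one point
  outside \<open>E\<close>.\<close>

lemma Lp_loc_of_gradient:
  fixes f :: "'a \<Rightarrow> 'k::{banach,second_countable_topology}"
  assumes [measurable]: "f \<in> borel_measurable M" "g \<in> borel_measurable M" and g: "\<And>x. 0 \<le> g x"
    and gp: "(\<integral>\<^sup>+x. ennreal (g x powr p) \<partial>M) < top" and E: "E \<in> null_sets M"
    and gr: "\<And>x y. x \<notin> E \<Longrightarrow> y \<notin> E \<Longrightarrow> norm (f x - f y) \<le> dist x y powr s * (g x + g y)"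
    and p: "0 < p" and s: "0 < s"
  shows "f \<in> Lp_loc M p"
  unfolding Lp_loc_def
proof (safe intro!: assms)
  fix y and r :: real assume r: "0 < r"
  obtain x where x: "x \<in> ball y r" "x \<notin> E" using not_null_ball[OF E r, of y] by blast
  let ?\<rho> = "(2 * r) powr s"
  let ?c = "norm (f x) + ?\<rho> * g x"
  have "(\<integral>\<^sup>+z\<in>ball y r. ennreal (norm (f z) powr p) \<partial>M)
    \<le> (\<integral>\<^sup>+z. ennreal (2 powr p * ?c powr p) * indicator (ball y r) z + ennreal (2 powr p * ?\<rho> powr p) * ennreal (g z powr p) \<partial>M)"
  proof (intro nn_integral_mono_AE)
    have "AE z in M. z \<notin> E" using E by (rule AE_not_in)
    then show "AE z in M. ennreal (norm (f z) powr p) * indicator (ball y r) z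
      \<le> ennreal (2 powr p * ?c powr p) * indicator (ball y r) z + ennreal (2 powr p * ?\<rho> powr p) * ennreal (g z powr p)"
    proof eventually_elim
      case (elim z)
      show ?case
      proof (cases "z \<in> ball y r")
        case True
        have "dist z x \<le> 2 * r" using True x(1) dist_triangle[of z x y] by (simp add: dist_commute)
        then have d: "dist z x powr s \<le> ?\<rho>" using s by (intro powr_mono2) auto
        have "norm (f z) \<le> norm (f x) + norm (f z - f x)" using norm_triangle_ineq[of "f x" "f z - f x"] by simp
        also have "\<dots> \<le> norm (f x) + dist z x powr s * (g z + g x)" using gr[OF elim x(2)] by simp
        also have "\<dots> \<le> norm (f x) + ?\<rho> * (g z + g x)" using d g by (intro add_left_mono mult_right_mono) auto
        also have "\<dots> = ?c + ?\<rho> * g z" by (simp add: algebra_simps)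
        finally have "norm (f z) powr p \<le> (?c + ?\<rho> * g z) powr p" using p by (intro powr_mono2) auto
        also have "\<dots> \<le> 2 powr p * (?c powr p + (?\<rho> * g z) powr p)" using g p by (intro powr_add_le) auto
        also have "\<dots> = 2 powr p * ?c powr p + 2 powr p * ?\<rho> powr p * g z powr p"
          using g by (simp add: powr_mult distrib_left)
        finally show ?thesis using True by (simp add: ennreal_leI flip: ennreal_mult ennreal_plus)
      qed simp
    qed
  qed
  also have "\<dots> = ennreal (2 powr p * ?c powr p) * emeasure M (ball y r) + ennreal (2 powr p * ?\<rho> powr p) * (\<integral>\<^sup>+z. ennreal (g z powr p) \<partial>M)"
    by (simp add: nn_integral_add nn_integral_cmult nn_integral_cmult_indicator)
  also have "\<dots> < \<infinity>" using gp ball_finite[of y r] by (auto simp: ennreal_mult_less_top)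
  finally show "(\<integral>\<^sup>+z\<in>ball y r. ennreal (norm (f z) powr p) \<partial>M) < \<infinity>" .
qed

section \<open>The grand maximal function\<close>

definition c6 :: real where "c6 = 6 * K * 2 powr n"

definition c18 :: real where "c18 = 18 * K * 2 powr n"

lemma c6_pos: "0 < c6" and c18_pos: "0 < c18"
  using K_ge_1 by (simp_all add: c6_def c18_def)

lemma powi_powr: "(2::real) powi (- k) = 2 powr (- real_of_int k)"
  using powr_real_of_int'[of 2 "- k"] by simp

lemma grand_class_molecule:
  assumes "\<phi> \<in> grand_class M x1 k x"
  shows "molecule x (2 powr (- real_of_int k)) \<phi> c6" "(\<integral>z. \<phi> z \<partial>M) = 0" "\<phi> \<in> tests x1"
proof -
  show "(\<integral>z. \<phi> z \<partial>M) = 0" "\<phi> \<in> tests x1" using assms by (auto simp: grand_class_def test_space0_def)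
  have "test_norm M x (2 powr (- real_of_int k)) 1 2 \<phi> \<le> 1"
    using assms by (simp add: grand_class_def powi_powr)
  \<comment> \<open>The norm is an infimum that need not be attained, hence some bound
    \<open>C < 2\<close>; this is the factor by which \<open>c6\<close> exceeds the constant of
    \<open>test_bound_molecule\<close>.\<close>
  also have "1 < ennreal 2" using ennreal_less_iff[of 1 2] by simp
  finally have "test_norm M x (2 powr (- real_of_int k)) 1 2 \<phi> < ennreal 2" .
  then obtain C where C: "test_bound M x (2 powr (- real_of_int k)) 1 2 \<phi> C" "ennreal C < ennreal 2"
    unfolding test_norm_def by (auto simp: INF_less_iff)
  have C2: "0 \<le> C" "C < 2" using C by (auto simp: test_bound_def ennreal_less_iff)
  have "molecule x (2 powr (- real_of_int k)) \<phi> (3 * K * 2 powr n * C)" using C(1) by (rule test_bound_molecule) simp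
  moreover have "3 * K * 2 powr n * C \<le> 3 * K * 2 powr n * 2" using C2 K_ge_1 by (intro mult_left_mono) auto
  ultimately show "molecule x (2 powr (- real_of_int k)) \<phi> c6" by (rule_tac molecule_mono) (auto simp: c6_def)
qed

definition grand_max :: "'a \<Rightarrow> (('a \<Rightarrow> 'k::{real_normed_field,banach,second_countable_topology}) \<Rightarrow> 'k) \<Rightarrow> int \<Rightarrow> 'a \<Rightarrow> ennreal" where
  "grand_max x1 F k x = (SUP \<phi>\<in>grand_class M x1 k x. ennreal (norm (F \<phi>)))"

text \<open>Division by \<open>c18 * D\<close> puts the molecule into the unit class, since
  \<open>c18\<close> is the constant of \<open>molecule_test_bound\<close>.\<close>

lemma grand_max_ge:
  assumes F: "linear_on_tests x1 F" and D: "0 < D" and \<phi>: "molecule x (2 powr (- real_of_int k)) \<phi> D" "(\<integral>z. \<phi> z \<partial>M) = 0"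
  shows "ennreal (norm (F \<phi>)) \<le> ennreal (c18 * D) * grand_max x1 F k x"
proof -
  let ?r = "2 powr (- real_of_int k)" and ?c = "c18 * D"
  have c: "0 < ?c" using c18_pos D by simp
  have T: "\<phi> \<in> tests x1" using \<phi>(1) D by (intro molecule_in_tests[OF \<phi>(1)]) auto
  define \<psi> where "\<psi> = (\<lambda>z. of_real (1 / ?c) * \<phi> z)"
  have "molecule x ?r \<psi> (norm (of_real (1 / ?c) :: 'b) * D)" unfolding \<psi>_def by (rule molecule_cmult[OF \<phi>(1)])
  moreover have "norm (of_real (1 / ?c) :: 'b) * D = 1 / c18"
    using c D by (simp only: norm_of_real) simp
  ultimately have "molecule x ?r \<psi> (1 / c18)" by simp
  then have "test_bound M x ?r 1 2 \<psi> (18 * K * 2 powr n * (1 / c18))" using c18_pos by (intro molecule_test_bound) auto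
  then have "test_bound M x ?r 1 2 \<psi> 1" using K_ge_1 by (simp add: c18_def)
  then have "test_norm M x ?r 1 2 \<psi> \<le> ennreal 1" unfolding test_norm_def by (intro INF_lower) auto
  moreover have "\<psi> \<in> tests x1" using tests_lincomb[OF T T, of "of_real (1 / ?c)" 0] by (simp add: \<psi>_def)
  moreover have "(\<integral>z. \<psi> z \<partial>M) = 0" using \<phi>(2) by (simp add: \<psi>_def)
  ultimately have "\<psi> \<in> grand_class M x1 k x" by (simp add: grand_class_def test_space0_def powi_powr)
  then have "ennreal (norm (F \<psi>)) \<le> grand_max x1 F k x" unfolding grand_max_def by (intro SUP_upper)
  moreover have "F \<psi> = of_real (1 / ?c) * F \<phi>" unfolding \<psi>_def by (rule linear_on_testsD(3)[OF F T T])
  ultimately have "ennreal (norm (F \<phi>) / ?c) \<le> grand_max x1 F k x"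
    using c c18_pos D by (simp add: norm_mult norm_divide)
  then have "ennreal ?c * ennreal (norm (F \<phi>) / ?c) \<le> ennreal ?c * grand_max x1 F k x" by (rule mult_left_mono) simp
  also have "ennreal ?c * ennreal (norm (F \<phi>) / ?c) = ennreal (norm (F \<phi>))"
    using c18_pos D by (simp flip: ennreal_mult)
  finally show ?thesis .
qed

lemma grand_TL_norm_le:
  assumes F: "ctl x1 s F g N" and p: "0 < p"
  shows "grand_TL_norm M x1 s p F \<le> ennreal c6 * Lp_norm M p (\<lambda>x. ennreal (g x))"
proof -
  note c = ctlD[OF F]
  let ?u = "\<lambda>x. SUP k::int. ennreal (2 powr (of_int k * s)) * (SUP \<phi>\<in>grand_class M x1 k x. ennreal (norm (F \<phi>)))"
  have u: "?u x \<le> ennreal (c6 * g x)" if x: "x \<notin> N" for x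
  proof (rule SUP_least)
    fix k :: int
    have "(SUP \<phi>\<in>grand_class M x1 k x. ennreal (norm (F \<phi>))) \<le> ennreal (c6 * (2 powr (- real_of_int k)) powr s * g x)"
      using x grand_class_molecule c6_pos by (intro SUP_least ennreal_leI c(5)) (auto simp: less_imp_le)
    then have "ennreal (2 powr (of_int k * s)) * (SUP \<phi>\<in>grand_class M x1 k x. ennreal (norm (F \<phi>)))
       \<le> ennreal (2 powr (of_int k * s)) * ennreal (c6 * (2 powr (- real_of_int k)) powr s * g x)"
      by (rule mult_left_mono) simp
    also have "\<dots> = ennreal (c6 * g x * (2 powr (of_int k * s) * (2 powr (- real_of_int k)) powr s))"
      using c6_pos c(2) by (simp add: mult_ac flip: ennreal_mult)
    also have "2 powr (of_int k * s) * (2 powr (- real_of_int k)) powr s = 1"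
      by (simp add: powr_powr flip: powr_add)
    finally show "ennreal (2 powr (of_int k * s)) * (SUP \<phi>\<in>grand_class M x1 k x. ennreal (norm (F \<phi>))) \<le> ennreal (c6 * g x)"
      by simp
  qed
  have [measurable]: "g \<in> borel_measurable M" by (rule c)
  have "Lp_norm M p ?u \<le> ennreal ((c6 powr p) powr (1 / p)) * Lp_norm M p (\<lambda>x. ennreal (g x))"
  proof (rule Lp_norm_le[OF _ p])
    show "0 < c6 powr p" using c6_pos by simp
    have "AE x in M. x \<notin> N" using c(3) by (rule AE_not_in)
    then have "(\<integral>\<^sup>+x. epowr (?u x) p \<partial>M) \<le> (\<integral>\<^sup>+x. ennreal (c6 powr p) * epowr (ennreal (g x)) p \<partial>M)"
    proof (intro nn_integral_mono_AE, eventually_elim)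
      case (elim x)
      have "epowr (?u x) p \<le> epowr (ennreal (c6 * g x)) p" using u[OF elim(2)] p by (intro epowr_mono) auto
      also have "ennreal (c6 * g x) = ennreal c6 * ennreal (g x)" using c6_pos c(2) by (simp add: ennreal_mult)
      finally show ?case unfolding epowr_cmult[OF c6_pos] .
    qed
    also have "\<dots> = ennreal (c6 powr p) * (\<integral>\<^sup>+x. epowr (ennreal (g x)) p \<partial>M)" by (rule nn_integral_cmult) measurable
    finally show "(\<integral>\<^sup>+x. epowr (?u x) p \<partial>M) \<le> ennreal (c6 powr p) * (\<integral>\<^sup>+x. epowr (ennreal (g x)) p \<partial>M)" .
  qed
  then show ?thesis using c6_pos p by (simp add: grand_TL_norm_def powr_powr)
qed

definition cgr :: real where "cgr = c18 * (chg 1 * c6)"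

definition cct :: real where "cct = c18 * chg 2"

lemma cgr_pos: "0 < cgr" and cct_pos: "0 < cct"
  using c18_pos c6_pos chg_pos by (simp_all add: cgr_def cct_def)

text \<open>A molecule stays one when its centre moves within its scale, so a supremum over nearby
  centres costs only the factor \<open>cgr\<close>. Passing from dyadic scales to all
  \<open>r\<close>, and from the unit class to arbitrary \<open>D\<close>, costs
  \<open>cct\<close>.\<close>

lemma grand_TL_ctl:
  fixes F :: "('a \<Rightarrow> 'k::{real_normed_field,banach,second_countable_topology}) \<Rightarrow> 'k"
  assumes F: "F \<in> grand_TL_space M x1 s p" and p: "0 < p" and s: "0 < s"
  obtains g N where "ctl x1 s F g N" "(\<integral>\<^sup>+x. ennreal (g x powr p) \<partial>M) < top"
    "Lp_norm M p (\<lambda>x. ennreal (g x)) \<le> ennreal (cct * cgr) * grand_TL_norm M x1 s p F"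
proof -
  have lin: "linear_on_tests x1 F" using F by (simp add: grand_TL_space_def test_dual_def linear_on_tests_def)
  define a where "a k = ennreal (2 powr (of_int k * s))" for k :: int
  define u where "u x = (SUP k. a k * grand_max x1 F k x)" for x
  \<comment> \<open>\<open>u\<close> need not be measurable; \<open>v\<close> is a comparable lower semicontinuous majorant\<close>
  define v where "v x = (SUP k. SUP y\<in>ball x (2 powr (- real_of_int k)). a k * grand_max x1 F k y)" for x
  have norm_u: "grand_TL_norm M x1 s p F = Lp_norm M p u"
    by (simp add: grand_TL_norm_def u_def[abs_def] a_def grand_max_def)
  have vu: "v x \<le> ennreal cgr * u x" for x
    unfolding v_def
  proof (intro SUP_least)
    fix k :: int and y assume y: "y \<in> ball x (2 powr (- real_of_int k))"
    have "grand_max x1 F k y \<le> ennreal cgr * grand_max x1 F k x"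
      unfolding grand_max_def[of x1 F k y]
    proof (rule SUP_least)
      fix \<phi> :: "'a \<Rightarrow> 'k" assume \<phi>: "\<phi> \<in> grand_class M x1 k y"
      have "molecule x (2 powr (- real_of_int k)) \<phi> (chg 1 * c6)"
        using c6_pos y by (intro molecule_change[OF grand_class_molecule(1)[OF \<phi>]]) (auto simp: dist_commute)
      then show "ennreal (norm (F \<phi>)) \<le> ennreal cgr * grand_max x1 F k x"
        unfolding cgr_def using grand_class_molecule(2)[OF \<phi>] chg_pos[of 1] c6_pos by (intro grand_max_ge lin) auto
    qed
    then have "a k * grand_max x1 F k y \<le> ennreal cgr * (a k * grand_max x1 F k x)"
      by (metis mult.left_commute mult_left_mono zero_le)
    also have "\<dots> \<le> ennreal cgr * u x" unfolding u_def by (intro mult_left_mono SUP_upper) auto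
    finally show "a k * grand_max x1 F k y \<le> ennreal cgr * u x" .
  qed
  have v_ge: "a k * grand_max x1 F k x \<le> v x" for k x
    unfolding v_def by (rule SUP_upper2[of k], simp, rule SUP_upper) simp
  have v_meas [measurable]: "v \<in> borel_measurable M"
  proof (rule borel_measurableI_greater)
    fix c
    have "{x \<in> space M. c < v x} = (\<Union>k::int. \<Union>y\<in>{y. c < a k * grand_max x1 F k y}. ball y (2 powr (- real_of_int k)))"
    proof (intro equalityI subsetI)
      fix x assume "x \<in> {x \<in> space M. c < v x}"
      then obtain k y where "y \<in> ball x (2 powr (- real_of_int k))" "c < a k * grand_max x1 F k y"
        by (auto simp only: v_def less_SUP_iff mem_Collect_eq)
      then show "x \<in> (\<Union>k::int. \<Union>y\<in>{y. c < a k * grand_max x1 F k y}. ball y (2 powr (- real_of_int k)))"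
        by (intro UN_I[of k] UN_I[of y]) (auto simp: dist_commute)
    next
      fix x assume "x \<in> (\<Union>k::int. \<Union>y\<in>{y. c < a k * grand_max x1 F k y}. ball y (2 powr (- real_of_int k)))"
      then obtain k y where "y \<in> ball x (2 powr (- real_of_int k))" "c < a k * grand_max x1 F k y"
        by (auto simp: dist_commute)
      then show "x \<in> {x \<in> space M. c < v x}" unfolding v_def less_SUP_iff mem_Collect_eq by (intro conjI bexI exI) simp_all
    qed
    also have "\<dots> \<in> sets M" by (intro open_in_M open_UN ballI open_ball)
    finally show "{x \<in> space M. c < v x} \<in> sets M" .
  qed
  have Lv: "Lp_norm M p v \<le> ennreal cgr * Lp_norm M p u"
  proof -
    have "Lp_norm M p v \<le> ennreal ((cgr powr p) powr (1 / p)) * Lp_norm M p u"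
    proof (rule Lp_norm_le[OF _ p])
      show "0 < cgr powr p" using cgr_pos by simp
      \<comment> \<open>The integral of the power of \<open>u\<close> is only a lower integral, so
        the constant is pulled out of an integral of the measurable \<open>v\<close> before
        \<open>u\<close> enters.\<close>
      have "(\<integral>\<^sup>+x. epowr (v x) p \<partial>M) = (\<integral>\<^sup>+x. ennreal (cgr powr p) * epowr (ennreal (1 / cgr) * v x) p \<partial>M)"
        using cgr_pos by (intro nn_integral_cong) (simp add: epowr_cmult powr_divide mult.assoc[symmetric] flip: ennreal_mult)
      also have "\<dots> = ennreal (cgr powr p) * (\<integral>\<^sup>+x. epowr (ennreal (1 / cgr) * v x) p \<partial>M)"
        by (rule nn_integral_cmult) measurable
      also have "\<dots> \<le> ennreal (cgr powr p) * (\<integral>\<^sup>+x. epowr (u x) p \<partial>M)"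
      proof (intro mult_left_mono nn_integral_mono epowr_mono)
        fix x
        have "ennreal (1 / cgr) * v x \<le> ennreal (1 / cgr) * (ennreal cgr * u x)" using vu by (rule mult_left_mono) simp
        also have "\<dots> = u x" using cgr_pos by (simp add: mult.assoc[symmetric] flip: ennreal_mult)
        finally show "ennreal (1 / cgr) * v x \<le> u x" .
      qed (use p in auto)
      finally show "(\<integral>\<^sup>+x. epowr (v x) p \<partial>M) \<le> ennreal (cgr powr p) * (\<integral>\<^sup>+x. epowr (u x) p \<partial>M)" .
    qed
    then show ?thesis using cgr_pos p by (simp add: powr_powr)
  qed
  have fin: "(\<integral>\<^sup>+x. epowr (v x) p \<partial>M) < top"
  proof -
    have "Lp_norm M p v < top"
      using Lv F by (auto simp: grand_TL_space_def norm_u ennreal_mult_less_top intro: le_less_trans)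
    then show ?thesis unfolding Lp_norm_def by (cases "(\<integral>\<^sup>+x. epowr (v x) p \<partial>M)") auto
  qed
  define N where "N = {x. v x = top}"
  have N: "N \<in> null_sets M"
  proof -
    have "AE x in M. epowr (v x) p \<noteq> \<infinity>" using fin by (intro nn_integral_noteq_infinite) auto
    then have "AE x in M. \<not> v x = top" by (auto elim!: eventually_mono)
    moreover have "{x \<in> space M. v x = top} \<in> sets M" by measurable
    ultimately show ?thesis unfolding N_def by (subst (asm) AE_iff_null) auto
  qed
  define g where "g x = cct * enn2real (v x)" for x
  have g_le: "ennreal (g x) \<le> ennreal cct * v x" for x
    using cct_pos by (cases "v x") (auto simp: g_def ennreal_mult_top simp flip: ennreal_mult)
  have Lg: "(\<integral>\<^sup>+x. epowr (ennreal (g x)) p \<partial>M) \<le> ennreal (cct powr p) * (\<integral>\<^sup>+x. epowr (v x) p \<partial>M)"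
  proof -
    have "(\<integral>\<^sup>+x. epowr (ennreal (g x)) p \<partial>M) \<le> (\<integral>\<^sup>+x. ennreal (cct powr p) * epowr (v x) p \<partial>M)"
      unfolding epowr_cmult[OF cct_pos, symmetric] using p by (intro nn_integral_mono epowr_mono g_le) auto
    then show ?thesis by (subst (asm) nn_integral_cmult) auto
  qed
  have g0: "0 \<le> g x" for x using cct_pos by (simp add: g_def)
  show thesis
  proof (rule that)
    show "ctl x1 s F g N"
      unfolding ctl_def
    proof (intro conjI allI impI)
      fix x r D and \<phi> :: "'a \<Rightarrow> 'k"
      assume h: "x \<notin> N" "0 < r" "0 \<le> D" "molecule x r \<phi> D" "(\<integral>z. \<phi> z \<partial>M) = 0"
      show "norm (F \<phi>) \<le> D * r powr s * g x"
      proof (cases "D = 0")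
        case True
        then have "\<phi> = (\<lambda>z. 0)" using h(4) by (auto simp: molecule_def)
        then show ?thesis using True linear_on_testsD(4)[OF lin psi_in_tests psi_in_tests, of 1 1] by simp
      next
        case False
        \<comment> \<open>Rounded so that the dyadic scale lies between \<open>r / 2\<close> and
          \<open>r\<close>; being at most \<open>r\<close>, its power \<open>s\<close> is at most
          \<open>r powr s\<close>.\<close>
        define k where "k = - \<lfloor>log 2 r\<rfloor>"
        let ?\<rho> = "2 powr (- real_of_int k)"
        have "?\<rho> \<le> 2 powr log 2 r" "2 powr log 2 r \<le> 2 powr (- real_of_int k + 1)"
          unfolding k_def by (intro powr_mono; simp; linarith)+
        then have \<rho>: "?\<rho> \<le> r" "r \<le> 2 * ?\<rho>" using h(2) by (auto simp: powr_add powr_diff powr_minus_divide)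
        have "molecule x ?\<rho> \<phi> (chg 2 * D)" using h \<rho> by (intro molecule_change[OF h(4)]) auto
        then have "ennreal (norm (F \<phi>)) \<le> ennreal (c18 * (chg 2 * D)) * grand_max x1 F k x"
          using h(3,5) False chg_pos[of 2] by (intro grand_max_ge lin) auto
        also have "grand_max x1 F k x = ennreal (2 powr (- (of_int k * s))) * (a k * grand_max x1 F k x)"
          by (simp add: a_def mult.assoc[symmetric] flip: ennreal_mult powr_add)
        also have "ennreal (c18 * (chg 2 * D)) * \<dots> \<le> ennreal (c18 * (chg 2 * D)) * (ennreal (2 powr (- (of_int k * s))) * v x)"
          by (intro mult_left_mono v_ge) auto
        also have "v x = ennreal (enn2real (v x))" using h(1) by (simp add: N_def less_top)
        also have "ennreal (c18 * (chg 2 * D)) * (ennreal (2 powr (- (of_int k * s))) * ennreal (enn2real (v x)))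
            = ennreal (D * 2 powr (- (of_int k * s)) * g x)"
          using h(3) c18_pos chg_pos[of 2] by (simp add: g_def cct_def mult_ac flip: ennreal_mult)
        finally have "norm (F \<phi>) \<le> D * 2 powr (- (of_int k * s)) * g x"
          using h(3) g0 by (simp add: ennreal_le_iff)
        also have "2 powr (- (of_int k * s)) = ?\<rho> powr s" by (simp add: powr_powr)
        also have "D * ?\<rho> powr s * g x \<le> D * r powr s * g x"
          using \<rho>(1) s h(3) g0 by (intro mult_right_mono mult_left_mono powr_mono2) auto
        finally show ?thesis .
      qed
    qed (use N lin g0 in \<open>auto simp: g_def[abs_def]\<close>)
    have "(\<integral>\<^sup>+x. epowr (ennreal (g x)) p \<partial>M) < top"
      using Lg fin by (auto simp: ennreal_mult_less_top intro: le_less_trans)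
    then show "(\<integral>\<^sup>+x. ennreal (g x powr p) \<partial>M) < top" using g0 by (simp add: epowr_ennreal)
    have "Lp_norm M p (\<lambda>x. ennreal (g x)) \<le> ennreal ((cct powr p) powr (1 / p)) * Lp_norm M p v"
      using cct_pos p Lg by (intro Lp_norm_le) auto
    also have "(cct powr p) powr (1 / p) = cct" using cct_pos p by (simp add: powr_powr)
    also have "ennreal cct * Lp_norm M p v \<le> ennreal cct * (ennreal cgr * Lp_norm M p u)"
      using Lv by (rule mult_left_mono) simp
    finally show "Lp_norm M p (\<lambda>x. ennreal (g x)) \<le> ennreal (cct * cgr) * grand_TL_norm M x1 s p F"
      using cct_pos cgr_pos by (simp add: norm_u ennreal_mult mult.assoc)
  qed
qed

section \<open>Pointwise limits of bump values\<close>

definition cdif :: real where "cdif = (1 + chg 2) * cpsi"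

definition clim :: "real \<Rightarrow> real" where "clim s = cdif / (1 - 2 powr (- s))"

lemma cdif_pos: "0 < cdif"
  using chg_pos[of 2] cpsi_pos by (simp add: cdif_def)

lemma cdif_le_clim: "0 < s \<Longrightarrow> cdif \<le> clim s" "0 < s \<Longrightarrow> 0 < clim s"
proof -
  assume "0 < s"
  then have "2 powr (- s) < 1" using powr_less_mono[of "- s" 0 2] by simp
  then show "cdif \<le> clim s" using cdif_pos by (simp add: clim_def field_simps)
  then show "0 < clim s" using cdif_pos by simp
qed

context
  fixes x1 :: 'a and s :: real and g :: "'a \<Rightarrow> real" and N :: "'a set"
    and F :: "('a \<Rightarrow> 'k::{real_normed_field,banach,second_countable_topology}) \<Rightarrow> 'k"
  assumes F: "ctl x1 s F g N" and s: "0 < s"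
begin

text \<open>Both bumps have integral 1, so their difference is a molecule of mean zero at
  \<open>x\<close> and is charged to \<open>g x\<close> alone.\<close>

lemma psi_difference:
  assumes x: "x \<notin> N" and r: "0 < r" "0 < \<rho>" "\<rho> \<le> r" "r \<le> 2 * \<rho>" "dist y x \<le> r"
  shows "norm (F (psi x r) - F (psi y \<rho>)) \<le> cdif * r powr s * g x"
proof -
  have "molecule x r (psi y \<rho> :: 'a \<Rightarrow> 'k) (chg 2 * cpsi)"
    using r cpsi_pos by (intro molecule_change[OF psi_molecule]) auto
  then have "molecule x r (\<lambda>z. (-1) * psi y \<rho> z :: 'k) (norm (-1 :: 'k) * (chg 2 * cpsi))"
    by (rule molecule_cmult)
  then have "molecule x r (\<lambda>z. psi x r z + (-1) * psi y \<rho> z :: 'k) (cpsi + norm (-1 :: 'k) * (chg 2 * cpsi))"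
    by (intro molecule_add psi_molecule r)
  then have m: "molecule x r (\<lambda>z. psi x r z - psi y \<rho> z :: 'k) cdif"
    by (simp add: cdif_def distrib_right)
  have "(\<integral>z. psi x r z - psi y \<rho> z \<partial>M) = (0 :: 'k)"
    using psi_integral[OF r(1), of x, where 'k='k] psi_integral[OF r(2), of y, where 'k='k] by simp
  then have "norm (F (\<lambda>z. psi x r z - psi y \<rho> z)) \<le> cdif * r powr s * g x"
    using ctlD(5)[OF F x r(1) _ m] cdif_pos by simp
  then show ?thesis
    by (simp add: linear_on_testsD(2)[OF ctlD(4)[OF F] psi_in_tests psi_in_tests] r)
qed

text \<open>Halve \<open>r\<close> until it is within a factor 2 of \<open>\<rho>\<close>. The
  differences form a geometric series of ratio \<open>2 powr (- s)\<close> with sum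
  \<open>clim s\<close>, and \<open>cdif + clim s * 2 powr (- s) = clim s\<close> closes the
  induction on the number of halvings.\<close>

lemma psi_difference_scales:
  assumes x: "x \<notin> N" and r: "0 < \<rho>" "\<rho> \<le> r"
  shows "norm (F (psi x r) - F (psi x \<rho>)) \<le> clim s * r powr s * g x"
proof -
  have g: "0 \<le> g x" by (rule ctlD(2)[OF F])
  have "r / 2 ^ m \<le> \<rho> \<Longrightarrow> \<rho> \<le> r \<Longrightarrow> norm (F (psi x r) - F (psi x \<rho>)) \<le> clim s * r powr s * g x" for m
  proof (induction m arbitrary: r)
    case 0
    then have "\<rho> = r" by simp
    then show ?case using cdif_le_clim(2)[OF s] g by simp
  next
    case (Suc m)
    show ?case
    proof (cases "r \<le> 2 * \<rho>")
      case True
      have "norm (F (psi x r) - F (psi x \<rho>)) \<le> cdif * r powr s * g x"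
        using r(1) Suc.prems True by (intro psi_difference x) auto
      also have "\<dots> \<le> clim s * r powr s * g x" using cdif_le_clim[OF s] g by (intro mult_right_mono) auto
      finally show ?thesis .
    next
      case False
      have rp: "0 < r" using r(1) Suc.prems by simp
      have 1: "norm (F (psi x r) - F (psi x (r/2))) \<le> cdif * r powr s * g x"
        using rp by (intro psi_difference x) auto
      have 2: "norm (F (psi x (r/2)) - F (psi x \<rho>)) \<le> clim s * (r/2) powr s * g x"
        using Suc False by (intro Suc.IH) (auto simp: mult_ac)
      have "norm (F (psi x r) - F (psi x \<rho>)) = norm ((F (psi x r) - F (psi x (r/2))) + (F (psi x (r/2)) - F (psi x \<rho>)))" by simp
      also have "\<dots> \<le> cdif * r powr s * g x + clim s * (r/2) powr s * g x" by (intro norm_triangle_mono 1 2)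
      also have "(r/2) powr s = 2 powr (- s) * r powr s" using rp by (simp add: powr_divide powr_minus_divide)
      also have "cdif * r powr s * g x + clim s * (2 powr (- s) * r powr s) * g x = (cdif + clim s * 2 powr (- s)) * r powr s * g x"
        by (simp add: algebra_simps)
      also have "cdif + clim s * 2 powr (- s) = clim s"
        using powr_less_mono[of "- s" 0 2] s by (simp add: clim_def field_simps)
      finally show ?thesis .
    qed
  qed
  moreover obtain m :: nat where "r / \<rho> < 2 ^ m" using real_arch_pow[of 2 "r / \<rho>"] by auto
  then have "r / 2 ^ m \<le> \<rho>" using r by (simp add: field_simps)
  ultimately show ?thesis using r by blast
qed

text \<open>Nothing is known about convergence on \<open>N\<close>; the fixed value 0 there makes
  preimages explicit in \<open>lims_measurable\<close>.\<close>

definition lims :: "'a \<Rightarrow> 'k" where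
  "lims x = (if x \<in> N then 0 else lim (\<lambda>m. F (psi x ((1/2) ^ m))))"

lemma lims_approx:
  assumes x: "x \<notin> N" and r: "0 < r"
  shows "norm (F (psi x r) - lims x) \<le> clim s * r powr s * g x"
proof -
  have g: "0 \<le> g x" by (rule ctlD(2)[OF F])
  define a where "a m = F (psi x ((1/2) ^ m))" for m :: nat
  define C where "C = clim s * g x"
  have C: "0 \<le> C" using g cdif_le_clim(2)[OF s] by (simp add: C_def)
  have small: "\<exists>m0. \<forall>m\<ge>m0. C * ((1/2) ^ m) powr s < e" if e: "0 < e" for e
  proof -
    have q: "0 < (1/2::real) powr s" "(1/2::real) powr s < 1" using s powr_less_mono2[of s "1/2" 1] by auto
    have "(\<lambda>m. C * ((1/2) powr s) ^ m) \<longlonglongrightarrow> C * 0" using q by (intro tendsto_mult tendsto_const LIMSEQ_power_zero) auto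
    then have "eventually (\<lambda>m. C * ((1/2) powr s) ^ m < e) sequentially" using e by (intro order_tendstoD) auto
    moreover have "((1/2) ^ m) powr s = ((1/2::real) powr s) ^ m" for m
      by (simp add: powr_powr mult.commute flip: powr_realpow)
    ultimately show ?thesis by (simp add: eventually_sequentially)
  qed
  have "Cauchy a"
  proof (rule CauchyI')
    fix e :: real assume "0 < e"
    then obtain m0 where m0: "\<forall>m\<ge>m0. C * ((1/2) ^ m) powr s < e" using small by blast
    show "\<exists>m0. \<forall>m\<ge>m0. \<forall>k>m. dist (a m) (a k) < e"
    proof (intro exI allI impI)
      fix m k assume "m0 \<le> m" "m < k"
      have "(1/2::real) ^ k \<le> (1/2) ^ m" using \<open>m < k\<close> by (intro power_decreasing) auto
      then have "dist (a m) (a k) \<le> clim s * ((1/2) ^ m) powr s * g x"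
        unfolding dist_norm a_def by (intro psi_difference_scales x) auto
      also have "\<dots> < e" using m0 \<open>m0 \<le> m\<close> by (simp add: C_def mult_ac)
      finally show "dist (a m) (a k) < e" .
    qed
  qed
  then have "convergent a" by (rule Cauchy_convergent)
  then have lim: "a \<longlonglongrightarrow> lims x" using x by (simp add: lims_def a_def[abs_def] convergent_LIMSEQ_iff)
  then have "(\<lambda>m. norm (F (psi x r) - a m)) \<longlonglongrightarrow> norm (F (psi x r) - lims x)" by (intro tendsto_intros)
  moreover have "eventually (\<lambda>m. norm (F (psi x r) - a m) \<le> clim s * r powr s * g x) sequentially"
  proof -
    obtain m0 :: nat where m0: "(1/2) ^ m0 < r" using real_arch_pow_inv[OF r, of "1/2"] by auto
    have "norm (F (psi x r) - a m) \<le> clim s * r powr s * g x" if "m0 \<le> m" for m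
    proof -
      have "(1/2::real) ^ m \<le> (1/2) ^ m0" using that by (intro power_decreasing) auto
      then have "(1/2) ^ m \<le> r" using m0 by linarith
      then show ?thesis unfolding a_def by (intro psi_difference_scales x) auto
    qed
    then show ?thesis by (auto simp: eventually_sequentially)
  qed
  ultimately show ?thesis by (rule tendsto_upperbound) simp
qed

text \<open>Both limits are compared with bumps at the scale \<open>dist x y\<close>, where the two
  bumps differ by a molecule at this scale.\<close>

lemma lims_gradient:
  assumes x: "x \<notin> N" "y \<notin> N"
  shows "norm (lims x - lims y) \<le> 2 * clim s * dist x y powr s * (g x + g y)"
proof (cases "x = y")
  case False
  let ?r = "dist x y"
  have r: "0 < ?r" using False by simp
  have g: "0 \<le> g x" "0 \<le> g y" by (rule ctlD(2)[OF F])+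
  have "norm (lims x - lims y) = norm ((lims x - F (psi x ?r)) + (F (psi x ?r) - F (psi y ?r)) + (F (psi y ?r) - lims y))" by simp
  also have "\<dots> \<le> clim s * ?r powr s * g x + cdif * ?r powr s * g x + clim s * ?r powr s * g y"
  proof (intro norm_triangle_mono)
    show "norm (lims x - F (psi x ?r)) \<le> clim s * ?r powr s * g x"
      using lims_approx[OF x(1) r] by (simp add: norm_minus_commute)
    show "norm (F (psi x ?r) - F (psi y ?r)) \<le> cdif * ?r powr s * g x"
      using r by (intro psi_difference x) (auto simp: dist_commute)
    show "norm (F (psi y ?r) - lims y) \<le> clim s * ?r powr s * g y" by (rule lims_approx[OF x(2) r])
  qed
  also have "\<dots> \<le> clim s * ?r powr s * g x + clim s * ?r powr s * g x + 2 * (clim s * ?r powr s * g y)"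
  proof (intro add_mono mult_right_mono order_refl)
    have "0 \<le> clim s * ?r powr s * g y" using cdif_le_clim(2)[OF s] g by simp
    then show "clim s * ?r powr s * g y \<le> 2 * (clim s * ?r powr s * g y)" by linarith
  qed (use cdif_le_clim[OF s] g in auto)
  finally show ?thesis by (simp add: algebra_simps)
qed simp

text \<open>
  Continuity of \<open>F (psi x r)\<close> in \<open>x\<close> is not available, since translation is not continuous in
  Lipschitz norms. But \<open>lims\<close> is Hoelder continuous on each set where \<open>g\<close> is bounded.
\<close>

lemma lims_measurable: "lims \<in> borel_measurable M"
proof (rule borel_measurableI)
  fix U :: "'k set" assume U: "open U"
  define S where "S m = {x. x \<notin> N \<and> g x \<le> real m}" for m :: nat
  have [measurable]: "g \<in> borel_measurable M" by (rule ctlD(1)[OF F])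
  have Nm: "N \<in> sets M" using ctlD(3)[OF F] by auto
  have Sm: "S m \<in> sets M" for m
  proof -
    have "{x \<in> space M. g x \<le> real m} \<in> sets M" by measurable
    then have "{x. g x \<le> real m} - N \<in> sets M" using Nm by auto
    moreover have "S m = {x. g x \<le> real m} - N" by (auto simp: S_def)
    ultimately show ?thesis by simp
  qed
  have cont: "continuous_on (S m) lims" for m
    unfolding continuous_on_iff
  proof (intro ballI allI impI)
    fix x and e :: real assume x: "x \<in> S m" and e: "0 < e"
    \<comment> \<open>The summand 1 keeps \<open>C\<close> positive when \<open>m = 0\<close>, so
      that \<open>e / C\<close> is meaningful.\<close>
    define C where "C = 2 * clim s * (2 * real m) + 1"
    have C: "0 < C" using cdif_le_clim(2)[OF s] by (auto simp: C_def intro!: add_nonneg_pos mult_nonneg_nonneg)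
    define d where "d = (e / C) powr (1 / s)"
    show "\<exists>d>0. \<forall>x'\<in>S m. dist x' x < d \<longrightarrow> dist (lims x') (lims x) < e"
    proof (intro exI[of _ d] conjI ballI impI)
      show "0 < d" using e C by (simp add: d_def)
      fix y assume y: "y \<in> S m" "dist y x < d"
      have "dist (lims y) (lims x) \<le> 2 * clim s * dist y x powr s * (g y + g x)"
        unfolding dist_norm using x y by (intro lims_gradient) (auto simp: S_def)
      also have "\<dots> \<le> 2 * clim s * dist y x powr s * (2 * real m)"
        using x y cdif_le_clim(2)[OF s] by (intro mult_left_mono) (auto simp: S_def)
      also have "\<dots> = (C - 1) * dist y x powr s" by (simp add: C_def)
      also have "\<dots> \<le> C * dist y x powr s" by (intro mult_right_mono) auto
      also have "\<dots> < C * d powr s" using y s C by (intro mult_strict_left_mono powr_less_mono2) auto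
      also have "d powr s = e / C" using e C s by (simp add: d_def powr_powr)
      finally show "dist (lims y) (lims x) < e" using C by simp
    qed
  qed
  have "\<forall>m. \<exists>T. open T \<and> T \<inter> S m = lims -` U \<inter> S m"
    using cont U by (simp add: continuous_on_open_invariant)
  from choice[OF this] obtain T where "\<forall>m. open (T m) \<and> T m \<inter> S m = lims -` U \<inter> S m" ..
  then have T: "open (T m)" "lims -` U \<inter> S m = T m \<inter> S m" for m by simp_all
  have "lims -` U = (\<Union>m. T m \<inter> S m) \<union> (if 0 \<in> U then N else {})"
  proof -
    have SN: "x \<in> N \<or> (\<exists>m. x \<in> S m)" for x
    proof -
      obtain m :: nat where "g x \<le> real m" using real_arch_simple by blast
      then show ?thesis by (auto simp: S_def)
    qed
    have N0: "lims x = 0" if "x \<in> N" for x using that by (simp add: lims_def)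
    show ?thesis
    proof (intro equalityI subsetI)
      fix x assume x: "x \<in> lims -` U"
      show "x \<in> (\<Union>m. T m \<inter> S m) \<union> (if 0 \<in> U then N else {})"
      proof (cases "x \<in> N")
        case True
        then show ?thesis using x N0 by auto
      next
        case False
        then obtain m where "x \<in> S m" using SN by blast
        then have "x \<in> T m \<inter> S m" using x T(2)[of m] by blast
        then show ?thesis by blast
      qed
    next
      fix x assume "x \<in> (\<Union>m. T m \<inter> S m) \<union> (if 0 \<in> U then N else {})"
      then consider m where "x \<in> T m \<inter> S m" | "0 \<in> U" "x \<in> N" by (auto split: if_splits)
      then show "x \<in> lims -` U"
      proof cases
        case (1 m) then show ?thesis using T(2)[of m] by blast
      qed (simp add: N0)
    qed
  qed
  also have "\<dots> \<in> sets M" using T(1) Sm Nm by auto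
  finally show "lims -` U \<inter> space M \<in> sets M" by simp
qed

end

section \<open>Functionals of order \<open>r\<^sup>s\<close> on all molecules vanish\<close>

lemma linear_on_tests_sum:
  fixes F :: "('a \<Rightarrow> 'k::{real_normed_field,banach,second_countable_topology}) \<Rightarrow> 'k"
  assumes F: "linear_on_tests x1 F" and J: "finite J" "\<And>j. j \<in> J \<Longrightarrow> \<zeta> j \<in> tests x1"
  shows "(\<lambda>z. \<Sum>j\<in>J. \<zeta> j z) \<in> tests x1 \<and> F (\<lambda>z. \<Sum>j\<in>J. \<zeta> j z) = (\<Sum>j\<in>J. F (\<zeta> j))"
  using J
proof (induction J rule: finite_induct)
  case empty
  have "(\<lambda>z. 0 * psi x1 1 z + 0 * psi x1 1 z) \<in> tests x1" by (intro tests_lincomb psi_in_tests) auto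
  then show ?case using linear_on_testsD(4)[OF F psi_in_tests psi_in_tests, of 1 1] by simp
next
  case (insert j J)
  then have IH: "(\<lambda>z. \<Sum>j\<in>J. \<zeta> j z) \<in> tests x1" "F (\<lambda>z. \<Sum>j\<in>J. \<zeta> j z) = (\<Sum>j\<in>J. F (\<zeta> j))" "\<zeta> j \<in> tests x1"
    by auto
  have "(\<lambda>z. 1 * \<zeta> j z + 1 * (\<Sum>j\<in>J. \<zeta> j z)) \<in> tests x1" by (intro tests_lincomb IH)
  then show ?case using linear_on_testsD(5)[OF F IH(3) IH(1)] insert(1,2) IH(2) by simp
qed

text \<open>The maximum keeps the quotient away from the junk value \<open>R / 0 = 0\<close>.\<close>

definition tail :: "'a \<Rightarrow> real \<Rightarrow> 'a \<Rightarrow> real" where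
  "tail x R z = min 1 (2 * (1 - R / max R (dist x z)))"

text \<open>The Lipschitz bound is stated at the point farther from \<open>x\<close>: in
  \<open>tail_molecule\<close> its factor \<open>1 / dist x v\<close> supplies the denominator that
  turns a \<open>wt\<close> into a \<open>wt1\<close>.\<close>

lemma tail_props:
  assumes R: "0 < R"
  shows "0 \<le> tail x R z" "tail x R z \<le> 1" "dist x z \<le> R \<Longrightarrow> tail x R z = 0" "2 * R \<le> dist x z \<Longrightarrow> tail x R z = 1"
    and "R \<le> dist x v \<Longrightarrow> dist x u \<le> dist x v \<Longrightarrow> \<bar>tail x R u - tail x R v\<bar> \<le> 2 * dist u v / dist x v"
proof -
  have "R / max R (dist x z) \<le> 1" using R by (intro divide_le_eq_1_pos[THEN iffD2]) auto
  then show "0 \<le> tail x R z" "tail x R z \<le> 1" by (auto simp: tail_def)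
  show "dist x z \<le> R \<Longrightarrow> tail x R z = 0" using R by (simp add: tail_def max_absorb1)
  show "tail x R z = 1" if "2 * R \<le> dist x z"
  proof -
    have "0 < dist x z" using R that by linarith
    then have "R / max R (dist x z) \<le> 1/2" using R that by (simp add: field_simps)
    then show ?thesis by (simp add: tail_def)
  qed
  assume v: "R \<le> dist x v" "dist x u \<le> dist x v"
  define a b where "a = max R (dist x u)" and "b = dist x v"
  have ab: "R \<le> a" "a \<le> b" "0 < a" "0 < b" using v R by (auto simp: a_def b_def)
  have "b - a \<le> dist u v" using dist_triangle[of x v u] by (simp add: a_def b_def)
  moreover have "R / a - R / b = (R / a) * ((b - a) / b)" using ab by (simp add: field_simps)
  moreover have "(R / a) * ((b - a) / b) \<le> 1 * ((b - a) / b)" using ab R by (intro mult_right_mono) auto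
  moreover have "(b - a) / b \<le> dist u v / b" using ab calculation(1) by (intro divide_right_mono) auto
  ultimately have "R / a - R / b \<le> dist u v / b" by linarith
  moreover have "0 \<le> R / a - R / b" using ab R by (simp add: frac_le)
  ultimately have "\<bar>2 * (1 - R / a) - 2 * (1 - R / b)\<bar> \<le> 2 * dist u v / b" by simp
  moreover have "max R (dist x v) = b" using v by (simp add: b_def)
  ultimately show "\<bar>tail x R u - tail x R v\<bar> \<le> 2 * dist u v / dist x v"
    unfolding tail_def a_def[symmetric] b_def[symmetric] by (simp add: min_def abs_if split: if_splits)
qed

text \<open>Here the decay exponent 2 acts. Beyond distance \<open>R\<close> the radius
  \<open>R + dist x z\<close> is at most twice \<open>1 + dist x z\<close>, so up to a constant only
  the numerators 1 and \<open>R\<^sup>2\<close> of the two weights matter.\<close>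

lemma wt_tail:
  assumes R: "0 < R" "R \<le> dist x z"
  shows "wt x 1 z \<le> cw / R\<^sup>2 * wt x R z" "wt1 x 1 z \<le> cw / R\<^sup>2 * wt1 x R z"
proof -
  define a b where "a = 1 + dist x z" and "b = R + dist x z"
  have ab: "0 < a" "0 < b" "b \<le> 2 * a" using R by (auto simp: a_def b_def add_pos_nonneg)
  have "vol M x b \<le> K * 2 powr n * vol M x a" using ab by (intro vol_compare) auto
  then have v: "1 / vol M x a \<le> K * 2 powr n * (1 / vol M x b)"
    using vol_pos[of a x] vol_pos[of b x] ab by (simp add: field_simps)
  have i: "1 / a \<le> 2 / b" using ab by (simp add: field_simps)
  then have "(1 / a)\<^sup>2 \<le> (2 / b)\<^sup>2" using ab by (intro power_mono) auto
  then have "(1 / a)\<^sup>2 * (1 / vol M x a) \<le> (2 / b)\<^sup>2 * (K * 2 powr n * (1 / vol M x b))"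
    using v by (intro mult_mono) auto
  also have "\<dots> = cw / 2 / R\<^sup>2 * wt x R z"
    using R by (simp add: wt_def cw_def power_divide b_def)
  finally have w: "wt x 1 z \<le> cw / 2 / R\<^sup>2 * wt x R z" by (simp add: wt_def a_def)
  have "0 \<le> cw / R\<^sup>2 * wt x R z" using cw_pos wt_nonneg by simp
  with w show "wt x 1 z \<le> cw / R\<^sup>2 * wt x R z" by simp
  have "wt x 1 z * (1 / a) \<le> (cw / 2 / R\<^sup>2 * wt x R z) * (2 / b)"
    using w i ab cw_pos wt_nonneg by (intro mult_mono) auto
  then show "wt1 x 1 z \<le> cw / R\<^sup>2 * wt1 x R z" by (simp add: wt1_def a_def b_def)
qed

text \<open>A product rule in which the increment of the cutoff is paired with \<open>\<phi>\<close>
  at the farther point. The other summand vanishes if \<open>u\<close> is within \<open>R\<close>,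
  so \<open>wt_tail\<close> is applied only beyond \<open>R\<close>. The two summands contribute 1
  and 4 to the factor 5.\<close>

lemma tail_molecule:
  fixes \<phi> :: "'a \<Rightarrow> 'k::real_normed_field"
  assumes \<phi>: "molecule x 1 \<phi> D" "0 \<le> D" and R: "0 < R"
  shows "molecule x R (\<lambda>z. of_real (tail x R z) * \<phi> z) (5 * cw * D / R\<^sup>2)"
proof -
  note t = tail_props[OF R]
  let ?\<zeta> = "\<lambda>z. of_real (tail x R z) * \<phi> z"
  define C where "C = cw / R\<^sup>2"
  have C: "0 \<le> C" using cw_pos by (simp add: C_def)
  have w: "wt x 1 z \<le> C * wt x R z" "wt1 x 1 z \<le> C * wt1 x R z" if "R \<le> dist x z" for z
    using wt_tail[OF R that] by (auto simp: C_def)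
  have n1: "0 \<le> wt1 x R z" for z using R wt1_nonneg by simp
  have size: "norm (?\<zeta> u) \<le> D * (C * wt x R u)" for u
  proof (cases "dist x u \<le> R")
    case True
    then show ?thesis using t(3) \<phi>(2) C wt_nonneg by simp
  next
    case False
    have "norm (?\<zeta> u) \<le> 1 * norm (\<phi> u)" unfolding norm_mult using t(1,2) by (intro mult_right_mono) auto
    also have "\<dots> \<le> 1 * (D * wt x 1 u)" using \<phi>(1) by (simp add: molecule_def)
    also have "\<dots> \<le> 1 * (D * (C * wt x R u))" using w(1)[of u] False \<phi>(2) by (intro mult_left_mono) auto
    finally show ?thesis by simp
  qed
  have lip: "norm (?\<zeta> u - ?\<zeta> v) \<le> 5 * C * D * (dist u v * (wt1 x R u + wt1 x R v))" if uv: "dist x u \<le> dist x v" for u v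
  proof (cases "dist x v \<le> R")
    case True
    then show ?thesis using t(3)[of x u] t(3)[of x v] uv C \<phi>(2) n1 by (simp add: add_nonneg_nonneg)
  next
    case False
    then have v: "R \<le> dist x v" by simp
    have 1: "norm (of_real (tail x R u) * (\<phi> u - \<phi> v)) \<le> D * (dist u v * (C * wt1 x R u + C * wt1 x R v))"
    proof (cases "dist x u \<le> R")
      case True
      then show ?thesis using t(3) \<phi>(2) C n1 by (simp add: add_nonneg_nonneg)
    next
      case False
      have "norm (of_real (tail x R u) * (\<phi> u - \<phi> v)) \<le> 1 * norm (\<phi> u - \<phi> v)"
        unfolding norm_mult using t(1,2) by (intro mult_right_mono) auto
      also have "\<dots> \<le> 1 * (D * (dist u v * (wt1 x 1 u + wt1 x 1 v)))" using \<phi>(1) by (simp add: molecule_def)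
      also have "\<dots> \<le> 1 * (D * (dist u v * (C * wt1 x R u + C * wt1 x R v)))"
        using w(2)[of u] w(2)[of v] False v \<phi>(2) by (intro mult_left_mono add_mono) auto
      finally show ?thesis by simp
    qed
    have 2: "norm (of_real (tail x R u - tail x R v) * \<phi> v) \<le> 4 * C * D * dist u v * wt1 x R v"
    proof -
      have "norm (of_real (tail x R u - tail x R v) * \<phi> v) = \<bar>tail x R u - tail x R v\<bar> * norm (\<phi> v)"
        by (simp only: norm_mult norm_of_real)
      also have "\<dots> \<le> (2 * dist u v / dist x v) * (D * wt x 1 v)"
        using t(5)[OF v uv] \<phi> by (intro mult_mono) (auto simp: molecule_def)
      also have "\<dots> \<le> (2 * dist u v / dist x v) * (D * (C * wt x R v))"
        using w(1)[OF v] \<phi>(2) by (intro mult_left_mono) auto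
      also have "\<dots> = (2 * dist u v * D * C * wt x R v) * (1 / dist x v)" by simp
      also have "\<dots> \<le> (2 * dist u v * D * C * wt x R v) * (2 / (R + dist x v))"
      proof (rule mult_left_mono)
        show "1 / dist x v \<le> 2 / (R + dist x v)"
          using v less_le_trans[OF R v] R by (simp add: field_simps)
      qed (use \<phi>(2) C wt_nonneg in simp)
      finally show ?thesis by (simp add: wt1_def mult_ac)
    qed
    have "?\<zeta> u - ?\<zeta> v = of_real (tail x R u) * (\<phi> u - \<phi> v) + of_real (tail x R u - tail x R v) * \<phi> v"
      by (simp add: algebra_simps)
    then have "norm (?\<zeta> u - ?\<zeta> v) \<le> D * (dist u v * (C * wt1 x R u + C * wt1 x R v)) + 4 * C * D * dist u v * wt1 x R v"
      using norm_triangle_mono[OF 1 2] by simp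
    also have "\<dots> \<le> D * (dist u v * (C * wt1 x R u + C * wt1 x R v)) + 4 * C * D * dist u v * (wt1 x R u + wt1 x R v)"
      using C \<phi>(2) n1 by (intro add_left_mono mult_left_mono) auto
    also have "\<dots> = 5 * C * D * (dist u v * (wt1 x R u + wt1 x R v))" by (simp add: algebra_simps)
    finally show ?thesis .
  qed
  have "molecule x R ?\<zeta> (5 * C * D)"
    unfolding molecule_def
  proof safe
    fix u v
    have "0 \<le> D * (C * wt x R u)" using \<phi>(2) C wt_nonneg by simp
    then show "norm (?\<zeta> u) \<le> 5 * C * D * wt x R u" using size[of u] by (simp add: mult_ac)
    show "norm (?\<zeta> u - ?\<zeta> v) \<le> 5 * C * D * (dist u v * (wt1 x R u + wt1 x R v))"
      using lip[of u v] lip[of v u] by (cases "dist x u \<le> dist x v") (auto simp: norm_minus_commute dist_commute add.commute)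
  qed
  then show ?thesis by (simp add: C_def mult_ac)
qed

text \<open>At most \<open>K * 12 powr n\<close> net points lie within \<open>2 * r\<close> of a
  given point, so at most twice as many hats differ between \<open>u\<close> and \<open>v\<close>,
  each with Lipschitz constant \<open>1 / (2 * r)\<close>. The bound does not depend on
  \<open>J\<close>.\<close>

lemma net_overlap:
  assumes r: "0 < r" and J: "J \<subseteq> net r" "finite J"
  shows "\<bar>(\<Sum>j\<in>J. hat j (2 * r) u) - (\<Sum>j\<in>J. hat j (2 * r) v)\<bar> \<le> K * 12 powr n * (dist u v / r)"
proof -
  define A where "A = J \<inter> (ball u (2 * r) \<union> ball v (2 * r))"
  have fA: "finite A" using J by (simp add: A_def)
  have "A \<subseteq> (net r \<inter> ball u (2 * r)) \<union> (net r \<inter> ball v (2 * r))" using J by (auto simp: A_def)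
  then have "card A \<le> card ((net r \<inter> ball u (2 * r)) \<union> (net r \<inter> ball v (2 * r)))"
    using net_card(1)[OF r, of "2 * r"] r by (intro card_mono) auto
  also have "\<dots> \<le> card (net r \<inter> ball u (2 * r)) + card (net r \<inter> ball v (2 * r))" by (rule card_Un_le)
  finally have "real (card A) \<le> real (card (net r \<inter> ball u (2 * r))) + real (card (net r \<inter> ball v (2 * r)))"
    by linarith
  also have "\<dots> \<le> K * (6 * (2 * r) / r) powr n + K * (6 * (2 * r) / r) powr n"
    using net_card(2)[OF r, of "2 * r"] r by (intro add_mono) auto
  finally have cA: "real (card A) \<le> 2 * (K * 12 powr n)" using r by simp
  have "\<bar>(\<Sum>j\<in>J. hat j (2 * r) u) - (\<Sum>j\<in>J. hat j (2 * r) v)\<bar> = \<bar>\<Sum>j\<in>J. hat j (2 * r) u - hat j (2 * r) v\<bar>"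
    by (simp add: sum_subtractf)
  also have "\<dots> \<le> (\<Sum>j\<in>J. \<bar>hat j (2 * r) u - hat j (2 * r) v\<bar>)" by (rule sum_abs)
  also have "\<dots> = (\<Sum>j\<in>A. \<bar>hat j (2 * r) u - hat j (2 * r) v\<bar>)"
  proof (intro sum.mono_neutral_right ballI)
    fix i assume "i \<in> J - A"
    then have "2 * r \<le> dist i u" "2 * r \<le> dist i v" by (auto simp: A_def dist_commute)
    then show "\<bar>hat i (2 * r) u - hat i (2 * r) v\<bar> = 0" using r by (simp add: hat_simps(3))
  qed (use J in \<open>auto simp: A_def\<close>)
  also have "\<dots> \<le> (\<Sum>j\<in>A. dist u v / (2 * r))" using r by (intro sum_mono hat_lipschitz) auto
  also have "\<dots> = real (card A) * (dist u v / (2 * r))" by simp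
  also have "\<dots> \<le> 2 * (K * 12 powr n) * (dist u v / (2 * r))" using cA r by (intro mult_right_mono) auto
  finally show ?thesis by simp
qed

definition cpu :: real where "cpu = 2 * (3 + 4 * (K * 12 powr n))"

text \<open>The truncation of \<open>T\<close> at 1/2 keeps the quotients Lipschitz everywhere, also
  where no hat is present. As \<open>r \<le> 1\<close>, the Lipschitz constant \<open>B\<close> is
  at most \<open>B / r\<close>. The leading factor 2 in \<open>cpu\<close> compensates for the bump
  radius \<open>2 * r\<close>.\<close>

lemma partition_molecule:
  fixes \<zeta> :: "'a \<Rightarrow> 'k::real_normed_field"
  assumes r: "0 < r" "r \<le> 1" and J: "J \<subseteq> net r" "finite J" and j: "j \<in> J"
    and B: "0 \<le> B" "\<And>z. norm (\<zeta> z) \<le> B" "\<And>u v. norm (\<zeta> u - \<zeta> v) \<le> B * dist u v"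
  defines "T \<equiv> \<lambda>z. max (1/2) (\<Sum>i\<in>J. hat i (2 * r) z)"
  shows "molecule j (2 * r) (\<lambda>z. of_real (hat j (2 * r) z / T z) * \<zeta> z) (cw * vol M j (2 * r) * (cpu * B))"
proof (rule bump_molecule)
  let ?N = "K * 12 powr n"
  define e where "e z = hat j (2 * r) z / T z" for z
  have N: "0 \<le> ?N" using K_ge_1 by simp
  have T: "1/2 \<le> T z" "0 < T z" for z by (auto simp: T_def)
  have h: "0 \<le> hat j (2 * r) z" "hat j (2 * r) z \<le> 1" for z using hat_simps r by auto
  have e: "0 \<le> e z" "e z \<le> 2" for z
  proof -
    show "0 \<le> e z" using h T[of z] by (simp add: e_def)
    have "hat j (2 * r) z / T z \<le> 1 / (1/2)" using h T by (intro frac_le) auto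
    then show "e z \<le> 2" by (simp add: e_def)
  qed
  have Tl: "\<bar>T u - T v\<bar> \<le> ?N * (dist u v / r)" for u v
    using net_overlap[OF r(1) J, of u v] by (auto simp: T_def max_def)
  have el: "\<bar>e u - e v\<bar> \<le> (1 + 4 * ?N) * (dist u v / r)" for u v
  proof -
    have "e u - e v = (hat j (2 * r) u - hat j (2 * r) v) / T u + hat j (2 * r) v * ((T v - T u) / (T u * T v))"
      using T(2)[of u] T(2)[of v] by (simp add: e_def field_simps)
    then have "\<bar>e u - e v\<bar> \<le> \<bar>hat j (2 * r) u - hat j (2 * r) v\<bar> / T u + hat j (2 * r) v * (\<bar>T v - T u\<bar> / (T u * T v))"
      using T(2)[of u] T(2)[of v] h[of v]
      by (metis abs_divide abs_mult abs_of_nonneg abs_of_pos abs_triangle_ineq)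
    also have "\<dots> \<le> (dist u v / (2 * r)) / (1/2) + 1 * ((?N * (dist u v / r)) / (1/2 * (1/2)))"
    proof (intro add_mono frac_le mult_mono)
      show "\<bar>hat j (2 * r) u - hat j (2 * r) v\<bar> \<le> dist u v / (2 * r)" using r by (intro hat_lipschitz) auto
      show "\<bar>T v - T u\<bar> \<le> ?N * (dist u v / r)" using Tl[of u v] by (simp add: abs_minus_commute)
    qed (use T[of u] T[of v] h[of v] N r in \<open>auto intro!: divide_nonneg_nonneg mult_nonneg_nonneg\<close>)
    also have "\<dots> = (1 + 4 * ?N) * (dist u v / r)" by (simp add: algebra_simps)
    finally show ?thesis .
  qed
  show "0 < 2 * r" using r by simp
  show "0 \<le> cpu * B" using B N by (simp add: cpu_def)
  fix z u v
  show "of_real (hat j (2 * r) z / T z) * \<zeta> z = 0" if "2 * r \<le> dist j z" using that r hat_simps(3)[of "2 * r" j z] by simp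
  have "norm (of_real (e z) * \<zeta> z) \<le> 2 * B" unfolding norm_mult using e B by (intro mult_mono) auto
  also have "\<dots> \<le> cpu * B" using B N by (intro mult_right_mono) (auto simp: cpu_def)
  finally show "norm (of_real (hat j (2 * r) z / T z) * \<zeta> z) \<le> cpu * B" by (simp add: e_def)
  have "of_real (e u) * \<zeta> u - of_real (e v) * \<zeta> v = of_real (e u) * (\<zeta> u - \<zeta> v) + of_real (e u - e v) * \<zeta> v"
    by (simp add: algebra_simps)
  also have "norm \<dots> \<le> 2 * (B * dist u v) + (1 + 4 * ?N) * (dist u v / r) * B"
  proof (rule norm_triangle_mono)
    show "norm (of_real (e u) * (\<zeta> u - \<zeta> v)) \<le> 2 * (B * dist u v)"
      unfolding norm_mult using e B by (intro mult_mono) auto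
    show "norm (of_real (e u - e v) * \<zeta> v) \<le> (1 + 4 * ?N) * (dist u v / r) * B"
      unfolding norm_mult norm_of_real using el B N r by (intro mult_mono) (auto intro!: mult_nonneg_nonneg)
  qed
  also have "\<dots> \<le> 2 * (B * (dist u v / r)) + (1 + 4 * ?N) * (dist u v / r) * B"
  proof -
    have "dist u v * r \<le> dist u v * 1" using r by (intro mult_left_mono) auto
    then have "dist u v \<le> dist u v / r" using r by (simp add: field_simps)
    then show ?thesis using B by (intro add_right_mono mult_left_mono) auto
  qed
  also have "\<dots> = cpu * B * (dist u v / (2 * r))" by (simp add: cpu_def algebra_simps)
  finally show "norm (of_real (hat j (2 * r) u / T u) * \<zeta> u - of_real (hat j (2 * r) v / T v) * \<zeta> v) \<le> cpu * B * (dist u v / (2 * r))"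
    by (simp add: e_def)
qed

text \<open>Where \<open>\<zeta>\<close> is nonzero, some point of \<open>J\<close> is closer than
  \<open>r\<close> and its hat is at least 1/2. The truncation in \<open>T\<close> is then inactive
  and the quotients sum to 1.\<close>

lemma partition_sum:
  fixes \<zeta> :: "'a \<Rightarrow> 'k::real_normed_field"
  assumes r: "0 < r" and supp: "\<And>z. R \<le> dist x z \<Longrightarrow> \<zeta> z = 0"
  defines "J \<equiv> net r \<inter> ball x (R + r)"
  assumes J: "finite J"
  defines "T \<equiv> \<lambda>z. max (1/2) (\<Sum>i\<in>J. hat i (2 * r) z)"
  shows "\<zeta> z = (\<Sum>j\<in>J. of_real (hat j (2 * r) z / T z) * \<zeta> z)"
proof (cases "\<zeta> z = 0")
  case False
  then have z: "dist x z < R" using supp[of z] by force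
  obtain j where j: "j \<in> net r" "dist z j < r" using net_dense[OF r, of z] by blast
  have "dist x j < R + r" using z j(2) dist_triangle[of x j z] by simp
  then have jJ: "j \<in> J" using j by (simp add: J_def)
  have "1/2 \<le> hat j (2 * r) z" using j(2) r by (simp add: hat_def dist_commute field_simps max_def)
  also have "\<dots> \<le> (\<Sum>i\<in>J. hat i (2 * r) z)" using jJ J by (intro member_le_sum) (auto simp: hat_simps)
  finally have "T z = (\<Sum>i\<in>J. hat i (2 * r) z)" "0 < T z" by (auto simp: T_def)
  then have "(\<Sum>j\<in>J. hat j (2 * r) z / T z) = 1" by (simp flip: sum_divide_distrib)
  then have "of_real (\<Sum>j\<in>J. hat j (2 * r) z / T z) * \<zeta> z = \<zeta> z" by simp
  then show ?thesis by (simp add: sum_distrib_right)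
qed simp

section \<open>Vanishing of a functional that is small on all bumps\<close>

context
  fixes x1 :: 'a and s p c0 :: real and g :: "'a \<Rightarrow> real" and N :: "'a set"
    and F :: "('a \<Rightarrow> 'k::{real_normed_field,banach,second_countable_topology}) \<Rightarrow> 'k"
  assumes F: "ctl x1 s F g N" and s: "0 < s" "s \<le> 1" and p: "n / (n + s) < p" and c0: "0 \<le> c0"
    and g_Lp: "(\<integral>\<^sup>+x. ennreal (g x powr p) \<partial>M) < top"
    and F_psi: "\<And>x r. x \<notin> N \<Longrightarrow> 0 < r \<Longrightarrow> norm (F (psi x r)) \<le> c0 * r powr s * g x"
begin

definition c3 :: real where "c3 = 1 + cw * cpsi + cw * c0"

lemma c3_pos: "0 < c3"
  using cw_pos cpsi_pos c0 by (auto simp: c3_def intro!: add_pos_nonneg)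

text \<open>The centred part is bounded by \<open>ctl\<close>, the bump that was split off by
  \<open>F_psi\<close>. This removes the mean-zero condition, which the pieces of a partition of
  unity violate.\<close>

lemma all_molecules:
  assumes x: "x \<notin> N" and \<zeta>: "molecule x r \<zeta> D" "0 \<le> D" "0 < r"
  shows "norm (F \<zeta>) \<le> c3 * D * r powr s * g x"
proof -
  define c where "c = (\<integral>z. \<zeta> z \<partial>M)"
  have c: "norm c \<le> cw * D" unfolding c_def by (rule molecule_integrable(2)[OF \<zeta>])
  have T: "\<zeta> \<in> tests x1" "psi x r \<in> tests x1" using \<zeta> by (auto intro: molecule_in_tests psi_in_tests)
  have g: "0 \<le> g x" by (rule ctlD(2)[OF F])
  have "norm (F (\<lambda>z. \<zeta> z + (- c) * psi x r z)) \<le> (1 + cw * cpsi) * D * r powr s * g x"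
    unfolding c_def using cw_pos cpsi_pos \<zeta> by (intro ctlD(5)[OF F x] molecule_centre) auto
  then have 1: "norm (F \<zeta> - c * F (psi x r)) \<le> (1 + cw * cpsi) * D * r powr s * g x"
    using linear_on_testsD(1)[OF ctlD(4)[OF F] T, of "- c"] by simp
  have 2: "norm (c * F (psi x r)) \<le> (cw * D) * (c0 * r powr s * g x)"
    unfolding norm_mult using c F_psi[OF x \<zeta>(3)] cw_pos \<zeta>(2) by (intro mult_mono) auto
  have "norm (F \<zeta>) \<le> (1 + cw * cpsi) * D * r powr s * g x + (cw * D) * (c0 * r powr s * g x)"
    using norm_triangle_mono[OF 1 2] by simp
  then show ?thesis by (simp add: c3_def algebra_simps)
qed

text \<open>Summation over the pieces uses \<open>1 / p0 - 1 \<ge> 0\<close>, so exponents above 1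
  are lowered to 1; locally the integral stays finite. The last claim of the next lemma is the
  inequality \<open>n / (n + s) < p0\<close> rewritten.\<close>

definition p0 :: real where "p0 = min p 1"

lemma p0: "0 < p0" "p0 \<le> 1" "0 < s + n * (1 - 1 / p0)"
proof -
  have ns: "0 < n + s" using n_pos s by simp
  then have "0 < n / (n + s)" using n_pos by simp
  then show p0: "0 < p0" "p0 \<le> 1" using p by (auto simp: p0_def)
  have "n / (n + s) < p0" using p s n_pos by (simp add: p0_def)
  then have "n / p0 < n + s" using ns p0 by (simp add: field_simps)
  then show "0 < s + n * (1 - 1 / p0)" by (simp add: algebra_simps)
qed

lemma g_p0_locally_finite: "(\<integral>\<^sup>+x\<in>ball y R. ennreal (g x powr p0) \<partial>M) < top"
proof -
  have [measurable]: "g \<in> borel_measurable M" by (rule ctlD(1)[OF F])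
  have "g x powr p0 \<le> 1 + g x powr p" for x
  proof (cases "p \<le> 1 \<or> g x \<le> 1")
    case True
    then show ?thesis using ctlD(2)[OF F, of x] p0 powr_mono2[of p0 "g x" 1] by (cases "p \<le> 1") (auto simp: p0_def intro: add_increasing2)
  next
    case False
    then show ?thesis using powr_mono[of p0 p "g x"] by (simp add: p0_def)
  qed
  then have "(\<integral>\<^sup>+x\<in>ball y R. ennreal (g x powr p0) \<partial>M) \<le> (\<integral>\<^sup>+x. indicator (ball y R) x + ennreal (g x powr p) \<partial>M)"
  proof (intro nn_integral_mono)
    fix x
    assume *: "\<And>x. g x powr p0 \<le> 1 + g x powr p"
    have "ennreal (g x powr p0) \<le> ennreal (1 + g x powr p)" by (intro ennreal_leI *)
    then show "ennreal (g x powr p0) * indicator (ball y R) x \<le> indicator (ball y R) x + ennreal (g x powr p)"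
      by (auto simp: indicator_def)
  qed
  also have "\<dots> = emeasure M (ball y R) + (\<integral>\<^sup>+x. ennreal (g x powr p) \<partial>M)" by (simp add: nn_integral_add)
  also have "\<dots> < top" using ball_finite[of y R] g_Lp by simp
  finally show ?thesis .
qed

text \<open>Cut \<open>\<zeta>\<close> into pieces at scale \<open>r\<close>. A piece has value at
  most \<open>C * r powr s * V j\<close> times \<open>g\<close> at almost every point of the ball
  about \<open>j\<close>, hence at most
  \<open>C * r powr s * V j * (i j / V j) powr (1 / p0)\<close>. The power \<open>1 - 1 / p0\<close>
  of \<open>V j\<close> is bounded through a lower volume bound, one factor \<open>i j\<close> is
  kept while the rest is bounded by \<open>I\<close>, and the \<open>i j\<close> sum to at most
  \<open>I\<close> because the balls are disjoint. A positive power of \<open>r\<close>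
  remains.\<close>

lemma compact_support_vanish:
  assumes \<zeta>: "\<zeta> \<in> tests x1" and R: "0 < R" "\<And>z. R \<le> dist x z \<Longrightarrow> \<zeta> z = 0"
    and B: "0 < B" "\<And>z. norm (\<zeta> z) \<le> B" "\<And>u v. norm (\<zeta> u - \<zeta> v) \<le> B * dist u v"
  shows "F \<zeta> = 0"
proof -
  note lin = ctlD(4)[OF F] and g0 = ctlD(2)[OF F]
  have [measurable]: "g \<in> borel_measurable M" by (rule ctlD(1)[OF F])
  \<comment> \<open>Room for the balls of radius \<open>r / 2\<close> about points of
    \<open>ball x (R + r)\<close> with \<open>r \<le> 1\<close>, and for
    \<open>dist j x + 1 \<le> R1\<close> in the comparison with the unit ball.\<close>
  define R1 where "R1 = R + 2"
  define Q where "Q S = (\<integral>\<^sup>+x\<in>S. ennreal (g x powr p0) \<partial>M)" for S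
  define I where "I = enn2real (Q (ball x R1))"
  have I: "Q (ball x R1) = ennreal I" "0 \<le> I"
    using g_p0_locally_finite[of x R1] by (auto simp: I_def Q_def)
  \<comment> \<open>Doubling from \<open>ball j (r / 2)\<close> up to the unit ball at
    \<open>x\<close> gives \<open>cv * r powr n \<le> V j\<close> for all \<open>j\<close> at
    once.\<close>
  define cv where "cv = vol M x 1 / (K * (2 * R1) powr n)"
  have cv: "0 < cv" using vol_pos[of 1 x] K_ge_1 R by (simp add: cv_def R1_def)
  define C where "C = c3 * (chg 1 * (cw * (K * 4 powr n) * (cpu * B))) * 2 powr s"
  have cpu: "0 < cpu" using K_ge_1 by (auto simp: cpu_def intro!: add_pos_nonneg)
  have C: "0 < C" using c3_pos chg_pos[of 1] cw_pos K_ge_1 cpu B by (simp add: C_def)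
  \<comment> \<open>positive exactly because \<open>p > n / (n + s)\<close>\<close>
  define \<epsilon> where "\<epsilon> = s + n * (1 - 1 / p0)"
  define C' where "C' = C * cv powr (1 - 1 / p0) * I powr (1 / p0 - 1) * I"
  have bound: "norm (F \<zeta>) \<le> C' * r powr \<epsilon>" if r: "0 < r" "r \<le> 1" for r
  proof -
    define J where "J = net r \<inter> ball x (R + r)"
    have J: "J \<subseteq> net r" "finite J" using net_card(1)[OF r(1), of "R + r"] R by (auto simp: J_def)
    define T where "T = (\<lambda>z. max (1/2) (\<Sum>i\<in>J. hat i (2 * r) z))"
    define \<eta> where "\<eta> j = (\<lambda>z. of_real (hat j (2 * r) z / T z) * \<zeta> z)" for j
    define V where "V j = vol M j (r / 2)" for j
    define i where "i j = enn2real (Q (ball j (r / 2)))" for j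
    have V: "0 < V j" for j using r by (simp add: V_def vol_pos)
    have mol: "molecule j (2 * r) (\<eta> j) (cw * vol M j (2 * r) * (cpu * B))" if "j \<in> J" for j
      unfolding \<eta>_def T_def using r J that B by (intro partition_molecule) auto
    have D0: "0 \<le> cw * vol M j (2 * r) * (cpu * B)" for j using cw_pos cpu B by simp
    have tests: "\<eta> j \<in> tests x1" if "j \<in> J" for j
      using molecule_in_tests[OF mol[OF that] D0] r by simp
    have "\<zeta> = (\<lambda>z. \<Sum>j\<in>J. \<eta> j z)"
      unfolding \<eta>_def T_def J_def using r R J by (intro ext partition_sum) (auto simp: J_def)
    then have "F \<zeta> = (\<Sum>j\<in>J. F (\<eta> j))"
      using linear_on_tests_sum[OF lin J(2) tests] by simp
    then have "norm (F \<zeta>) \<le> (\<Sum>j\<in>J. norm (F (\<eta> j)))" by (simp add: norm_sum)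
    also have "\<dots> \<le> (\<Sum>j\<in>J. C * cv powr (1 - 1 / p0) * I powr (1 / p0 - 1) * r powr \<epsilon> * i j)"
    proof (rule sum_mono)
      fix j assume j: "j \<in> J"
      have sub: "ball j (r / 2) \<subseteq> ball x R1"
      proof
        fix z assume "z \<in> ball j (r / 2)"
        then show "z \<in> ball x R1" using j r dist_triangle[of x z j] by (auto simp: J_def R1_def)
      qed
      then have "Q (ball j (r / 2)) \<le> Q (ball x R1)"
        unfolding Q_def by (intro nn_integral_mono mult_left_mono) (auto simp: indicator_def)
      then have ij: "Q (ball j (r / 2)) = ennreal (i j)" "0 \<le> i j" "i j \<le> I"
        using I by (auto simp: i_def ennreal_enn2real_if top_unique enn2real_leI split: if_splits)
      have v1: "vol M j (2 * r) \<le> K * 4 powr n * V j"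
        unfolding V_def using r by (intro vol_compare) auto
      have pt: "norm (F (\<eta> j)) \<le> C * r powr s * V j * g y" if y: "y \<in> ball j (r / 2)" "y \<notin> N" for y
      proof -
        have "molecule y (2 * r) (\<eta> j) (chg 1 * (cw * vol M j (2 * r) * (cpu * B)))"
          using r y by (intro molecule_change[OF mol[OF j] D0]) auto
        then have "norm (F (\<eta> j)) \<le> c3 * (chg 1 * (cw * vol M j (2 * r) * (cpu * B))) * (2 * r) powr s * g y"
          using y r D0 chg_pos[of 1] by (intro all_molecules) auto
        also have "\<dots> \<le> c3 * (chg 1 * (cw * (K * 4 powr n * V j) * (cpu * B))) * (2 * r) powr s * g y"
          using v1 c3_pos chg_pos[of 1] cw_pos cpu B g0 by (intro mult_right_mono mult_left_mono) auto
        also have "(2 * r) powr s = 2 powr s * r powr s" using r by (simp add: powr_mult)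
        also have "c3 * (chg 1 * (cw * (K * 4 powr n * V j) * (cpu * B))) * (2 powr s * r powr s) * g y = C * r powr s * V j * g y"
          by (simp add: C_def mult_ac)
        finally show ?thesis .
      qed
      \<comment> \<open>A lower bound of \<open>g\<close> almost everywhere on the ball, so
        \<open>t powr p0\<close> is at most the average of \<open>g powr p0\<close>.\<close>
      define t where "t = norm (F (\<eta> j)) / (C * r powr s * V j)"
      have den: "0 < C * r powr s * V j" using C r V by simp
      have t: "0 \<le> t" using den by (simp add: t_def)
      have tg: "t \<le> g y" if "y \<in> ball j (r / 2)" "y \<notin> N" for y
        using pt[OF that] den by (simp add: t_def field_simps)
      have "ennreal (t powr p0 * V j) = ennreal (t powr p0) * emeasure M (ball j (r / 2))"
        using t by (simp add: V_def emeasure_ball ennreal_mult)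
      also have "\<dots> = (\<integral>\<^sup>+y. ennreal (t powr p0) * indicator (ball j (r / 2)) y \<partial>M)"
        by (simp add: nn_integral_cmult_indicator)
      also have "\<dots> \<le> Q (ball j (r / 2))"
        unfolding Q_def
      proof (rule nn_integral_mono_AE)
        have "AE y in M. y \<notin> N" using ctlD(3)[OF F] by (rule AE_not_in)
        then show "AE y in M. ennreal (t powr p0) * indicator (ball j (r / 2)) y \<le> ennreal (g y powr p0) * indicator (ball j (r / 2)) y"
        proof eventually_elim
          case (elim y)
          show ?case
          proof (cases "y \<in> ball j (r / 2)")
            case True
            then show ?thesis using tg[of y] elim t p0 by (simp add: ennreal_leI powr_mono2)
          qed simp
        qed
      qed
      finally have "t powr p0 * V j \<le> i j" using ij by (simp add: ennreal_le_iff)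
      then have "t powr p0 \<le> i j / V j" using V[of j] by (simp add: field_simps)
      then have "(t powr p0) powr (1 / p0) \<le> (i j / V j) powr (1 / p0)" using p0 by (intro powr_mono2) auto
      then have tle: "t \<le> i j powr (1 / p0) / V j powr (1 / p0)"
        using t p0 V[of j] ij by (simp add: powr_powr powr_divide)
      have "vol M x 1 \<le> K * (2 * R1 / r) powr n * V j"
        unfolding V_def
      proof (rule vol_compare)
        show "1 \<le> 2 * R1 / r" using r R by (simp add: R1_def field_simps)
        have "dist j x \<le> R + 1" using j r by (auto simp: J_def dist_commute)
        then show "dist j x + 1 \<le> 2 * R1 / r * (r / 2)" using r by (simp add: R1_def)
      qed (use r in simp)
      also have "(2 * R1 / r) powr n = (2 * R1) powr n / r powr n" using r R by (simp add: powr_divide R1_def)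
      finally have vj: "cv * r powr n \<le> V j"
        using r R K_ge_1 by (simp add: cv_def R1_def field_simps)
      have e: "1 - 1 / p0 \<le> 0" using p0 by (simp add: field_simps)
      have "V j powr (1 - 1 / p0) \<le> (cv * r powr n) powr (1 - 1 / p0)"
        using vj cv r e by (intro powr_mono2') auto
      also have "\<dots> = cv powr (1 - 1 / p0) * r powr (n * (1 - 1 / p0))"
        using cv r by (simp add: powr_mult powr_powr)
      finally have vp: "V j powr (1 - 1 / p0) \<le> cv powr (1 - 1 / p0) * r powr (n * (1 - 1 / p0))" .
      have ip: "i j powr (1 / p0) \<le> I powr (1 / p0 - 1) * i j"
      proof (cases "i j = 0")
        case False
        then have "i j powr (1 / p0) = i j powr (1 / p0 - 1) * i j" using ij by (simp add: powr_diff)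
        also have "\<dots> \<le> I powr (1 / p0 - 1) * i j" using ij e by (intro mult_right_mono powr_mono2) auto
        finally show ?thesis .
      qed simp
      have "norm (F (\<eta> j)) = C * r powr s * V j * t" using C V[of j] r by (simp add: t_def)
      also have "\<dots> \<le> C * r powr s * V j * (i j powr (1 / p0) / V j powr (1 / p0))" using tle den by (intro mult_left_mono) auto
      also have "\<dots> = C * r powr s * (V j powr (1 - 1 / p0) * i j powr (1 / p0))"
        using V[of j] by (simp add: powr_diff)
      also have "\<dots> \<le> C * r powr s * ((cv powr (1 - 1 / p0) * r powr (n * (1 - 1 / p0))) * (I powr (1 / p0 - 1) * i j))"
        using C vp ip ij by (intro mult_left_mono mult_mono) auto
      also have "\<dots> = C * cv powr (1 - 1 / p0) * I powr (1 / p0 - 1) * (r powr s * r powr (n * (1 - 1 / p0))) * i j"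
        by (simp add: mult_ac)
      also have "r powr s * r powr (n * (1 - 1 / p0)) = r powr \<epsilon>" by (simp add: \<epsilon>_def powr_add)
      finally show "norm (F (\<eta> j)) \<le> C * cv powr (1 - 1 / p0) * I powr (1 / p0 - 1) * r powr \<epsilon> * i j" .
    qed
    also have "\<dots> = C * cv powr (1 - 1 / p0) * I powr (1 / p0 - 1) * r powr \<epsilon> * (\<Sum>j\<in>J. i j)"
      by (rule sum_distrib_left[symmetric])
    also have "\<dots> \<le> C * cv powr (1 - 1 / p0) * I powr (1 / p0 - 1) * r powr \<epsilon> * I"
    proof (rule mult_left_mono)
      have disj: "disjoint_family_on (\<lambda>j. ball j (r/2)) J"
        unfolding disjoint_family_on_def
      proof (intro ballI impI)
        fix y z assume yz: "y \<in> J" "z \<in> J" "y \<noteq> z"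
        then have "r \<le> dist y z" using net_separated[OF r(1)] J(1) by blast
        moreover have "dist y z < r" if "w \<in> ball y (r/2)" "w \<in> ball z (r/2)" for w
          using that dist_triangle[of y z w] by (simp add: dist_commute)
        ultimately show "ball y (r/2) \<inter> ball z (r/2) = {}" by force
      qed
      have sub: "(\<Union>j\<in>J. ball j (r/2)) \<subseteq> ball x R1"
      proof
        fix z assume "z \<in> (\<Union>j\<in>J. ball j (r/2))"
        then obtain j where "j \<in> J" "dist j z < r/2" by auto
        then show "z \<in> ball x R1" using r dist_triangle[of x z j] by (auto simp: J_def R1_def)
      qed
      have "(\<Sum>j\<in>J. Q (ball j (r/2))) = (\<integral>\<^sup>+y. (\<Sum>j\<in>J. ennreal (g y powr p0) * indicator (ball j (r/2)) y) \<partial>M)"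
        unfolding Q_def by (intro nn_integral_sum[symmetric]) auto
      also have "\<dots> \<le> Q (ball x R1)"
        unfolding Q_def
      proof (rule nn_integral_mono)
        fix y
        have "(\<Sum>j\<in>J. ennreal (g y powr p0) * indicator (ball j (r/2)) y) = ennreal (g y powr p0) * (\<Sum>j\<in>J. indicator (ball j (r/2)) y)"
          by (rule sum_distrib_left[symmetric])
        also have "(\<Sum>j\<in>J. indicator (ball j (r/2)) y) = (indicator (\<Union>j\<in>J. ball j (r/2)) y :: ennreal)"
          using J(2) disj by (intro indicator_UN_disjoint[symmetric])
        also have "ennreal (g y powr p0) * \<dots> \<le> ennreal (g y powr p0) * indicator (ball x R1) y"
          using subsetD[OF sub] by (intro mult_left_mono indicator_leI) simp_all
        finally show "(\<Sum>j\<in>J. ennreal (g y powr p0) * indicator (ball j (r/2)) y) \<le> ennreal (g y powr p0) * indicator (ball x R1) y" .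
      qed
      finally have le: "(\<Sum>j\<in>J. Q (ball j (r/2))) \<le> ennreal I" using I by simp
      have Qi: "Q (ball j (r/2)) = ennreal (i j)" for j
        using g_p0_locally_finite[of j "r/2"] by (simp add: i_def Q_def)
      have "ennreal (\<Sum>j\<in>J. i j) = (\<Sum>j\<in>J. ennreal (i j))"
        by (rule sum_ennreal[symmetric]) (simp add: i_def)
      also have "\<dots> \<le> ennreal I" using le unfolding Qi .
      finally have "ennreal (\<Sum>j\<in>J. i j) \<le> ennreal I" .
      then show "(\<Sum>j\<in>J. i j) \<le> I" using I by (simp add: ennreal_le_iff)
    qed (use C in simp)
    finally show ?thesis by (simp add: C'_def mult_ac)
  qed
  have "((\<lambda>r. C' * r powr \<epsilon>) \<longlongrightarrow> C' * 0 powr \<epsilon>) (at_right 0)"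
    using p0(3) by (intro tendsto_mult tendsto_const tendsto_powr') (auto simp: \<epsilon>_def eventually_at_filter)
  moreover have "eventually (\<lambda>r. norm (F \<zeta>) \<le> C' * r powr \<epsilon>) (at_right 0)"
    unfolding eventually_at_right_field using bound by (intro exI[of _ 1]) auto
  ultimately have "norm (F \<zeta>) \<le> C' * 0 powr \<epsilon>" by (intro tendsto_lowerbound) auto
  then show ?thesis by simp
qed

text \<open>
  The dual of \<open>\<G>(1, 2)\<close> contains singular functionals, concentrated at a point or at infinity, so
  this does not follow from density of nice functions: the two kinds are excluded by
  \<open>compact_support_vanish\<close> and by the tail estimate, respectively.
\<close>

lemma functional_vanishes:
  assumes \<phi>: "\<phi> \<in> tests x1"
  shows "F \<phi> = 0"
proof -
  note lin = ctlD(4)[OF F] and g0 = ctlD(2)[OF F]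
  obtain x where x: "x \<notin> N" using not_null_ball[OF ctlD(3)[OF F] zero_less_one] by blast
  obtain D where D: "0 \<le> D" "molecule x 1 \<phi> D" using tests_molecule[OF \<phi> zero_less_one] by blast
  define C where "C = c3 * (5 * cw * D) * g x"
  have bound: "norm (F \<phi>) \<le> C * R powr (s - 2)" if R: "0 < R" for R
  proof -
    define D' where "D' = 5 * cw * D / R\<^sup>2"
    have D': "0 \<le> D'" using cw_pos D by (simp add: D'_def)
    define \<tau> where "\<tau> = (\<lambda>z. of_real (tail x R z) * \<phi> z)"
    have \<tau>: "molecule x R \<tau> D'" unfolding \<tau>_def D'_def by (rule tail_molecule[OF D(2,1) R])
    have \<tau>T: "\<tau> \<in> tests x1" using \<tau> D' R by (rule molecule_in_tests)
    have diff: "(\<lambda>z. \<phi> z - \<tau> z) \<in> tests x1" using tests_lincomb[OF \<phi> \<tau>T, of 1 "-1"] by simp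
    let ?V = "vol M x 1" and ?W = "vol M x R"
    have V: "0 < ?V" "0 < ?W" using R by (auto intro: vol_pos)
    \<comment> \<open>Bounds both the size and the Lipschitz constant of the difference. It depends
      on \<open>R\<close>, which does no harm because \<open>compact_support_vanish\<close> yields
      exactly 0.\<close>
    define B where "B = 1 + D / ?V + D' / ?W + 2 * D / (?V * 1) + 2 * D' / (?W * R)"
    have B: "1 \<le> B" "D / ?V + D' / ?W \<le> B" "2 * D / (?V * 1) + 2 * D' / (?W * R) \<le> B"
    proof -
      have "0 \<le> D / ?V" "0 \<le> D' / ?W" "0 \<le> 2 * D / (?V * 1)" "0 \<le> 2 * D' / (?W * R)"
        using D D' V R by auto
      then show "1 \<le> B" "D / ?V + D' / ?W \<le> B" "2 * D / (?V * 1) + 2 * D' / (?W * R) \<le> B"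
        unfolding B_def by linarith+
    qed
    have "F (\<lambda>z. \<phi> z - \<tau> z) = 0"
    proof (rule compact_support_vanish[OF diff, of "2 * R" x B])
      show "\<phi> z - \<tau> z = 0" if "2 * R \<le> dist x z" for z using tail_props(4)[OF R that] by (simp add: \<tau>_def)
      show "norm (\<phi> z - \<tau> z) \<le> B" for z
        using norm_triangle_ineq4[of "\<phi> z" "\<tau> z"] molecule_bounded[OF D(2,1), of z] molecule_bounded[OF \<tau> D' R, of z] B by simp
      show "norm (\<phi> u - \<tau> u - (\<phi> v - \<tau> v)) \<le> B * dist u v" for u v
      proof -
        have "norm (\<phi> u - \<tau> u - (\<phi> v - \<tau> v)) = norm ((\<phi> u - \<phi> v) - (\<tau> u - \<tau> v))" by (simp add: algebra_simps)
        also have "\<dots> \<le> norm (\<phi> u - \<phi> v) + norm (\<tau> u - \<tau> v)" by (rule norm_triangle_ineq4)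
        also have "\<dots> \<le> 2 * D / (?V * 1) * dist u v + 2 * D' / (?W * R) * dist u v"
          by (intro add_mono molecule_lipschitz D D' \<tau> R) auto
        also have "\<dots> = (2 * D / (?V * 1) + 2 * D' / (?W * R)) * dist u v" by (simp add: distrib_right)
        also have "\<dots> \<le> B * dist u v" using B by (intro mult_right_mono) auto
        finally show ?thesis .
      qed
    qed (use R B in auto)
    then have "F \<phi> = F \<tau>" using linear_on_testsD(2)[OF lin \<phi> \<tau>T] by simp
    also have "norm \<dots> \<le> c3 * D' * R powr s * g x" by (rule all_molecules[OF x \<tau> D' R])
    also have "\<dots> = C * (R powr s / R\<^sup>2)" by (simp add: C_def D'_def)
    also have "R powr s / R\<^sup>2 = R powr (s - 2)" using R by (simp add: powr_diff)
    finally show ?thesis .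
  qed
  have "((\<lambda>R. C * R powr (s - 2)) \<longlongrightarrow> C * 0) at_top"
    using s by (intro tendsto_mult tendsto_const tendsto_neg_powr filterlim_ident) auto
  moreover have "eventually (\<lambda>R. norm (F \<phi>) \<le> C * R powr (s - 2)) at_top"
    using eventually_gt_at_top[of 0] by eventually_elim (rule bound)
  ultimately have "norm (F \<phi>) \<le> C * 0" by (intro tendsto_lowerbound) auto
  then show ?thesis by simp
qed

end

end

text \<open>A space of finite diameter would be a single ball, hence of finite measure. With
  infinite diameter the upper restrictions on \<open>r\<close> and \<open>l\<close> in
  \<open>volume_growth\<close> always hold, and doubling is available at all scales.\<close>

lemma (in rd_space) doubling_space_of_infinite_measure:
  assumes "emeasure M UNIV = \<infinity>"
  obtains K where "doubling_space M K n"
proof -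
  have "ext_diam (UNIV :: 'a set) = \<infinity>"
  proof (rule ccontr)
    assume fin: "ext_diam (UNIV :: 'a set) \<noteq> \<infinity>"
    have le: "ereal (dist x y) \<le> ext_diam (UNIV :: 'a set)" for x y :: 'a
    proof -
      have "ereal (dist x y) \<le> (SUP y. ereal (dist x y))"
        by (rule SUP_upper[of y UNIV "\<lambda>y. ereal (dist x y)"]) simp
      also have "\<dots> \<le> (SUP x::'a. SUP y. ereal (dist x y))"
        by (rule SUP_upper[of x UNIV "\<lambda>x. SUP y. ereal (dist x y)"]) simp
      finally show ?thesis by (simp add: ext_diam_def)
    qed
    fix x :: 'a
    obtain d where d: "ext_diam (UNIV :: 'a set) = ereal d"
      using fin le[of x x] by (cases "ext_diam (UNIV :: 'a set)") auto
    have d0: "0 \<le> d" using le[of x x] d by simp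
    have "dist x y < d + 1" for y using le[of x y] d by simp
    then have "UNIV = ball x (d + 1)" by auto
    then show False using ball_pos_finite[of "d + 1" x] d0 assms by simp
  qed
  note diam = this
  obtain C2 where C2: "1 \<le> C2" and
    C: "\<forall>x r l. 0 < r \<and> ereal r < 2 * ext_diam (UNIV :: 'a set) \<and> 1 \<le> l \<and> ereal l < 2 * ext_diam (UNIV :: 'a set) / ereal r \<longrightarrow>
       vol M x (l * r) \<le> C2 * l powr n * vol M x r"
    using volume_growth by metis
  have g: "vol M x (l * r) \<le> C2 * l powr n * vol M x r" if "0 < r" "1 \<le> l" for x r l
    using C that by (simp add: diam)
  have "doubling_space M C2 n"
  proof
    show "emeasure M (ball x r) < \<infinity>" for x r
      using ball_pos_finite[of r x] by (cases "0 < r") (auto simp: not_less ball_empty)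
    show "0 < n" using dim_bounds by linarith
  qed (use regular ball_pos_finite C2 g in \<open>auto simp: regular_borel_measure_def\<close>)
  then show ?thesis by (rule that)
qed

section \<open>Comparison of the two norms\<close>

lemma Lp_norm_cmult_le:
  assumes [measurable]: "g \<in> borel_measurable M" and "0 < c" "0 < p" "\<And>x. 0 \<le> g x"
  shows "Lp_norm M p (\<lambda>x. ennreal (c * g x)) \<le> ennreal c * Lp_norm M p (\<lambda>x. ennreal (g x))"
proof -
  have "(\<integral>\<^sup>+x. epowr (ennreal (c * g x)) p \<partial>M) = (\<integral>\<^sup>+x. ennreal (c powr p) * epowr (ennreal (g x)) p \<partial>M)"
    using assms by (simp add: ennreal_mult epowr_cmult)
  also have "\<dots> = ennreal (c powr p) * (\<integral>\<^sup>+x. epowr (ennreal (g x)) p \<partial>M)" by (rule nn_integral_cmult) measurable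
  finally have "Lp_norm M p (\<lambda>x. ennreal (c * g x)) \<le> ennreal ((c powr p) powr (1 / p)) * Lp_norm M p (\<lambda>x. ennreal (g x))"
    using assms by (intro Lp_norm_le) auto
  then show ?thesis using assms by (simp add: powr_powr)
qed

lemma Lp_norm_finite_iff:
  assumes "\<And>x. 0 \<le> g x"
  shows "Lp_norm M p (\<lambda>x. ennreal (g x)) < top \<longleftrightarrow> (\<integral>\<^sup>+x. ennreal (g x powr p) \<partial>M) < top"
  unfolding Lp_norm_def using assms
  by (cases "\<integral>\<^sup>+x. ennreal (g x powr p) \<partial>M") (auto simp: epowr_ennreal epowr_def)

context doubling_space
begin

definition cup :: "real \<Rightarrow> real \<Rightarrow> real" where
  "cup s p = c6 * (cosc s * clp s p powr (1 / p))"

definition clow :: "real \<Rightarrow> real" where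
  "clow s = 2 * clim s * (cct * cgr)"

lemma clow_pos: "0 < s \<Longrightarrow> 0 < clow s"
  using cdif_le_clim(2)[of s] cct_pos cgr_pos by (simp add: clow_def)

lemma hajlasz_functionI:
  assumes s: "0 < s" "s \<le> 1" and p: "n / (n + s) < p"
    and f: "f \<in> borel_measurable M" and g: "g \<in> hajlasz_gradients M s p f"
  obtains E where "hajlasz_function M K n s p f g E"
proof -
  obtain E where "E \<in> null_sets M" "\<forall>x\<in>-E. \<forall>y\<in>-E. norm (f x - f y) \<le> dist x y powr s * (g x + g y)"
    using g by (auto simp: hajlasz_gradients_def)
  then have "hajlasz_function M K n s p f g E"
    using g s p f by unfold_locales (auto simp: hajlasz_gradients_def Lp_norm_finite_iff)
  then show ?thesis by (rule that)
qed

lemma cup_pos: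
  assumes "0 < s" "s \<le> 1" "n / (n + s) < p"
  shows "0 < cup s p"
proof -
  \<comment> \<open>The zero function serves only to make \<open>clp_pos\<close>, proved inside the
    locale, available for these \<open>s\<close> and \<open>p\<close>.\<close>
  interpret hajlasz_function M K n s p "\<lambda>_. 0 :: real" "\<lambda>_. 0" "{}"
    using assms by unfold_locales auto
  show ?thesis using c6_pos cosc_pos[of s] clp_pos by (simp add: cup_def)
qed

lemma grand_TL_norm_integral_functional:
  fixes f :: "'a \<Rightarrow> 'k::{real_normed_field,banach,second_countable_topology}"
  assumes s: "0 < s" "s \<le> 1" and p: "n / (n + s) < p"
    and f: "f \<in> borel_measurable M"
  shows "grand_TL_norm M x1 s p (integral_functional M f) \<le> ennreal (cup s p) * hajlasz_norm M s p f"
proof -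
  \<comment> \<open>With the constant on the left, the infimum on the right can be treated one
    gradient at a time.\<close>
  have "ennreal (1 / cup s p) * grand_TL_norm M x1 s p (integral_functional M f) \<le> hajlasz_norm M s p f"
    unfolding hajlasz_norm_def
  proof (rule INF_greatest)
    fix g assume "g \<in> hajlasz_gradients M s p f"
    then obtain E where "hajlasz_function M K n s p f g E" by (rule hajlasz_functionI[OF s p f])
    then interpret hajlasz_function M K n s p f g E .
    have "grand_TL_norm M x1 s p (integral_functional M f) \<le> ennreal c6 * Lp_norm M p (\<lambda>x. ennreal (cosc s * hg x))"
      using ctl_integral_functional p_pos by (rule grand_TL_norm_le)
    also have "\<dots> \<le> ennreal c6 * (ennreal (cosc s) * Lp_norm M p (\<lambda>x. ennreal (hg x)))"
      using cosc_pos p_pos hg_nonneg by (intro mult_left_mono Lp_norm_cmult_le) auto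
    also have "\<dots> \<le> ennreal c6 * (ennreal (cosc s) * (ennreal (clp s p powr (1 / p)) * Lp_norm M p (\<lambda>x. ennreal (g x))))"
      using clp_pos p_pos hg_Lp hg_nonneg g_nonneg by (intro mult_left_mono Lp_norm_le) (auto simp: epowr_ennreal)
    also have "\<dots> = ennreal (cup s p) * Lp_norm M p (\<lambda>x. ennreal (g x))"
      using c6_pos cosc_pos[of s] by (simp add: cup_def ennreal_mult mult.assoc)
    finally have "ennreal (1 / cup s p) * grand_TL_norm M x1 s p (integral_functional M f)
        \<le> ennreal (1 / cup s p) * (ennreal (cup s p) * Lp_norm M p (\<lambda>x. ennreal (g x)))"
      by (rule mult_left_mono) simp
    also have "\<dots> = Lp_norm M p (\<lambda>x. ennreal (g x))"
      using cup_pos[OF s p] by (simp add: mult.assoc[symmetric] flip: ennreal_mult)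
    finally show "ennreal (1 / cup s p) * grand_TL_norm M x1 s p (integral_functional M f) \<le> Lp_norm M p (\<lambda>x. ennreal (g x))" .
  qed
  then have "ennreal (cup s p) * (ennreal (1 / cup s p) * grand_TL_norm M x1 s p (integral_functional M f))
      \<le> ennreal (cup s p) * hajlasz_norm M s p f"
    by (rule mult_left_mono) simp
  then show ?thesis
    using cup_pos[OF s p] by (simp add: mult.assoc[symmetric] flip: ennreal_mult)
qed

lemma hajlasz_norm_le:
  fixes f :: "'a \<Rightarrow> 'k::{real_normed_field,banach,second_countable_topology}"
  assumes s: "0 < s" and p: "0 < p"
    and g: "g \<in> borel_measurable M" "\<And>x. 0 \<le> g x" "(\<integral>\<^sup>+x. ennreal (g x powr p) \<partial>M) < top"
    and E: "E \<in> null_sets M"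
    and gr: "\<And>x y. x \<notin> E \<Longrightarrow> y \<notin> E \<Longrightarrow> norm (f x - f y) \<le> 2 * clim s * dist x y powr s * (g x + g y)"
    and F: "Lp_norm M p (\<lambda>x. ennreal (g x)) \<le> ennreal (cct * cgr) * G"
  shows "(\<lambda>x. 2 * clim s * g x) \<in> hajlasz_gradients M s p f" "hajlasz_norm M s p f \<le> ennreal (clow s) * G"
proof -
  note cl = cdif_le_clim(2)[OF s]
  have L: "Lp_norm M p (\<lambda>x. ennreal (2 * clim s * g x)) \<le> ennreal (2 * clim s) * Lp_norm M p (\<lambda>x. ennreal (g x))"
    using g(1,2) cl p by (intro Lp_norm_cmult_le) auto
  also have "\<dots> < \<infinity>"
    using Lp_norm_finite_iff[of g M p] g(2,3) by (auto simp: ennreal_mult_less_top)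
  finally show G: "(\<lambda>x. 2 * clim s * g x) \<in> hajlasz_gradients M s p f"
    unfolding hajlasz_gradients_def using g cl E gr
    by (auto intro!: bexI[of _ E] mult_nonneg_nonneg simp: algebra_simps)
  have "hajlasz_norm M s p f \<le> Lp_norm M p (\<lambda>x. ennreal (2 * clim s * g x))"
    unfolding hajlasz_norm_def using G by (rule INF_lower)
  also have "\<dots> \<le> ennreal (2 * clim s) * (ennreal (cct * cgr) * G)"
    by (rule order_trans[OF L mult_left_mono[OF F]]) simp
  also have "\<dots> = ennreal (clow s) * G"
    using cl cct_pos cgr_pos by (simp add: clow_def ennreal_mult mult.assoc)
  finally show "hajlasz_norm M s p f \<le> ennreal (clow s) * G" .
qed

text \<open>For the last claim, the values of the functional on shrinking bumps converge to
  \<open>f\<close> and, by construction, to \<open>lims\<close>. The two functions agree off a null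
  set, so \<open>f\<close> inherits the gradient that the grand norm controls.\<close>

lemma grand_TL_space_integral_functional:
  fixes f :: "'a \<Rightarrow> 'k::{real_normed_field,banach,second_countable_topology}"
  assumes s: "0 < s" "s \<le> 1" and p: "n / (n + s) < p" and f: "f \<in> hajlasz_space M s p"
  shows "locally_integrable M f" "\<phi> \<in> tests x1 \<Longrightarrow> integrable M (\<lambda>x. f x * \<phi> x)"
    "integral_functional M f \<in> grand_TL_space M x1 s p"
    "hajlasz_norm M s p f \<le> ennreal (clow s) * grand_TL_norm M x1 s p (integral_functional M f)"
proof -
  obtain g where fm: "f \<in> borel_measurable M" and g: "g \<in> hajlasz_gradients M s p f"
    using f by (auto simp: hajlasz_space_def Lp_loc_def)
  obtain E where "hajlasz_function M K n s p f g E" using hajlasz_functionI[OF s p fm g] .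
  then interpret hajlasz_function M K n s p f g E .
  show "locally_integrable M f" by (rule f_locally_integrable)
  show "\<phi> \<in> tests x1 \<Longrightarrow> integrable M (\<lambda>x. f x * \<phi> x)" by (rule f_tests_integrable)
  have "hajlasz_norm M s p f \<le> Lp_norm M p (\<lambda>x. ennreal (g x))"
    unfolding hajlasz_norm_def using g by (rule INF_lower)
  also have "\<dots> < \<infinity>" using g_nonneg g_Lp by (simp add: Lp_norm_finite_iff)
  finally have "grand_TL_norm M x1 s p (integral_functional M f) < \<infinity>"
    using grand_TL_norm_integral_functional[OF s p fm, of x1] by (auto simp: ennreal_mult_less_top intro: le_less_trans)
  then show T: "integral_functional M f \<in> grand_TL_space M x1 s p"
    using integral_functional_dual by (simp add: grand_TL_space_def)
  obtain g' N' where g': "ctl x1 s (integral_functional M f) g' N'" "(\<integral>\<^sup>+x. ennreal (g' x powr p) \<partial>M) < top"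
    "Lp_norm M p (\<lambda>x. ennreal (g' x)) \<le> ennreal (cct * cgr) * grand_TL_norm M x1 s p (integral_functional M f)"
    using grand_TL_ctl[OF T p_pos s(1)] .
  let ?h = "lims N' (integral_functional M f)"
  have eq: "f x = ?h x" if x: "x \<notin> N \<union> N'" for x
  proof -
    define C where "C = cpsi * cosc s * hg x + clim s * g' x"
    have "norm (f x - ?h x) \<le> C * r powr s" if r: "0 < r" for r
    proof -
      have "norm (f x - integral_functional M f (psi x r)) \<le> cpsi * cosc s * r powr s * hg x"
        using integral_functional_psi[of x r] x r by (simp add: norm_minus_commute)
      moreover have "norm (integral_functional M f (psi x r) - ?h x) \<le> clim s * r powr s * g' x"
        using lims_approx[OF g'(1) s(1)] x r by simp
      ultimately show ?thesis
        using norm_triangle_mono by (fastforce simp: C_def algebra_simps)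
    qed
    then have "eventually (\<lambda>r. norm (f x - ?h x) \<le> C * r powr s) (at_right 0)"
      unfolding eventually_at_right_field by (intro exI[of _ 1]) auto
    moreover have "((\<lambda>r. C * r powr s) \<longlongrightarrow> C * 0 powr s) (at_right 0)"
      using s by (intro tendsto_mult tendsto_const tendsto_powr') (auto simp: eventually_at_filter)
    ultimately have "norm (f x - ?h x) \<le> C * 0 powr s" by (intro tendsto_lowerbound) auto
    then show ?thesis by simp
  qed
  show "hajlasz_norm M s p f \<le> ennreal (clow s) * grand_TL_norm M x1 s p (integral_functional M f)"
  proof (rule hajlasz_norm_le(2)[OF s(1) p_pos _ _ g'(2) _ _ g'(3)])
    show "N \<union> N' \<in> null_sets M" using N_null ctlD(3)[OF g'(1)] by auto
    show "norm (f x - f y) \<le> 2 * clim s * dist x y powr s * (g' x + g' y)" if "x \<notin> N \<union> N'" "y \<notin> N \<union> N'" for x y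
      using lims_gradient[OF g'(1) s(1), of x y] that by (simp add: eq)
  qed (use ctlD(1,2)[OF g'(1)] in auto)
qed

lemma ctl_diff:
  fixes F F' :: "('a \<Rightarrow> 'k::{real_normed_field,banach,second_countable_topology}) \<Rightarrow> 'k"
  assumes F: "ctl x1 s F g N" and F': "ctl x1 s F' g' N'"
  shows "ctl x1 s (\<lambda>\<phi>. F \<phi> - F' \<phi>) (\<lambda>x. g x + g' x) (N \<union> N')"
  unfolding ctl_def
proof (intro conjI allI impI)
  show "linear_on_tests x1 (\<lambda>\<phi>. F \<phi> - F' \<phi>)"
    using ctlD(4)[OF F] ctlD(4)[OF F'] by (auto simp: linear_on_tests_def algebra_simps)
  fix x r D and \<phi> :: "'a \<Rightarrow> 'k"
  assume h: "x \<notin> N \<union> N'" "0 < r" "0 \<le> D" "molecule x r \<phi> D" "(\<integral>z. \<phi> z \<partial>M) = 0"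
  have "norm (F \<phi> - F' \<phi>) \<le> norm (F \<phi>) + norm (F' \<phi>)" by (rule norm_triangle_ineq4)
  also have "\<dots> \<le> D * r powr s * g x + D * r powr s * g' x"
    using h by (intro add_mono ctlD(5)[OF F] ctlD(5)[OF F']) auto
  finally show "norm (F \<phi> - F' \<phi>) \<le> D * r powr s * (g x + g' x)" by (simp add: distrib_left)
qed (use ctlD(1,2,3)[OF F] ctlD(1,2,3)[OF F'] in auto)

lemma grand_TL_space_representation:
  fixes F :: "('a \<Rightarrow> 'k::{real_normed_field,banach,second_countable_topology}) \<Rightarrow> 'k"
  assumes s: "0 < s" "s \<le> 1" and p: "n / (n + s) < p" and F: "F \<in> grand_TL_space M x1 s p"
  shows "\<exists>h\<in>hajlasz_space M s p. (\<forall>\<phi>\<in>tests x1. F \<phi> = integral_functional M h \<phi>) \<and>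
    hajlasz_norm M s p h \<le> ennreal (clow s) * grand_TL_norm M x1 s p F"
proof -
  have "0 < n / (n + s)" using n_pos s by simp
  then have p_pos: "0 < p" using p by linarith
  obtain g N where g: "ctl x1 s F g N" "(\<integral>\<^sup>+x. ennreal (g x powr p) \<partial>M) < top"
    "Lp_norm M p (\<lambda>x. ennreal (g x)) \<le> ennreal (cct * cgr) * grand_TL_norm M x1 s p F"
    using grand_TL_ctl[OF F p_pos s(1)] .
  define h where "h = lims N F"
  note hm = lims_measurable[OF g(1) s(1), folded h_def]
  note grad = lims_gradient[OF g(1) s(1), folded h_def]
  note gD = ctlD[OF g(1)]
  define G where "G x = 2 * clim s * g x" for x
  have H: "G \<in> hajlasz_gradients M s p h" "hajlasz_norm M s p h \<le> ennreal (clow s) * grand_TL_norm M x1 s p F"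
    using hajlasz_norm_le[OF s(1) p_pos gD(1,2) g(2) gD(3) grad g(3)] by (simp_all add: G_def[abs_def])
  \<comment> \<open>The limit enters the Sobolev half with its own gradient, so its functional is
    controlled too and can be subtracted from \<open>F\<close>.\<close>
  interpret h: hajlasz_function M K n s p h G N
  proof
    show "norm (h x - h y) \<le> dist x y powr s * (G x + G y)" if "x \<notin> N" "y \<notin> N" for x y
      using grad[OF that] by (simp add: G_def algebra_simps)
  qed (use H(1) s p hm gD in \<open>auto simp: hajlasz_gradients_def Lp_norm_finite_iff\<close>)
  have hs: "h \<in> hajlasz_space M s p"
    unfolding hajlasz_space_def using H(1) Lp_loc_of_gradient[OF hm h.g_meas h.g_nonneg h.g_Lp h.E_null h.grad p_pos s(1)] by auto
  have "F \<phi> = integral_functional M h \<phi>" if \<phi>: "\<phi> \<in> tests x1" for \<phi>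
  proof -
    define c0 where "c0 = clim s + cpsi"
    have c0: "0 \<le> c0" using cdif_le_clim(2)[OF s(1)] cpsi_pos by (simp add: c0_def)
    let ?k = "\<lambda>x. g x + cosc s * h.hg x"
    have c: "ctl x1 s (\<lambda>\<phi>. F \<phi> - integral_functional M h \<phi>) ?k (N \<union> h.N)"
      by (rule ctl_diff[OF g(1) h.ctl_integral_functional])
    have "F \<phi> - integral_functional M h \<phi> = 0"
    proof (rule functional_vanishes[OF c s p c0 _ _ \<phi>])
      show "(\<integral>\<^sup>+x. ennreal (?k x powr p) \<partial>M) < top"
      proof -
        have [measurable]: "g \<in> borel_measurable M" by (rule gD)
        have "(\<integral>\<^sup>+x. ennreal (?k x powr p) \<partial>M)
           \<le> (\<integral>\<^sup>+x. ennreal (2 powr p) * (ennreal (g x powr p) + ennreal (cosc s powr p) * ennreal (h.hg x powr p)) \<partial>M)"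
        proof (rule nn_integral_mono)
          fix x
          have "?k x powr p \<le> 2 powr p * (g x powr p + (cosc s * h.hg x) powr p)"
            using gD(2)[of x] cosc_pos[of s] h.hg_nonneg[of x] p_pos by (intro powr_add_le) auto
          also have "(cosc s * h.hg x) powr p = cosc s powr p * h.hg x powr p"
            using cosc_pos[of s] h.hg_nonneg[of x] by (simp add: powr_mult)
          finally show "ennreal (?k x powr p) \<le> ennreal (2 powr p) * (ennreal (g x powr p) + ennreal (cosc s powr p) * ennreal (h.hg x powr p))"
            by (simp add: ennreal_leI flip: ennreal_mult ennreal_plus)
        qed
        also have "\<dots> = ennreal (2 powr p) * ((\<integral>\<^sup>+x. ennreal (g x powr p) \<partial>M) + ennreal (cosc s powr p) * (\<integral>\<^sup>+x. ennreal (h.hg x powr p) \<partial>M))"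
          by (simp add: nn_integral_cmult nn_integral_add)
        also have "\<dots> < top"
        proof -
          have "(\<integral>\<^sup>+x. ennreal (h.hg x powr p) \<partial>M) < top"
            using h.hg_Lp h.g_Lp by (auto simp: ennreal_mult_less_top intro: le_less_trans)
          then show ?thesis using g(2) by (auto simp: ennreal_mult_less_top)
        qed
        finally show ?thesis .
      qed
      fix x and r :: real assume x: "x \<notin> N \<union> h.N" and r: "0 < r"
      \<comment> \<open>Both functionals approximate the same value \<open>h x\<close> on the bump.
        This is the extra smallness that turns control on mean-zero molecules into control on all of
        them.\<close>
      have "norm ((F (psi x r) - h x) - (integral_functional M h (psi x r) - h x))
         \<le> norm (F (psi x r) - h x) + norm (integral_functional M h (psi x r) - h x)" by (rule norm_triangle_ineq4)
      also have "\<dots> \<le> clim s * r powr s * g x + cpsi * cosc s * r powr s * h.hg x"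
        using x r lims_approx[OF g(1) s(1), of x r] h.integral_functional_psi[of x r] by (intro add_mono) (auto simp: h_def)
      also have "\<dots> \<le> c0 * r powr s * g x + c0 * r powr s * (cosc s * h.hg x)"
      proof (rule add_mono)
        show "clim s * r powr s * g x \<le> c0 * r powr s * g x"
          using gD(2) cpsi_pos by (intro mult_right_mono) (auto simp: c0_def)
        have "cpsi * (r powr s * (cosc s * h.hg x)) \<le> c0 * (r powr s * (cosc s * h.hg x))"
          using cdif_le_clim(2)[OF s(1)] cosc_pos[of s] h.hg_nonneg[of x] by (intro mult_right_mono) (auto simp: c0_def)
        then show "cpsi * cosc s * r powr s * h.hg x \<le> c0 * r powr s * (cosc s * h.hg x)" by (simp add: mult_ac)
      qed
      finally show "norm (F (psi x r) - integral_functional M h (psi x r)) \<le> c0 * r powr s * ?k x"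
        by (simp add: distrib_left)
    qed
    then show ?thesis by simp
  qed
  then show ?thesis using hs H(2) by blast
qed

lemma grand_TL_norm_cong:
  assumes "\<And>\<phi>. \<phi> \<in> tests x1 \<Longrightarrow> F \<phi> = F' \<phi>"
  shows "grand_TL_norm M x1 s p F = grand_TL_norm M x1 s p F'"
proof -
  have "(SUP \<phi>\<in>grand_class M x1 k x. ennreal (norm (F \<phi>))) = (SUP \<phi>\<in>grand_class M x1 k x. ennreal (norm (F' \<phi>)))" for k x
    using assms by (intro SUP_cong) (auto simp: grand_class_def test_space0_def)
  then show ?thesis by (simp add: grand_TL_norm_def)
qed

end

theorem theorem1p3:
  fixes M :: "'a::metric_space measure" and \<kappa> n s p :: real and x1 :: 'a
  assumes "rd_space M \<kappa> n"
    and "emeasure M UNIV = \<infinity>"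
    and "0 < s" "s \<le> 1"
    and "n / (n + s) < p"
  shows "\<exists>C::real. 0 < C \<and>
    (\<forall>f :: 'a \<Rightarrow> 'k::{real_normed_field, banach, second_countable_topology}.
       f \<in> hajlasz_space M s p \<longrightarrow>
         locally_integrable M f \<and>
         (\<forall>\<phi>\<in>test_space M x1 1 1 2. integrable M (\<lambda>x. f x * \<phi> x)) \<and>
         integral_functional M f \<in> grand_TL_space M x1 s p \<and>
         grand_TL_norm M x1 s p (integral_functional M f) \<le> ennreal C * hajlasz_norm M s p f \<and>
         hajlasz_norm M s p f \<le> ennreal C * grand_TL_norm M x1 s p (integral_functional M f)) \<and>
    (\<forall>F :: ('a \<Rightarrow> 'k) \<Rightarrow> 'k.
       F \<in> grand_TL_space M x1 s p \<longrightarrow>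
         (\<exists>h\<in>hajlasz_space M s p. locally_integrable M h \<and>
            (\<exists>c. \<forall>\<phi>\<in>test_space M x1 1 1 2.
               F \<phi> = integral_functional M h \<phi> + c * (\<integral>x. \<phi> x \<partial>M)) \<and>
            hajlasz_norm M s p h \<le> ennreal C * grand_TL_norm M x1 s p F \<and>
            grand_TL_norm M x1 s p F \<le> ennreal C * hajlasz_norm M s p h))"
proof -
  obtain K where "doubling_space M K n"
    using rd_space.doubling_space_of_infinite_measure[OF assms(1,2)] .
  then interpret doubling_space M K n .
  note s = assms(3,4) and p = assms(5)
  define C where "C = cup s p + clow s"
  have C: "0 < C" "cup s p \<le> C" "clow s \<le> C"
    using cup_pos[OF s p] clow_pos[OF s(1)] by (auto simp: C_def)
  have up: "u \<le> ennreal C * v" if "u \<le> ennreal c * v" "c \<le> C" for u v :: ennreal and c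
    using that(1) by (rule order_trans) (intro mult_right_mono ennreal_leI that(2), simp)
  have fm: "f \<in> borel_measurable M" if "f \<in> hajlasz_space M s p" for f :: "'a \<Rightarrow> 'k"
    using that by (simp add: hajlasz_space_def Lp_loc_def)
  have grand: "grand_TL_norm M x1 s p (integral_functional M f) \<le> ennreal C * hajlasz_norm M s p f"
    if "f \<in> hajlasz_space M s p" for f :: "'a \<Rightarrow> 'k"
    by (rule up[OF grand_TL_norm_integral_functional[OF s p fm[OF that]] C(2)])
  show ?thesis
  proof (intro exI[of _ C] conjI allI impI ballI)
    fix f :: "'a \<Rightarrow> 'k" assume f: "f \<in> hajlasz_space M s p"
    note * = grand_TL_space_integral_functional[OF s p f]
    show "locally_integrable M f" by (rule *(1))
    show "integrable M (\<lambda>x. f x * \<phi> x)" if "\<phi> \<in> tests x1" for \<phi> by (rule *(2)[OF that])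
    show "integral_functional M f \<in> grand_TL_space M x1 s p" by (rule *(3))
    show "grand_TL_norm M x1 s p (integral_functional M f) \<le> ennreal C * hajlasz_norm M s p f"
      by (rule grand[OF f])
    show "hajlasz_norm M s p f \<le> ennreal C * grand_TL_norm M x1 s p (integral_functional M f)"
      by (rule up[OF *(4) C(3)])
  next
    fix F :: "('a \<Rightarrow> 'k) \<Rightarrow> 'k" assume F: "F \<in> grand_TL_space M x1 s p"
    obtain h where h: "h \<in> hajlasz_space M s p" "\<forall>\<phi>\<in>tests x1. F \<phi> = integral_functional M h \<phi>"
      "hajlasz_norm M s p h \<le> ennreal (clow s) * grand_TL_norm M x1 s p F"
      using grand_TL_space_representation[OF s p F] by blast
    have "grand_TL_norm M x1 s p F = grand_TL_norm M x1 s p (integral_functional M h)"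
      using h(2) by (intro grand_TL_norm_cong) simp
    \<comment> \<open>The additive constant is 0: bumps of integral 1 recover \<open>h\<close>
      together with its constant.\<close>
    then show "\<exists>h\<in>hajlasz_space M s p. locally_integrable M h \<and>
        (\<exists>c. \<forall>\<phi>\<in>tests x1. F \<phi> = integral_functional M h \<phi> + c * (\<integral>x. \<phi> x \<partial>M)) \<and>
        hajlasz_norm M s p h \<le> ennreal C * grand_TL_norm M x1 s p F \<and>
        grand_TL_norm M x1 s p F \<le> ennreal C * hajlasz_norm M s p h"
      using h grand[OF h(1)] grand_TL_space_integral_functional(1)[OF s p h(1)] up[OF h(3) C(3)]
      by (intro bexI[of _ h] conjI exI[of _ 0]) auto
  qed (rule C(1))
qed

end
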